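(* For every integer $q\ge 1$ there exist constants $c_q,C_q,C_q'>0$ depending only on $q$ such that the following holds. Let $m,d_1,d_2\ge 1$ be integers, $d=\max\{d_1,d_2\}$, let $h$ be a real random variable with zero mean and unit variance, and let $$Y=\sum_{i_1,\ldots,i_q\in[m]} h^{(1)}_{i_1}\cdots h^{(q)}_{i_q}\,A_{i_1,\ldots,i_q}$$ be a decoupled matrix chaos of order $q$, where $A_{i_1,\ldots,i_q}$ are deterministic real $d_1\times d_2$ matrices and the $h^{(t)}_i$ ($t\in[q]$, $i\in[m]$) are i.i.d. copies of $h$. Define $\alpha(h)=\|h\|_{L^{\log(d+m)}}$. Then $$c_q\Big(\sigma(\mathcal A)-C_q\,\alpha(h)^q\log(d+m)^{\frac q2}\,r(\mathcal A)\Big)\;\le\;\mathbb E\|Y\|\;\le\; C_q'\Big(\log(d+m)^{\frac q2}\,\sigma(\mathcal A)+\alpha(h)^q\log(d+m)^{\frac{q+1}{2}}\,r(\mathcal A)\Big).$$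
   Context: $[m]=\{1,\dots,m\}$; $\|\cdot\|$ is the operator (spectral) norm of a matrix; $\|h\|_{L^p}=(\mathbb E|h|^p)^{1/p}$. Coefficient tensor: $\mathcal A$ is the tensor of order $q+2$ with entries $\mathcal A_{i_1,\ldots,i_q,i_{q+1},i_{q+2}}=(A_{i_1,\ldots,i_q})_{i_{q+1},i_{q+2}}$, $i_1,\dots,i_q\in[m]$, $i_{q+1}\in[d_1]$, $i_{q+2}\in[d_2]$. Flattenings: for $R,C\subseteq[q+2]$, $$\mathcal A_{[R|C]}=\sum_{i_1,\ldots,i_{q+2}}\Big(\bigotimes_{t\in R}e_{i_t}\Big)\otimes\Big(\bigotimes_{t\in C}e_{i_t}^\top\Big)\,\mathcal A_{i_1,\ldots,i_{q+2}},$$ where $e_i$ are standard basis column vectors. A coordinate may appear in both $R$ and $C$; e.g. for $q=1$, $R=\{1,2\}$, $C=\{1,3\}$, $(\mathcal A_{[R|C]})_{(i_1,i_2),(i_1',i_3)}=1_{i_1=i_1'}\mathcal A_{i_1,i_2,i_3}$. Parameters: $$\sigma(\mathcal A)=\max\{\|\mathcal A_{[R|C]}\| : R=[q+2]\setminus C,\ q+1\in R,\ q+2\in C\},$$ $$r(\mathcal A)=\max\{\|\mathcal A_{[R|C]}\| : R\cup C=[q+2],\ q+1\in R,\ q+2\in C,\ \emptyset\ne R\cap C\subseteq[q]\}.$$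
   Formalization: In the lower bound α(h) is the L^{max(2, log(d+m))} norm, since the bound with exponent log(d+m) < 2 (d+m ≤ 7) is false; the random variables live on a probability space with underlying set of real functions on ℕ×ℕ, which realizes every i.i.d. family up to joint law. *)

theory Defs
  imports "HOL-Probability.Probability"
begin

text \<open>Finite matrices with arbitrary index types are functions of a row and a column index, used
  only on finite index sets \<open>I\<close> (rows) and \<open>J\<close> (columns). This is their spectral norm.\<close>

definition op_norm :: "'i set \<Rightarrow> 'j set \<Rightarrow> ('i \<Rightarrow> 'j \<Rightarrow> real) \<Rightarrow> real" where
  "op_norm I J B = Sup {L2_set (\<lambda>i. \<Sum>j\<in>J. B i j * x j) I | x. L2_set x J \<le> 1}"

text \<open>A multi-index over a set \<open>S\<close> of positions is an element of \<open>Pi\<^sub>E S (\<lambda>t. {1..D t})\<close>, where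
  \<open>D t\<close> is the dimension in position \<open>t\<close>. For the tensor of a matrix chaos of order \<open>q\<close>, the
  positions are \<open>{1..q + 2}\<close>.\<close>

definition chaos_dim :: "nat \<Rightarrow> nat \<Rightarrow> nat \<Rightarrow> nat \<Rightarrow> nat \<Rightarrow> nat" where
  "chaos_dim q m d1 d2 t = (if t \<le> q then m else if t = q + 1 then d1 else d2)"

definition multi_indices :: "(nat \<Rightarrow> nat) \<Rightarrow> nat set \<Rightarrow> (nat \<Rightarrow> nat) set" where
  "multi_indices D S = Pi\<^sub>E S (\<lambda>t. {1..D t})"

text \<open>The coefficients \<open>A i\<close>, for multi-indices \<open>i\<close> over \<open>{1..q}\<close>, are \<open>d1 \<times> d2\<close> matrices.\<close>

definition coeff_tensor ::
    "nat \<Rightarrow> ((nat \<Rightarrow> nat) \<Rightarrow> nat \<Rightarrow> nat \<Rightarrow> real) \<Rightarrow> (nat \<Rightarrow> nat) \<Rightarrow> real" where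
  "coeff_tensor q A i = A (restrict i {1..q}) (i (q + 1)) (i (q + 2))"

text \<open>The flattening, as a matrix with rows \<open>multi_indices D R\<close> and columns \<open>multi_indices D C\<close>:
  the vector \<open>\<Otimes>\<^sub>t\<^sub>\<in>\<^sub>R e(i\<^sub>t)\<close> is the standard basis vector of the
  multi-index \<open>restrict i R\<close>.\<close>

definition flattening ::
    "nat \<Rightarrow> (nat \<Rightarrow> nat) \<Rightarrow> ((nat \<Rightarrow> nat) \<Rightarrow> real) \<Rightarrow> nat set \<Rightarrow> nat set
      \<Rightarrow> (nat \<Rightarrow> nat) \<Rightarrow> (nat \<Rightarrow> nat) \<Rightarrow> real" where
  "flattening n D T R C r c =
    (\<Sum>i\<in>multi_indices D {1..n}. of_bool (r = restrict i R) * of_bool (c = restrict i C) * T i)"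

definition flattening_norm ::
    "nat \<Rightarrow> (nat \<Rightarrow> nat) \<Rightarrow> ((nat \<Rightarrow> nat) \<Rightarrow> real) \<Rightarrow> nat set \<Rightarrow> nat set \<Rightarrow> real" where
  "flattening_norm n D T R C =
    op_norm (multi_indices D R) (multi_indices D C) (flattening n D T R C)"

definition chaos_sigma ::
    "nat \<Rightarrow> nat \<Rightarrow> nat \<Rightarrow> nat \<Rightarrow> ((nat \<Rightarrow> nat) \<Rightarrow> nat \<Rightarrow> nat \<Rightarrow> real) \<Rightarrow> real" where
  "chaos_sigma q m d1 d2 A =
    Max {flattening_norm (q + 2) (chaos_dim q m d1 d2) (coeff_tensor q A) R C | R C.
      C \<subseteq> {1..q + 2} \<and> R = {1..q + 2} - C \<and> q + 1 \<in> R \<and> q + 2 \<in> C}"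

definition chaos_r ::
    "nat \<Rightarrow> nat \<Rightarrow> nat \<Rightarrow> nat \<Rightarrow> ((nat \<Rightarrow> nat) \<Rightarrow> nat \<Rightarrow> nat \<Rightarrow> real) \<Rightarrow> real" where
  "chaos_r q m d1 d2 A =
    Max {flattening_norm (q + 2) (chaos_dim q m d1 d2) (coeff_tensor q A) R C | R C.
      R \<union> C = {1..q + 2} \<and> q + 1 \<in> R \<and> q + 2 \<in> C \<and> R \<inter> C \<noteq> {} \<and> R \<inter> C \<subseteq> {1..q}}"

text \<open>The variable in copy \<open>t\<close> with index \<open>i\<close> is \<open>H t i\<close>.\<close>

definition matrix_chaos ::
    "nat \<Rightarrow> nat \<Rightarrow> (nat \<Rightarrow> nat \<Rightarrow> 'a \<Rightarrow> real) \<Rightarrow> ((nat \<Rightarrow> nat) \<Rightarrow> nat \<Rightarrow> nat \<Rightarrow> real)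
      \<Rightarrow> 'a \<Rightarrow> nat \<Rightarrow> nat \<Rightarrow> real" where
  "matrix_chaos q m H A \<omega> j k =
    (\<Sum>i\<in>multi_indices (\<lambda>_. m) {1..q}. (\<Prod>t\<in>{1..q}. H t (i t) \<omega>) * A i j k)"

text \<open>The value is infinite when the moment is, whereas the Bochner integral would then be 0.\<close>

definition Lp_norm :: "'a measure \<Rightarrow> real \<Rightarrow> ('a \<Rightarrow> real) \<Rightarrow> ereal" where
  "Lp_norm M p h =
    (if integrable M (\<lambda>\<omega>. \<bar>h \<omega>\<bar> powr p)
     then ereal ((\<integral>\<omega>. \<bar>h \<omega>\<bar> powr p \<partial>M) powr (1 / p)) else \<infinity>)"

definition iid_copies ::
    "'a measure \<Rightarrow> nat \<Rightarrow> nat \<Rightarrow> ('a \<Rightarrow> real) \<Rightarrow> (nat \<Rightarrow> nat \<Rightarrow> 'a \<Rightarrow> real) \<Rightarrow> bool" where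
  "iid_copies M q m h H \<longleftrightarrow>
    prob_space.indep_vars M (\<lambda>_. borel) (\<lambda>(t, i). H t i) ({1..q} \<times> {1..m}) \<and>
    (\<forall>t\<in>{1..q}. \<forall>i\<in>{1..m}. distr M borel (H t i) = distr M borel h)"

text \<open>In the theorem, the sample space has the fixed type \<open>nat \<times> nat \<Rightarrow> real\<close> because the constants,
  chosen first, could otherwise depend on a type variable. Up to joint law nothing is lost: the
  product space carries every family of i.i.d. copies.

  The lower bound uses the exponent \<open>max 2 (ln (d + m))\<close>, which differs from \<open>ln (d + m)\<close> only for
  \<open>d + m \<le> 7\<close>. With an exponent \<open>p < 2\<close> it would be false there: if \<open>h = \<plusminus>K\<close> with probability
  \<open>1 / (2 * K\<^sup>2)\<close> each and \<open>h = 0\<close> otherwise, then \<open>h\<close> has mean 0 and variance 1, but both its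
  \<open>L\<^sup>p\<close> norm and the expected norm of the chaos tend to 0 as \<open>K\<close> grows.\<close>

end

theory Submission
  imports Defs
begin

text \<open>Conditionally on all the other variables, the chaos is a sum \<open>\<Sum>\<^sub>k x\<^sub>k A\<^sub>k\<close> with independent scalar
  coefficients. Putting the \<open>A\<^sub>k\<close> side by side, on top of each other, or on the diagonal of a block matrix
  moves the position \<open>k\<close> of the tensor to the columns, to the rows, or to both, so that all three parameters
  of a single sum are again flattenings and the theorem follows by removing one position at a time.

  For a single sum, the noncommutative Khintchine inequality compares the norm with \<open>\<parallel>\<Sum>\<^sub>k x\<^sub>k\<^sup>2 A\<^sub>k\<^sup>T A\<^sub>k\<parallel>\<^sup>1\<^sup>/\<^sup>2\<close> and
  its transpose. Their squares deviate from the deterministic value by the norm of \<open>\<Sum>\<^sub>k (x\<^sub>k\<^sup>2 - 1) A\<^sub>k\<^sup>T A\<^sub>k\<close>,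
  to which the Khintchine inequality applies once more; this is small when all \<open>\<parallel>A\<^sub>k\<parallel>\<close> are, and it gives the upper
  and the lower bound at once. When the position removed lies on both sides, the trivial bound
  \<open>\<parallel>\<Sum>\<^sub>k x\<^sub>k\<^sup>2 A\<^sub>k\<^sup>T A\<^sub>k\<parallel> \<le> max x\<^sub>k\<^sup>2 \<parallel>\<Sum>\<^sub>k A\<^sub>k\<^sup>T A\<^sub>k\<parallel>\<close> saves a factor \<open>log\<^sup>1\<^sup>/\<^sup>2\<close>, which is what makes the induction close.

  The Khintchine inequality is proved through trace moments, by Tropp's discrete integration by parts, and without
  the spectral theorem.\<close>

section \<open>The spectral norm on finite index sets\<close>

text \<open>A single number \<open>p\<close> is both the order of the moments and the scale of all
  logarithms. Every dimension is at most \<open>exp p\<close>, so a flattening of a tensor with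
  \<open>n\<close> positions has at most \<open>exp (n * p)\<close> rows and columns, and the
  dimension enters moments of order about \<open>p\<close> only through a constant depending on
  \<open>n\<close>.

  The obstacle is the bookkeeping of logarithms. Removing a position leaves a remainder in which
  that position lies on both sides, at the cost \<open>a * p\<close>. Treating this remainder by the
  sharp two-term bound would create further remainders and lose more logarithms. It is bounded
  crudely instead, at the cost \<open>a * sqrt p\<close> for each remaining position, which gives
  \<open>a ^ q * sqrt p ^ (q + 1)\<close> in total.

  To survive integration over the other variables, the bounds for a single sum must be linear in the
  norms. For this reason the deviation of the squared norms is converted back into an additive error
  for the norms themselves.

  Random signs form a finite set of vectors, so the moment estimates are finite sums, and
  integration concerns only powers of one law.\<close>

abbreviation mat_vec :: "'j set \<Rightarrow> ('i \<Rightarrow> 'j \<Rightarrow> real) \<Rightarrow> ('j \<Rightarrow> real) \<Rightarrow> 'i \<Rightarrow> real" where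
  "mat_vec J B x \<equiv> \<lambda>i. \<Sum>j\<in>J. B i j * x j"

lemma L2_set_power2: "(L2_set f A)\<^sup>2 = (\<Sum>i\<in>A. (f i)\<^sup>2)"
  by (simp add: L2_set_def sum_nonneg)

lemma L2_set_scale: "L2_set (\<lambda>i. c * f i) A = \<bar>c\<bar> * L2_set f A"
  by (simp add: L2_set_def power_mult_distrib sum_distrib_left [symmetric] real_sqrt_mult)

lemma abs_sum_mult_le_L2_set: "\<bar>\<Sum>i\<in>A. f i * g i\<bar> \<le> L2_set f A * L2_set g A"
proof -
  have "\<bar>\<Sum>i\<in>A. f i * g i\<bar> \<le> (\<Sum>i\<in>A. \<bar>f i\<bar> * \<bar>g i\<bar>)"
    using sum_abs[of "\<lambda>i. f i * g i" A] by (simp add: abs_mult)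
  also have "\<dots> \<le> L2_set f A * L2_set g A" by (rule L2_set_mult_ineq)
  finally show ?thesis .
qed

text \<open>Cauchy-Schwarz in every row bounds the image by the Frobenius norm. This makes the
  supremum in \<open>op_norm\<close> finite, and it settles vectors with
  \<open>L2_set x J = 0\<close>, which cannot be normalised.\<close>

lemma L2_set_mat_vec_le:
  "L2_set (mat_vec J B x) I \<le> L2_set (\<lambda>i. L2_set (B i) J) I * L2_set x J"
proof -
  have "L2_set (mat_vec J B x) I = L2_set (\<lambda>i. \<bar>mat_vec J B x i\<bar>) I"
    by (simp add: L2_set_def)
  also have "\<dots> \<le> L2_set (\<lambda>i. L2_set (B i) J * L2_set x J) I"
    by (intro L2_set_mono abs_sum_mult_le_L2_set) auto
  also have "\<dots> = L2_set (\<lambda>i. L2_set (B i) J) I * L2_set x J"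
    by (simp add: L2_set_left_distrib)
  finally show ?thesis .
qed

lemma bdd_above_op_norm: "bdd_above {L2_set (mat_vec J B x) I | x. L2_set x J \<le> 1}"
proof (rule bdd_aboveI, safe)
  fix x assume x: "L2_set x J \<le> 1"
  show "L2_set (mat_vec J B x) I \<le> L2_set (\<lambda>i. L2_set (B i) J) I"
    using L2_set_mat_vec_le[of B x J I] mult_left_mono[OF x L2_set_nonneg[of "\<lambda>i. L2_set (B i) J" I]]
    by simp
qed

lemma L2_set_mat_vec_le_op_norm_unit:
  "L2_set x J \<le> 1 \<Longrightarrow> L2_set (mat_vec J B x) I \<le> op_norm I J B"
  unfolding op_norm_def by (intro cSup_upper bdd_above_op_norm) auto

lemma op_norm_nonneg: "0 \<le> op_norm I J B"
proof -
  have "L2_set (mat_vec J B (\<lambda>_. 0)) I \<le> op_norm I J B"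
    by (rule L2_set_mat_vec_le_op_norm_unit) (simp add: L2_set_0')
  then show ?thesis by (simp add: L2_set_0')
qed

lemma L2_set_mat_vec_le_op_norm:
  "L2_set (mat_vec J B x) I \<le> op_norm I J B * L2_set x J"
proof (cases "L2_set x J = 0")
  case True
  then show ?thesis using L2_set_mat_vec_le[of B x J I] by simp
next
  case False
  define c where "c = 1 / L2_set x J"
  have c: "c > 0" using False by (simp add: c_def less_le)
  have "L2_set (mat_vec J B (\<lambda>j. c * x j)) I \<le> op_norm I J B"
    using False c by (intro L2_set_mat_vec_le_op_norm_unit, unfold L2_set_scale) (simp add: c_def)
  moreover have "mat_vec J B (\<lambda>j. c * x j) = (\<lambda>i. c * mat_vec J B x i)"
    by (simp add: sum_distrib_left mult_ac)
  ultimately have "c * L2_set (mat_vec J B x) I \<le> op_norm I J B"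
    using c by (simp add: L2_set_scale)
  then show ?thesis using False by (simp add: c_def field_simps less_le)
qed

lemma op_norm_leI:
  assumes "\<And>x. L2_set (mat_vec J B x) I \<le> K * L2_set x J" "0 \<le> K"
  shows "op_norm I J B \<le> K"
  unfolding op_norm_def
proof (rule cSup_least)
  show "{L2_set (mat_vec J B x) I |x. L2_set x J \<le> 1} \<noteq> {}"
    by (auto intro!: exI[of _ "\<lambda>_. 0"] simp: L2_set_0')
  fix z assume "z \<in> {L2_set (mat_vec J B x) I |x. L2_set x J \<le> 1}"
  then obtain x where "z = L2_set (mat_vec J B x) I" "L2_set x J \<le> 1" by auto
  then show "z \<le> K"
    using assms(1)[of x] mult_left_mono[of "L2_set x J" 1 K] assms(2) by simp
qed

text \<open>The form \<open>y^T B x\<close> is linear in \<open>B\<close> and treats rows and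
  columns alike, so transposition, sums and expectations can be carried out on numbers before the
  supremum is taken.\<close>

definition bil :: "'i set \<Rightarrow> 'j set \<Rightarrow> ('i \<Rightarrow> 'j \<Rightarrow> real) \<Rightarrow> ('i \<Rightarrow> real) \<Rightarrow> ('j \<Rightarrow> real) \<Rightarrow> real" where
  "bil I J B y x = (\<Sum>i\<in>I. \<Sum>j\<in>J. y i * B i j * x j)"

lemma bil_mat_vec: "bil I J B y x = (\<Sum>i\<in>I. y i * mat_vec J B x i)"
  by (simp add: bil_def sum_distrib_left mult_ac)

lemma bil_transpose: "bil J I (\<lambda>j i. B i j) x y = bil I J B y x"
  unfolding bil_def by (subst sum.swap) (simp add: mult_ac)

lemma abs_bil_le_op_norm: "\<bar>bil I J B y x\<bar> \<le> op_norm I J B * L2_set y I * L2_set x J"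
proof -
  have "\<bar>bil I J B y x\<bar> \<le> L2_set y I * L2_set (mat_vec J B x) I"
    unfolding bil_mat_vec by (rule abs_sum_mult_le_L2_set)
  also have "\<dots> \<le> L2_set y I * (op_norm I J B * L2_set x J)"
    by (intro mult_left_mono L2_set_mat_vec_le_op_norm) auto
  finally show ?thesis by (simp add: mult_ac)
qed

text \<open>Testing with \<open>y = B x\<close> turns the bound into
  \<open>|B x|^2 \<le> K |x| |B x|\<close>, so a one-sided estimate of the form suffices.\<close>

lemma op_norm_leI_bil:
  assumes "\<And>y x. bil I J B y x \<le> K * L2_set y I * L2_set x J" "0 \<le> K"
  shows "op_norm I J B \<le> K"
proof (rule op_norm_leI[OF _ assms(2)])
  fix x
  let ?w = "mat_vec J B x"
  have "L2_set ?w I * L2_set ?w I = bil I J B ?w x"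
    by (simp add: bil_mat_vec L2_set_power2 flip: power2_eq_square)
  also have "\<dots> \<le> K * L2_set x J * L2_set ?w I" using assms(1)[of ?w x] by (simp add: mult_ac)
  finally show "L2_set ?w I \<le> K * L2_set x J"
    by (cases "L2_set ?w I = 0") (auto simp: assms(2) less_le)
qed

lemma bil_add: "bil I J (\<lambda>i j. B i j + B' i j) y x = bil I J B y x + bil I J B' y x"
  by (simp add: bil_def algebra_simps sum.distrib)

lemma bil_scale: "bil I J (\<lambda>i j. c * B i j) y x = c * bil I J B y x"
  by (simp add: bil_def algebra_simps sum_distrib_left)

lemma bil_sum:
  "bil I J (\<lambda>i j. \<Sum>k\<in>S. c k * A k i j) y x = (\<Sum>k\<in>S. c k * bil I J (A k) y x)"
proof (cases "finite S")
  case True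
  then show ?thesis
    by (induction S) (auto simp: bil_add bil_scale, simp_all add: bil_def)
qed (simp add: bil_def)

lemma op_norm_cong:
  assumes "\<And>i j. i \<in> I \<Longrightarrow> j \<in> J \<Longrightarrow> B i j = B' i j"
  shows "op_norm I J B = op_norm I J B'"
proof -
  have "L2_set (mat_vec J B x) I = L2_set (mat_vec J B' x) I" for x
    using assms by (intro L2_set_cong sum.cong) auto
  then show ?thesis by (simp add: op_norm_def)
qed

lemma op_norm_transpose: "op_norm J I (\<lambda>j i. B i j) = op_norm I J B"
proof -
  have le: "op_norm J I (\<lambda>j i. B i j) \<le> op_norm I J B" for I :: "'i set" and J :: "'j set" and B
  proof (intro op_norm_leI_bil op_norm_nonneg)
    fix y x
    have "bil J I (\<lambda>j i. B i j) y x = bil I J B x y" by (rule bil_transpose)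
    then show "bil J I (\<lambda>j i. B i j) y x \<le> op_norm I J B * L2_set y J * L2_set x I"
      using abs_bil_le_op_norm[of I J B x y] by (simp add: mult_ac abs_le_iff)
  qed
  show ?thesis using le[of J I B] le[of I J "\<lambda>j i. B i j"] by simp
qed

lemma op_norm_triangle:
  "op_norm I J (\<lambda>i j. B i j + B' i j) \<le> op_norm I J B + op_norm I J B'"
proof (rule op_norm_leI_bil)
  fix y x
  show "bil I J (\<lambda>i j. B i j + B' i j) y x \<le> (op_norm I J B + op_norm I J B') * L2_set y I * L2_set x J"
    using abs_bil_le_op_norm[of I J B y x] abs_bil_le_op_norm[of I J B' y x]
    by (simp add: bil_add algebra_simps)
qed (simp add: op_norm_nonneg)

lemma op_norm_scale: "op_norm I J (\<lambda>i j. c * B i j) = \<bar>c\<bar> * op_norm I J B"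
proof -
  have le: "op_norm I J (\<lambda>i j. c * B i j) \<le> \<bar>c\<bar> * op_norm I J B" for c B
  proof (rule op_norm_leI_bil)
    fix y x
    have "bil I J (\<lambda>i j. c * B i j) y x \<le> \<bar>c\<bar> * \<bar>bil I J B y x\<bar>"
      by (simp add: bil_scale flip: abs_mult)
    also have "\<dots> \<le> \<bar>c\<bar> * (op_norm I J B * L2_set y I * L2_set x J)"
      by (intro mult_left_mono abs_bil_le_op_norm) auto
    finally show "bil I J (\<lambda>i j. c * B i j) y x \<le> \<bar>c\<bar> * op_norm I J B * L2_set y I * L2_set x J"
      by (simp add: mult_ac)
  qed (simp add: op_norm_nonneg)
  show ?thesis
  proof (cases "c = 0")
    case True
    then show ?thesis using le[of 0 B] op_norm_nonneg[of I J "\<lambda>_ _. 0"] by simp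
  next
    case False
    have "op_norm I J B \<le> \<bar>1/c\<bar> * op_norm I J (\<lambda>i j. c * B i j)"
      using le[of "1/c" "\<lambda>i j. c * B i j"] False by simp
    then show ?thesis using le[of c B] False by (simp add: field_simps)
  qed
qed

lemma op_norm_diff: "op_norm I J B - op_norm I J B' \<le> op_norm I J (\<lambda>i j. B i j - B' i j)"
  using op_norm_triangle[of I J "\<lambda>i j. B i j - B' i j" B'] by simp

lemma op_norm_sum:
  "op_norm I J (\<lambda>i j. \<Sum>k\<in>S. c k * A k i j) \<le> (\<Sum>k\<in>S. \<bar>c k\<bar> * op_norm I J (A k))"
proof (rule op_norm_leI_bil)
  fix y x
  have "bil I J (\<lambda>i j. \<Sum>k\<in>S. c k * A k i j) y x \<le> (\<Sum>k\<in>S. \<bar>c k\<bar> * \<bar>bil I J (A k) y x\<bar>)"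
    unfolding bil_sum by (intro sum_mono) (simp flip: abs_mult)
  also have "\<dots> \<le> (\<Sum>k\<in>S. \<bar>c k\<bar> * (op_norm I J (A k) * L2_set y I * L2_set x J))"
    by (intro sum_mono mult_left_mono abs_bil_le_op_norm) auto
  finally show "bil I J (\<lambda>i j. \<Sum>k\<in>S. c k * A k i j) y x
      \<le> (\<Sum>k\<in>S. \<bar>c k\<bar> * op_norm I J (A k)) * L2_set y I * L2_set x J"
    by (simp add: sum_distrib_left sum_distrib_right mult_ac)
qed (simp add: op_norm_nonneg sum_nonneg)

text \<open>Test vectors are extended by zero. With general injections \<open>f\<close> and
  \<open>g\<close>, corners of a block matrix and slices of a flattening both count as
  submatrices.\<close>

lemma op_norm_submatrix:
  assumes f: "inj_on f I'" "f ` I' \<subseteq> I" and g: "inj_on g J'" "g ` J' \<subseteq> J"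
    and B: "\<And>i j. i \<in> I' \<Longrightarrow> j \<in> J' \<Longrightarrow> B' i j = B (f i) (g j)"
    and fin: "finite I" "finite J"
  shows "op_norm I' J' B' \<le> op_norm I J B"
proof (rule op_norm_leI_bil[OF _ op_norm_nonneg])
  fix y x
  define Y :: "'b \<Rightarrow> real" where "Y i = (if i \<in> f ` I' then y (inv_into I' f i) else 0)" for i
  define X :: "'d \<Rightarrow> real" where "X j = (if j \<in> g ` J' then x (inv_into J' g j) else 0)" for j
  have Y: "Y (f i) = y i" if "i \<in> I'" for i using that f by (auto simp: Y_def)
  have X: "X (g j) = x j" if "j \<in> J'" for j using that g by (auto simp: X_def)
  have nY: "L2_set Y I = L2_set y I'"
  proof -
    have "(\<Sum>i\<in>I. (Y i)\<^sup>2) = (\<Sum>i\<in>f ` I'. (Y i)\<^sup>2)"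
      using f fin by (intro sum.mono_neutral_right) (auto simp: Y_def)
    also have "\<dots> = (\<Sum>i\<in>I'. (y i)\<^sup>2)" using f Y by (subst sum.reindex) auto
    finally show ?thesis by (simp add: L2_set_def)
  qed
  have nX: "L2_set X J = L2_set x J'"
  proof -
    have "(\<Sum>i\<in>J. (X i)\<^sup>2) = (\<Sum>i\<in>g ` J'. (X i)\<^sup>2)"
      using g fin by (intro sum.mono_neutral_right) (auto simp: X_def)
    also have "\<dots> = (\<Sum>i\<in>J'. (x i)\<^sup>2)" using g X by (subst sum.reindex) auto
    finally show ?thesis by (simp add: L2_set_def)
  qed
  have "bil I J B Y X = (\<Sum>i\<in>f ` I'. \<Sum>j\<in>g ` J'. Y i * B i j * X j)"
  proof -
    have "bil I J B Y X = (\<Sum>i\<in>f ` I'. \<Sum>j\<in>J. Y i * B i j * X j)"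
      unfolding bil_def using f fin by (intro sum.mono_neutral_right) (auto simp: Y_def)
    also have "\<dots> = (\<Sum>i\<in>f ` I'. \<Sum>j\<in>g ` J'. Y i * B i j * X j)"
      using g fin by (intro sum.cong refl sum.mono_neutral_right) (auto simp: X_def)
    finally show ?thesis .
  qed
  also have "\<dots> = (\<Sum>i\<in>I'. \<Sum>j\<in>J'. Y (f i) * B (f i) (g j) * X (g j))"
    using f g by (simp add: sum.reindex)
  also have "\<dots> = bil I' J' B' y x"
    unfolding bil_def using X Y B by (intro sum.cong) auto
  finally show "bil I' J' B' y x \<le> op_norm I J B * L2_set y I' * L2_set x J'"
    using abs_bil_le_op_norm[of I J B Y X] by (simp add: nX nY)
qed

lemma op_norm_reindex:
  assumes f: "bij_betw f I' I" and g: "bij_betw g J' J"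
    and B: "\<And>i j. i \<in> I' \<Longrightarrow> j \<in> J' \<Longrightarrow> B' i j = B (f i) (g j)"
    and fin: "finite I" "finite J"
  shows "op_norm I' J' B' = op_norm I J B"
proof (rule antisym)
  show "op_norm I' J' B' \<le> op_norm I J B"
    using assms by (intro op_norm_submatrix[where f = f and g = g]) (auto simp: bij_betw_def)
  have fin': "finite I'" "finite J'" using f g fin bij_betw_finite by blast+
  show "op_norm I J B \<le> op_norm I' J' B'"
  proof (rule op_norm_submatrix[where f = "inv_into I' f" and g = "inv_into J' g"])
    show "inj_on (inv_into I' f) I" "inv_into I' f ` I \<subseteq> I'"
      using bij_betw_inv_into[OF f] by (auto simp: bij_betw_def)
    show "inj_on (inv_into J' g) J" "inv_into J' g ` J \<subseteq> J'"
      using bij_betw_inv_into[OF g] by (auto simp: bij_betw_def)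
    fix i j assume "i \<in> I" "j \<in> J"
    moreover have "inv_into I' f i \<in> I'" "inv_into J' g j \<in> J'"
      using \<open>i \<in> I\<close> \<open>j \<in> J\<close> f g by (auto simp: bij_betw_def intro!: inv_into_into)
    ultimately show "B i j = B' (inv_into I' f i) (inv_into J' g j)"
      using f g B by (simp add: bij_betw_inv_into_right)
  qed (use fin' in auto)
qed

text \<open>The identity \<open>|B B^T| = |B|^2\<close>. It makes the squared norm of stacked
  matrices \<open>x\<^sub>k A\<^sub>k\<close> the norm of a sum that is linear in the squares
  \<open>x\<^sub>k\<^sup>2\<close>.\<close>

lemma op_norm_gram:
  "op_norm I I (\<lambda>i i'. \<Sum>l\<in>L. B i l * B i' l) = (op_norm I L B)\<^sup>2"
proof -
  let ?G = "\<lambda>i i'. \<Sum>l\<in>L. B i l * B i' l"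
  let ?T = "\<lambda>l i. B i l"
  have eq: "bil I I ?G y x = (\<Sum>l\<in>L. mat_vec I ?T y l * mat_vec I ?T x l)" for y x
  proof -
    have "(\<Sum>l\<in>L. mat_vec I ?T y l * mat_vec I ?T x l)
        = (\<Sum>l\<in>L. \<Sum>i\<in>I. \<Sum>i'\<in>I. y i * (B i l * B i' l) * x i')"
      unfolding sum_product by (intro sum.cong refl) (simp add: mult_ac)
    also have "\<dots> = (\<Sum>i\<in>I. \<Sum>l\<in>L. \<Sum>i'\<in>I. y i * (B i l * B i' l) * x i')"
      by (rule sum.swap)
    also have "\<dots> = (\<Sum>i\<in>I. \<Sum>i'\<in>I. \<Sum>l\<in>L. y i * (B i l * B i' l) * x i')"
      by (intro sum.cong refl sum.swap)
    also have "\<dots> = bil I I ?G y x"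
      unfolding bil_def sum_distrib_left sum_distrib_right ..
    finally show ?thesis by simp
  qed
  show ?thesis
  proof (rule antisym)
    show "op_norm I I ?G \<le> (op_norm I L B)\<^sup>2"
    proof (rule op_norm_leI_bil)
      fix y x
      have "bil I I ?G y x \<le> L2_set (mat_vec I ?T y) L * L2_set (mat_vec I ?T x) L"
        unfolding eq by (rule order_trans[OF abs_ge_self abs_sum_mult_le_L2_set])
      also have "\<dots> \<le> (op_norm L I ?T * L2_set y I) * (op_norm L I ?T * L2_set x I)"
        by (intro mult_mono L2_set_mat_vec_le_op_norm) (auto simp: op_norm_nonneg)
      finally show "bil I I ?G y x \<le> (op_norm I L B)\<^sup>2 * L2_set y I * L2_set x I"
        by (simp add: op_norm_transpose[of L I B] power2_eq_square mult_ac)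
    qed simp
    have "op_norm L I ?T \<le> sqrt (op_norm I I ?G)"
    proof (rule op_norm_leI)
      fix x
      have "(L2_set (mat_vec I ?T x) L)\<^sup>2 = bil I I ?G x x"
        unfolding eq L2_set_power2 by (simp add: power2_eq_square)
      also have "\<dots> \<le> op_norm I I ?G * L2_set x I * L2_set x I"
        using abs_bil_le_op_norm[of I I ?G x x] by simp
      also have "\<dots> = (sqrt (op_norm I I ?G) * L2_set x I)\<^sup>2"
        by (simp add: power_mult_distrib op_norm_nonneg power2_eq_square)
      finally show "L2_set (mat_vec I ?T x) L \<le> sqrt (op_norm I I ?G) * L2_set x I"
        by (rule power2_le_imp_le) (simp add: op_norm_nonneg)
    qed (simp add: op_norm_nonneg)
    then have "(op_norm I L B)\<^sup>2 \<le> (sqrt (op_norm I I ?G))\<^sup>2"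
      by (intro power_mono) (simp_all add: op_norm_transpose[of L I B] op_norm_nonneg)
    then show "(op_norm I L B)\<^sup>2 \<le> op_norm I I ?G"
      by (simp add: op_norm_nonneg)
  qed
qed

text \<open>A countable family of test vectors makes the norm measurable in the entries. Quotients
  replace the constraint on the length, so that rounding the entries of a vector is a valid
  approximation; where the length is 0 the quotient is 0 and does not affect the supremum.\<close>

lemma op_norm_eq_SUP_rat:
  assumes fin: "finite I" "finite J"
  shows "op_norm I J B =
    (SUP x \<in> Pi\<^sub>E J (\<lambda>_. \<rat>). L2_set (mat_vec J B x) I / L2_set x J)"
proof -
  let ?f = "\<lambda>x. L2_set (mat_vec J B x) I / L2_set x J"
  let ?Q = "Pi\<^sub>E J (\<lambda>_. \<rat> :: real set)"
  have le: "?f x \<le> op_norm I J B" for x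
    using L2_set_mat_vec_le_op_norm[of B x J I] L2_set_nonneg[of x J]
    by (cases "L2_set x J = 0") (auto simp: op_norm_nonneg field_simps less_le)
  have bdd: "bdd_above (?f ` ?Q)" by (intro bdd_aboveI2) (rule le)
  have ne: "?Q \<noteq> {}" by (auto simp: PiE_eq_empty_iff)
  show ?thesis
  proof (rule antisym)
    show "op_norm I J B \<le> (SUP x\<in>?Q. ?f x)"
    proof (rule op_norm_leI)
      let ?K = "SUP x\<in>?Q. ?f x"
      have Q: "L2_set (mat_vec J B x) I \<le> ?K * L2_set x J" if "x \<in> ?Q" for x
      proof (cases "L2_set x J = 0")
        case True
        then show ?thesis using L2_set_mat_vec_le[of B x J I] by simp
      next
        case False
        have "?f x \<le> ?K" using that bdd by (rule cSUP_upper)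
        then show ?thesis using False by (simp add: field_simps less_le)
      qed
      fix x
      define X where "X n = restrict (\<lambda>j. real_of_int \<lfloor>x j * real (Suc n)\<rfloor> / real (Suc n)) J" for n
      have XQ: "X n \<in> ?Q" for n by (auto simp: X_def)
      have lim: "(\<lambda>n. X n j) \<longlonglongrightarrow> x j" if "j \<in> J" for j
      proof -
        have "\<bar>X n j - x j\<bar> \<le> inverse (real (Suc n))" for n
        proof -
          have "\<bar>real_of_int \<lfloor>x j * real (Suc n)\<rfloor> - x j * real (Suc n)\<bar> \<le> 1" by linarith
          moreover have "X n j - x j = (real_of_int \<lfloor>x j * real (Suc n)\<rfloor> - x j * real (Suc n)) / real (Suc n)"
            using that by (simp add: X_def diff_divide_distrib)
          ultimately show ?thesis by (metis abs_divide abs_of_nat divide_right_mono inverse_eq_divide of_nat_0_le_iff)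
        qed
        then have "(\<lambda>n. X n j - x j) \<longlonglongrightarrow> 0"
          by (intro Lim_null_comparison[OF _ LIMSEQ_inverse_real_of_nat]) simp
        then show ?thesis by (rule LIM_zero_cancel)
      qed
      have l1: "(\<lambda>n. L2_set (mat_vec J B (X n)) I) \<longlonglongrightarrow> L2_set (mat_vec J B x) I"
        unfolding L2_set_def by (intro tendsto_intros lim)
      have l2: "(\<lambda>n. ?K * L2_set (X n) J) \<longlonglongrightarrow> ?K * L2_set x J"
        unfolding L2_set_def by (intro tendsto_intros lim)
      show "L2_set (mat_vec J B x) I \<le> ?K * L2_set x J"
        by (rule LIMSEQ_le[OF l1 l2]) (use Q XQ in blast)
    next
      have "restrict (\<lambda>_. 0) J \<in> ?Q" by auto
      from cSUP_upper[OF this bdd] show "0 \<le> (SUP x\<in>?Q. ?f x)"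
        by (rule order_trans[rotated]) simp
    qed
    show "(SUP x\<in>?Q. ?f x) \<le> op_norm I J B" by (intro cSUP_least ne le)
  qed
qed

lemma borel_measurable_op_norm [measurable (raw)]:
  assumes fin: "finite I" "finite J"
    and B: "\<And>i j. i \<in> I \<Longrightarrow> j \<in> J \<Longrightarrow> (\<lambda>w. B w i j) \<in> borel_measurable M"
  shows "(\<lambda>w. op_norm I J (B w)) \<in> borel_measurable M"
  unfolding op_norm_eq_SUP_rat[OF fin]
proof (rule borel_measurable_cSUP)
  show "countable (Pi\<^sub>E J (\<lambda>_. \<rat> :: real set))"
    using fin by (intro countable_PiE) (auto simp: countable_rat)
  show "bdd_above ((\<lambda>x. L2_set (mat_vec J (B w) x) I / L2_set x J) ` Pi\<^sub>E J (\<lambda>_. \<rat>))" for w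
  proof (rule bdd_aboveI2)
    fix x
    show "L2_set (mat_vec J (B w) x) I / L2_set x J \<le> op_norm I J (B w)"
      using L2_set_mat_vec_le_op_norm[of "B w" x J I] L2_set_nonneg[of x J]
      by (cases "L2_set x J = 0") (auto simp: op_norm_nonneg field_simps less_le)
  qed
  show "(\<lambda>w. L2_set (mat_vec J (B w) x) I / L2_set x J) \<in> borel_measurable M" for x
    unfolding L2_set_def using B by measurable
qed

section \<open>The noncommutative Khintchine inequality\<close>

definition mmul :: "'i set \<Rightarrow> ('a \<Rightarrow> 'i \<Rightarrow> real) \<Rightarrow> ('i \<Rightarrow> 'b \<Rightarrow> real) \<Rightarrow> 'a \<Rightarrow> 'b \<Rightarrow> real" where
  "mmul N A B i k = (\<Sum>j\<in>N. A i j * B j k)"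

definition mtr :: "'i set \<Rightarrow> ('i \<Rightarrow> 'i \<Rightarrow> real) \<Rightarrow> real" where
  "mtr N A = (\<Sum>i\<in>N. A i i)"

definition mone :: "'i set \<Rightarrow> 'i \<Rightarrow> 'i \<Rightarrow> real" where
  "mone N i j = of_bool (i = j \<and> i \<in> N)"

primrec mpow :: "'i set \<Rightarrow> ('i \<Rightarrow> 'i \<Rightarrow> real) \<Rightarrow> nat \<Rightarrow> 'i \<Rightarrow> 'i \<Rightarrow> real" where
  "mpow N A 0 = mone N"
| "mpow N A (Suc n) = mmul N A (mpow N A n)"

definition transp_mat :: "('i \<Rightarrow> 'j \<Rightarrow> real) \<Rightarrow> 'j \<Rightarrow> 'i \<Rightarrow> real" where
  "transp_mat A i j = A j i"

text \<open>Vanishing outside \<open>N\<close> is part of the notion, so that \<open>mone N\<close>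
  is an identity up to equality of functions and products can be rewritten without keeping indices
  inside \<open>N\<close>.\<close>

definition sym_on :: "'i set \<Rightarrow> ('i \<Rightarrow> 'i \<Rightarrow> real) \<Rightarrow> bool" where
  "sym_on N A \<longleftrightarrow> transp_mat A = A \<and> (\<forall>i j. A i j \<noteq> 0 \<longrightarrow> i \<in> N \<and> j \<in> N)"

lemma sym_onI:
  assumes "transp_mat A = A" "\<And>i j. A i j \<noteq> 0 \<Longrightarrow> i \<in> N \<and> j \<in> N"
  shows "sym_on N A"
  using assms unfolding sym_on_def by blast

lemma sym_onD:
  assumes "sym_on N A"
  shows "transp_mat A = A" "A i j \<noteq> 0 \<Longrightarrow> i \<in> N" "A i j \<noteq> 0 \<Longrightarrow> j \<in> N"
  using assms unfolding sym_on_def by blast+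

lemma mmul_assoc: "mmul N (mmul N A B) C = mmul N A (mmul N B C)"
proof (intro ext)
  fix i k
  have "mmul N (mmul N A B) C i k = (\<Sum>l\<in>N. \<Sum>j\<in>N. A i j * B j l * C l k)"
    by (simp add: mmul_def sum_distrib_right)
  also have "\<dots> = (\<Sum>j\<in>N. \<Sum>l\<in>N. A i j * B j l * C l k)" by (rule sum.swap)
  also have "\<dots> = mmul N A (mmul N B C) i k"
    by (simp add: mmul_def sum_distrib_left mult.assoc)
  finally show "mmul N (mmul N A B) C i k = mmul N A (mmul N B C) i k" .
qed

lemma mtr_commute: "mtr N (mmul N A B) = mtr N (mmul N B A)"
  unfolding mtr_def mmul_def by (subst sum.swap) (simp add: mult.commute)

lemma transp_mmul: "transp_mat (mmul N A B) = mmul N (transp_mat B) (transp_mat A)"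
  by (simp add: fun_eq_iff transp_mat_def mmul_def mult.commute)

lemma mone_left: "finite N \<Longrightarrow> sym_on N A \<Longrightarrow> mmul N (mone N) A = A"
proof (intro ext)
  fix i k assume "finite N" and A: "sym_on N A"
  have "mmul N (mone N) A i k = (\<Sum>j\<in>N. if j = i then A j k else 0)"
    unfolding mmul_def by (intro sum.cong) (auto simp: mone_def)
  also have "\<dots> = (if i \<in> N then A i k else 0)" using \<open>finite N\<close> by simp
  also have "\<dots> = A i k" using A by (auto simp: sym_on_def)
  finally show "mmul N (mone N) A i k = A i k" .
qed

lemma sym_on_mone: "sym_on N (mone N)"
  by (auto simp: sym_on_def mone_def transp_mat_def fun_eq_iff)

lemma mone_right:
  assumes "finite N" "sym_on N A"
  shows "mmul N A (mone N) = A"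
proof -
  have t: "transp_mat A = A" "transp_mat (mone N) = mone N"
    using assms(2) sym_on_mone[of N] by (simp_all only: sym_on_def)
  have "transp_mat (mmul N A (mone N)) = A"
    unfolding transp_mmul t by (rule mone_left[OF assms])
  then have "transp_mat (transp_mat (mmul N A (mone N))) = A" using t by simp
  then show ?thesis by (simp add: transp_mat_def[abs_def])
qed

lemma mpow_supp:
  assumes "sym_on N A"
  shows "mpow N A n i j \<noteq> 0 \<Longrightarrow> i \<in> N \<and> j \<in> N"
proof (induction n arbitrary: i j)
  case (Suc n)
  then have "(\<Sum>l\<in>N. A i l * mpow N A n l j) \<noteq> 0" by (simp add: mmul_def)
  then obtain l where "A i l * mpow N A n l j \<noteq> 0"
    by (rule sum.not_neutral_contains_not_neutral)
  then have "A i l \<noteq> 0" "mpow N A n l j \<noteq> 0" by auto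
  then show ?case using Suc.IH sym_onD(2)[OF assms] by blast
qed (simp add: mone_def split: if_splits)

lemma mpow_commute:
  assumes "finite N" "sym_on N A"
  shows "mmul N (mpow N A n) A = mmul N A (mpow N A n)"
proof (induction n)
  case 0
  show ?case by (simp only: mpow.simps mone_left[OF assms] mone_right[OF assms])
next
  case (Suc n)
  then show ?case by (simp only: mpow.simps mmul_assoc)
qed

lemma sym_on_mpow:
  assumes "finite N" "sym_on N A"
  shows "sym_on N (mpow N A n)"
proof (rule sym_onI)
  show "transp_mat (mpow N A n) = mpow N A n"
  proof (induction n)
    case 0
    show ?case using sym_onD(1)[OF sym_on_mone] by simp
  next
    case (Suc n)
    then show ?case
      by (simp only: mpow.simps transp_mmul sym_onD(1)[OF assms(2)] mpow_commute[OF assms])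
  qed
qed (rule mpow_supp[OF assms(2)])

lemma mpow_add:
  assumes "finite N" "sym_on N A"
  shows "mpow N A (a + b) = mmul N (mpow N A a) (mpow N A b)"
proof (induction a)
  case 0
  show ?case by (simp only: mpow.simps mone_left[OF assms(1) sym_on_mpow[OF assms]] add_0)
next
  case (Suc a)
  then show ?case by (simp only: mpow.simps mmul_assoc add_Suc)
qed

section \<open>Trace inequalities for two symmetric matrices\<close>

lemma mtr_transp: "mtr N (mmul N A (transp_mat B)) = (\<Sum>i\<in>N. \<Sum>j\<in>N. A i j * B i j)"
  by (simp add: mtr_def mmul_def transp_mat_def)

text \<open>The entrywise inequality \<open>2 a b \<le> a^2 + b^2\<close> for the Frobenius inner
  product, from which the convexity of the mixed traces comes.\<close>

lemma mtr_transp_le: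
  "2 * mtr N (mmul N A (transp_mat B)) \<le> mtr N (mmul N A (transp_mat A)) + mtr N (mmul N B (transp_mat B))"
proof -
  have "2 * (a * b) \<le> a * a + b * b" for a b :: real
    using zero_le_power2[of "a - b"] by (simp add: power2_eq_square algebra_simps)
  then show ?thesis
    unfolding mtr_transp sum_distrib_left sum.distrib[symmetric] by (intro sum_mono) auto
qed

lemma mtr_transp_nonneg: "0 \<le> mtr N (mmul N A (transp_mat A))"
  unfolding mtr_transp by (intro sum_nonneg) auto

text \<open>The mixed trace \<open>tr (H W^a H Y^c)\<close> appears when a difference of powers is
  telescoped. Bounding it by \<open>tr (H^2 W^(2r)) + tr (H^2 Y^(2r))\<close> for
  \<open>a + c = 2 r\<close> is a weak form of the arithmetic-geometric mean inequality for
  traces.\<close>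

definition gtr :: "'i set \<Rightarrow> ('i \<Rightarrow> 'i \<Rightarrow> real) \<Rightarrow> ('i \<Rightarrow> 'i \<Rightarrow> real) \<Rightarrow> ('i \<Rightarrow> 'i \<Rightarrow> real) \<Rightarrow> nat \<Rightarrow> nat \<Rightarrow> real" where
  "gtr N H W Y a c = mtr N (mmul N H (mmul N (mpow N W a) (mmul N H (mpow N Y c))))"

context
  fixes N :: "'i set" and H W Y :: "'i \<Rightarrow> 'i \<Rightarrow> real"
  assumes fin: "finite N" and H: "sym_on N H" and W: "sym_on N W" and Y: "sym_on N Y"
begin

text \<open>By cyclicity and symmetry, the trace is the Frobenius inner product of
  \<open>W^a H Y^c\<close> and \<open>W^b H Y^d\<close>. This yields midpoint convexity, and
  nonnegativity at even exponents, where the trace is a squared norm.\<close>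

lemma gtr_eq_transp:
  "mtr N (mmul N (mmul N (mpow N W a) (mmul N H (mpow N Y c)))
     (transp_mat (mmul N (mpow N W b) (mmul N H (mpow N Y d))))) = gtr N H W Y (a + b) (c + d)"
proof -
  have t: "transp_mat H = H" "transp_mat (mpow N W n) = mpow N W n" "transp_mat (mpow N Y n) = mpow N Y n" for n
    by (rule sym_onD(1) H sym_on_mpow fin W Y)+
  have "mtr N (mmul N (mmul N (mpow N W a) (mmul N H (mpow N Y c)))
     (transp_mat (mmul N (mpow N W b) (mmul N H (mpow N Y d)))))
    = mtr N (mmul N (mpow N W a) (mmul N H (mmul N (mpow N Y (c + d)) (mmul N H (mpow N W b)))))"
    by (simp only: transp_mmul t mmul_assoc mpow_add[OF fin Y])
  also have "\<dots> = mtr N (mmul N (mmul N H (mpow N Y (c + d))) (mmul N H (mmul N (mpow N W b) (mpow N W a))))"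
    by (subst mtr_commute) (simp add: mmul_assoc)
  also have "\<dots> = mtr N (mmul N (mmul N H (mpow N W (a + b))) (mmul N H (mpow N Y (c + d))))"
    by (subst mtr_commute) (simp add: mpow_add[OF fin W, symmetric] add.commute)
  finally show ?thesis by (simp add: gtr_def mmul_assoc)
qed

lemma gtr_mid: "2 * gtr N H W Y (a + b) (c + d) \<le> gtr N H W Y (2 * a) (2 * c) + gtr N H W Y (2 * b) (2 * d)"
  using mtr_transp_le[of N "mmul N (mpow N W a) (mmul N H (mpow N Y c))"
      "mmul N (mpow N W b) (mmul N H (mpow N Y d))"]
  unfolding gtr_eq_transp by (simp flip: mult_2)

lemma gtr_even_nonneg: "0 \<le> gtr N H W Y (2 * a) (2 * c)"
  using mtr_transp_nonneg[of N "mmul N (mpow N W a) (mmul N H (mpow N Y c))"]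
  unfolding gtr_eq_transp by (simp flip: mult_2)

text \<open>By \<open>gtr_mid\<close>, the trace is a discretely convex function of the even exponents, so
  its maximum is attained at an end point.\<close>

lemma gtr_even_le:
  assumes "k \<le> r"
  shows "gtr N H W Y (2 * k) (2 * (r - k)) \<le> gtr N H W Y 0 (2 * r) + gtr N H W Y (2 * r) 0"
proof -
  define e where "e k = gtr N H W Y (2 * k) (2 * (r - k))" for k
  have e0: "0 \<le> e k" for k unfolding e_def by (rule gtr_even_nonneg)
  have conv: "2 * e (Suc k) \<le> e k + e (Suc (Suc k))" if "Suc (Suc k) \<le> r" for k
  proof -
    have "k + Suc (Suc k) = 2 * Suc k" "(r - k) + (r - Suc (Suc k)) = 2 * (r - Suc k)" using that by auto
    then show ?thesis using gtr_mid[of k "Suc (Suc k)" "r - k" "r - Suc (Suc k)"] by (simp only: e_def)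
  qed
  \<comment> \<open>Convexity in chord form: \<open>e k\<close> lies below the line through
    \<open>e 0\<close> and \<open>e (Suc k)\<close>. Descending from \<open>r\<close>, this
    propagates the bound by the two end values.\<close>
  have slope: "(real k + 1) * e k \<le> real k * e (Suc k) + e 0" if "Suc k \<le> r" for k
    using that
  proof (induction k)
    case (Suc k)
    have "(real k + 1) * (2 * e (Suc k)) \<le> (real k + 1) * (e k + e (Suc (Suc k)))"
      using conv[OF Suc.prems] by (intro mult_left_mono) auto
    then show ?case using Suc by (simp add: algebra_simps)
  qed simp
  have "e k \<le> e 0 + e r"
    using assms
  proof (induction k rule: inc_induct)
    case (step k)
    have "(real k + 1) * e k \<le> real k * e (Suc k) + e 0" using step slope by simp
    also have "\<dots> \<le> real k * (e 0 + e r) + (e 0 + e r)"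
      using step e0[of r] by (intro add_mono mult_left_mono) auto
    also have "\<dots> = (real k + 1) * (e 0 + e r)" by (simp add: algebra_simps)
    finally show ?case by (subst (asm) mult_le_cancel_left_pos) auto
  qed (use e0[of 0] in simp)
  then show ?thesis by (simp add: e_def)
qed

text \<open>Since \<open>a + c\<close> is even, an odd pair of exponents is the midpoint of two
  neighbouring even pairs, to which the previous bound applies. At the end points one of the powers
  disappears and the two factors \<open>H\<close> meet.\<close>

lemma gtr_le:
  assumes "a + c = 2 * r"
  shows "gtr N H W Y a c \<le> mtr N (mmul N (mmul N H H) (mpow N W (2 * r)))
    + mtr N (mmul N (mmul N H H) (mpow N Y (2 * r)))"
proof -
  have "gtr N H W Y a c \<le> gtr N H W Y 0 (2 * r) + gtr N H W Y (2 * r) 0"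
  proof (cases "even a")
    case True
    then obtain k where k: "a = 2 * k" by (elim evenE)
    then have "k \<le> r" "c = 2 * (r - k)" using assms by auto
    then show ?thesis using gtr_even_le[of k r] k by simp
  next
    case False
    then obtain k where k: "a = 2 * k + 1" by (elim oddE)
    then have k': "Suc k \<le> r" using assms by presburger
    then have "a = k + Suc k" "c = (r - k) + (r - Suc k)" using assms k by auto
    then have "2 * gtr N H W Y a c \<le> gtr N H W Y (2 * k) (2 * (r - k)) + gtr N H W Y (2 * Suc k) (2 * (r - Suc k))"
      using gtr_mid[of k "Suc k" "r - k" "r - Suc k"] by simp
    then show ?thesis using gtr_even_le[of k r] gtr_even_le[of "Suc k" r] k' by simp
  qed
  also have "gtr N H W Y 0 (2 * r) = mtr N (mmul N (mmul N H H) (mpow N Y (2 * r)))"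
    by (simp only: gtr_def mpow.simps mone_left[OF fin sym_on_mpow[OF fin Y]] mone_left[OF fin H] mmul_assoc
      flip: mmul_assoc[of N "mone N" H])
  also have "gtr N H W Y (2 * r) 0 = mtr N (mmul N (mmul N H H) (mpow N W (2 * r)))"
  proof -
    have "gtr N H W Y (2 * r) 0 = mtr N (mmul N (mmul N H (mpow N W (2 * r))) H)"
      by (simp only: gtr_def mpow.simps mone_right[OF fin H] mmul_assoc)
    also have "\<dots> = mtr N (mmul N H (mmul N H (mpow N W (2 * r))))" by (rule mtr_commute)
    finally show ?thesis by (simp only: mmul_assoc)
  qed
  finally show ?thesis by simp
qed

text \<open>Telescoping of \<open>W^(n+1) - Y^(n+1)\<close> into the terms
  \<open>W^q (W - Y) Y^(n-q)\<close> with \<open>W - Y = c H\<close>. Later \<open>W\<close> and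
  \<open>Y\<close> are signed sums differing in one sign, so that
  \<open>c = 2 e\<^sub>k\<close>.\<close>

lemma mtr_mpow_diff:
  assumes d: "\<And>i j. W i j = Y i j + c * H i j"
  shows "mtr N (mmul N H (mpow N W (Suc n))) - mtr N (mmul N H (mpow N Y (Suc n)))
    = c * (\<Sum>q\<le>n. gtr N H W Y q (n - q))"
proof -
  define T where "T q = mtr N (mmul N H (mmul N (mpow N W q) (mpow N Y (Suc n - q))))" for q
  have step: "T (Suc q) - T q = c * gtr N H W Y q (n - q)" if "q \<le> n" for q
  proof -
    have lin: "mmul N A (mmul N W B) i k = mmul N A (mmul N Y B) i k + c * mmul N A (mmul N H B) i k" for A B i k
    proof -
      have "mmul N W B j k = mmul N Y B j k + c * mmul N H B j k" for j
        by (simp add: mmul_def d algebra_simps sum.distrib sum_distrib_left)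
      then show ?thesis
        unfolding mmul_def[of N A] by (simp add: algebra_simps sum.distrib sum_distrib_left)
    qed
    have 1: "mmul N (mpow N W (Suc q)) B = mmul N (mpow N W q) (mmul N W B)" for B
      using mpow_commute[OF fin W, of q] by (simp flip: mmul_assoc)
    have 2: "mpow N Y (Suc n - q) = mmul N Y (mpow N Y (n - q))"
      using that by (simp add: Suc_diff_le)
    have "T (Suc q) = mtr N (mmul N H (mmul N (mpow N W q) (mmul N W (mpow N Y (n - q)))))"
      unfolding T_def 1 by simp
    also have "\<dots> = mtr N (mmul N (mmul N H (mpow N W q)) (mmul N W (mpow N Y (n - q))))"
      by (simp add: mmul_assoc)
    also have "\<dots> = T q + c * gtr N H W Y q (n - q)"
      unfolding T_def 2 gtr_def mtr_def lin by (simp add: sum.distrib sum_distrib_left mmul_assoc)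
    finally show ?thesis by simp
  qed
  have "T (Suc n) - T 0 = (\<Sum>q\<le>n. T (Suc q) - T q)"
    using sum_telescope[of "\<lambda>i. - T i" n] by simp
  also have "\<dots> = c * (\<Sum>q\<le>n. gtr N H W Y q (n - q))"
    unfolding sum_distrib_left by (intro sum.cong refl step) simp
  finally show ?thesis
    using mone_left[OF fin sym_on_mpow[OF fin Y]] mone_right[OF fin sym_on_mpow[OF fin W]]
    by (simp only: T_def mpow.simps(1) diff_self_eq_0 diff_zero)
qed

end

text \<open>\<open>tr (H\<^sup>2 X\<^sup>2\<^sup>r)\<close> is the squared Frobenius norm of \<open>H X\<^sup>r\<close>.\<close>

lemma sum_mtr_sq_le:
  assumes fin: "finite N" and X: "sym_on N X" and H: "\<And>k. k \<in> S \<Longrightarrow> sym_on N (H k)"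
    and le: "\<And>v. (\<Sum>k\<in>S. (L2_set (mat_vec N (H k) v) N)\<^sup>2) \<le> s\<^sup>2 * (L2_set v N)\<^sup>2"
  shows "(\<Sum>k\<in>S. mtr N (mmul N (mmul N (H k) (H k)) (mpow N X (2 * r)))) \<le> s\<^sup>2 * mtr N (mpow N X (2 * r))"
proof -
  let ?P = "mpow N X r"
  have P: "sym_on N ?P" by (rule sym_on_mpow[OF fin X])
  have 2: "mpow N X (2 * r) = mmul N ?P ?P" using mpow_add[OF fin X, of r r] by (simp add: mult_2)
  have eq: "mtr N (mmul N (mmul N (H k) (H k)) (mpow N X (2 * r)))
      = (\<Sum>j\<in>N. (L2_set (mat_vec N (H k) (\<lambda>l. ?P l j)) N)\<^sup>2)" if "k \<in> S" for k
  proof -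
    have "mtr N (mmul N (mmul N (H k) (H k)) (mpow N X (2 * r)))
        = mtr N (mmul N (H k) (mmul N (mmul N (H k) ?P) ?P))"
      unfolding 2 by (simp only: mmul_assoc)
    also have "\<dots> = mtr N (mmul N (mmul N (H k) ?P) (mmul N ?P (H k)))"
      by (subst mtr_commute) (simp only: mmul_assoc)
    also have "mmul N ?P (H k) = transp_mat (mmul N (H k) ?P)"
      by (simp only: transp_mmul sym_onD(1)[OF P] sym_onD(1)[OF H[OF that]])
    also have "mtr N (mmul N (mmul N (H k) ?P) (transp_mat (mmul N (H k) ?P)))
        = (\<Sum>j\<in>N. \<Sum>i\<in>N. (mmul N (H k) ?P i j)\<^sup>2)"
      unfolding mtr_transp by (subst sum.swap) (simp add: power2_eq_square)
    finally show ?thesis by (simp only: L2_set_power2 mmul_def[of N "H k" ?P])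
  qed
  \<comment> \<open>The variance hypothesis \<open>le\<close> is applied to every column of
    \<open>X^r\<close>.\<close>
  have "(\<Sum>k\<in>S. mtr N (mmul N (mmul N (H k) (H k)) (mpow N X (2 * r))))
      = (\<Sum>j\<in>N. \<Sum>k\<in>S. (L2_set (mat_vec N (H k) (\<lambda>l. ?P l j)) N)\<^sup>2)"
    by (simp add: eq sum.swap[of _ N])
  also have "\<dots> \<le> (\<Sum>j\<in>N. s\<^sup>2 * (L2_set (\<lambda>l. ?P l j) N)\<^sup>2)" by (intro sum_mono le)
  also have "\<dots> = s\<^sup>2 * (\<Sum>j\<in>N. \<Sum>l\<in>N. ?P l j * ?P l j)"
    unfolding L2_set_power2 by (simp add: sum_distrib_left power2_eq_square)
  also have "(\<Sum>j\<in>N. \<Sum>l\<in>N. ?P l j * ?P l j) = mtr N (mmul N ?P (transp_mat ?P))"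
    unfolding mtr_transp by (rule sum.swap)
  also have "transp_mat ?P = ?P" by (rule sym_onD(1)[OF P])
  finally show ?thesis unfolding 2 .
qed

section \<open>Trace moments over all sign vectors\<close>

definition signs :: "'k set \<Rightarrow> ('k \<Rightarrow> real) set" where
  "signs S = Pi\<^sub>E S (\<lambda>_. {-1, 1})"

lemma finite_signs: "finite S \<Longrightarrow> finite (signs S)"
  by (simp add: signs_def finite_PiE)

lemma card_signs: "finite S \<Longrightarrow> card (signs S) = 2 ^ card S"
  by (simp add: signs_def card_PiE numeral_2_eq_2)

lemma signs_sq: "e \<in> signs S \<Longrightarrow> k \<in> S \<Longrightarrow> e k * e k = 1"
  by (auto simp: signs_def PiE_iff)

lemma sum_signs_flip:
  assumes k: "k \<in> S"
  shows "(\<Sum>e\<in>signs S. f (e(k := - e k))) = (\<Sum>e\<in>signs S. f e)"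
proof (rule sum.reindex_bij_witness[where i = "\<lambda>e. e(k := - e k)" and j = "\<lambda>e. e(k := - e k)"])
  show "e(k := - e k) \<in> signs S" if "e \<in> signs S" for e
    using that k by (auto simp: signs_def PiE_iff extensional_def)
  then show "e(k := - e k) \<in> signs S" if "e \<in> signs S" for e using that .
qed auto

definition sign_sum :: "'k set \<Rightarrow> ('k \<Rightarrow> 'i \<Rightarrow> 'j \<Rightarrow> real) \<Rightarrow> ('k \<Rightarrow> real) \<Rightarrow> 'i \<Rightarrow> 'j \<Rightarrow> real" where
  "sign_sum S A e i j = (\<Sum>k\<in>S. e k * A k i j)"

lemma sym_on_sign_sum:
  assumes H: "\<And>k. k \<in> S \<Longrightarrow> sym_on N (H k)"
  shows "sym_on N (sign_sum S H e)"
proof (rule sym_onI)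
  have "H k j i = H k i j" if "k \<in> S" for k i j
    using fun_cong[OF fun_cong[OF sym_onD(1)[OF H[OF that]]]] by (simp add: transp_mat_def)
  then show "transp_mat (sign_sum S H e) = sign_sum S H e"
    by (simp add: fun_eq_iff transp_mat_def sign_sum_def)
  fix i j assume "sign_sum S H e i j \<noteq> 0"
  then obtain k where "k \<in> S" "e k * H k i j \<noteq> 0"
    unfolding sign_sum_def by (rule sum.not_neutral_contains_not_neutral)
  then show "i \<in> N \<and> j \<in> N" using sym_onD(2,3)[OF H[OF \<open>k \<in> S\<close>], of i j] by auto
qed

text \<open>Changing one sign replaces Gaussian integration by parts.\<close>

lemma sum_signs_mtr_step:
  assumes fin: "finite N" "finite S" and H: "\<And>k. k \<in> S \<Longrightarrow> sym_on N (H k)"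
    and le: "\<And>v. (\<Sum>k\<in>S. (L2_set (mat_vec N (H k) v) N)\<^sup>2) \<le> s\<^sup>2 * (L2_set v N)\<^sup>2"
  shows "(\<Sum>e\<in>signs S. mtr N (mpow N (sign_sum S H e) (2 * Suc r)))
    \<le> 2 * (2 * real r + 1) * s\<^sup>2 * (\<Sum>e\<in>signs S. mtr N (mpow N (sign_sum S H e) (2 * r)))"
proof -
  let ?X = "sign_sum S H"
  have X: "sym_on N (sign_sum S H e)" for e by (rule sym_on_sign_sum[OF H])
  let ?h = "\<lambda>k e. mtr N (mmul N (mmul N (H k) (H k)) (mpow N (?X e) (2 * r)))"
  have main: "(\<Sum>e\<in>signs S. e k * mtr N (mmul N (H k) (mpow N (?X e) (Suc (2 * r)))))
      \<le> 2 * (2 * real r + 1) * (\<Sum>e\<in>signs S. ?h k e)" if k: "k \<in> S" for k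
  proof -
    define G where "G e = mtr N (mmul N (H k) (mpow N (?X e) (Suc (2 * r))))" for e
    let ?f = "\<lambda>e. e(k := - e k)"
    have diff: "e k * (G e - G (?f e)) = 2 * (\<Sum>q\<le>2 * r. gtr N (H k) (?X e) (?X (?f e)) q (2 * r - q))"
      if e: "e \<in> signs S" for e
    proof -
      have "?X e i j = ?X (?f e) i j + (2 * e k) * H k i j" for i j
        unfolding sign_sum_def using fin k by (simp add: sum.remove[of S k])
      from mtr_mpow_diff[OF fin(1) H[OF k] X X this]
      have "G e - G (?f e) = (2 * e k) * (\<Sum>q\<le>2 * r. gtr N (H k) (?X e) (?X (?f e)) q (2 * r - q))"
        unfolding G_def .
      then have "e k * (G e - G (?f e)) = 2 * (e k * e k) * (\<Sum>q\<le>2 * r. gtr N (H k) (?X e) (?X (?f e)) q (2 * r - q))"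
        by simp
      then show ?thesis using signs_sq[OF e k] by simp
    qed
    have "(\<Sum>e\<in>signs S. e k * G (?f e)) = - (\<Sum>e\<in>signs S. e k * G e)"
      using sum_signs_flip[OF k, of "\<lambda>e. - e k * G e"] by (simp add: sum_negf)
    then have "2 * (\<Sum>e\<in>signs S. e k * G e) = (\<Sum>e\<in>signs S. e k * (G e - G (?f e)))"
      by (simp add: right_diff_distrib sum_subtractf)
    also have "\<dots> = 2 * (\<Sum>e\<in>signs S. \<Sum>q\<le>2 * r. gtr N (H k) (?X e) (?X (?f e)) q (2 * r - q))"
      by (simp add: diff sum_distrib_left)
    finally have "(\<Sum>e\<in>signs S. e k * G e) = (\<Sum>e\<in>signs S. \<Sum>q\<le>2 * r. gtr N (H k) (?X e) (?X (?f e)) q (2 * r - q))"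
      by simp
    \<comment> \<open>Each of the \<open>2 * r + 1\<close> mixed traces is bounded by two pure ones.
      The flip permutes the sign vectors, so both have the same sum, which gives the factor
      \<open>2 * (2 * r + 1)\<close>.\<close>
    also have "\<dots> \<le> (\<Sum>e\<in>signs S. \<Sum>q\<le>2 * r. ?h k e + ?h k (?f e))"
      by (intro sum_mono gtr_le fin H k X) auto
    also have "\<dots> = (2 * real r + 1) * (\<Sum>e\<in>signs S. ?h k e + ?h k (?f e))"
      by (simp add: sum_distrib_left add.commute)
    also have "\<dots> = (2 * real r + 1) * (2 * (\<Sum>e\<in>signs S. ?h k e))"
      unfolding sum.distrib sum_signs_flip[OF k, of "?h k"] by simp
    also have "\<dots> = 2 * (2 * real r + 1) * (\<Sum>e\<in>signs S. ?h k e)" by (simp only: mult.assoc mult.left_commute)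
    finally show ?thesis unfolding G_def .
  qed
  have "(\<Sum>e\<in>signs S. mtr N (mpow N (?X e) (2 * Suc r)))
      = (\<Sum>e\<in>signs S. \<Sum>k\<in>S. e k * mtr N (mmul N (H k) (mpow N (?X e) (Suc (2 * r)))))"
  proof (intro sum.cong refl)
    fix e
    let ?Q = "mpow N (?X e) (Suc (2 * r))"
    have "mtr N (mpow N (?X e) (2 * Suc r)) = mtr N (mmul N (?X e) ?Q)" by simp
    also have "\<dots> = (\<Sum>i\<in>N. \<Sum>j\<in>N. \<Sum>k\<in>S. e k * H k i j * ?Q j i)"
      unfolding mtr_def mmul_def[of N "?X e" ?Q] by (simp only: sign_sum_def[of S H e] sum_distrib_right)
    also have "\<dots> = (\<Sum>i\<in>N. \<Sum>k\<in>S. \<Sum>j\<in>N. e k * H k i j * ?Q j i)"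
      by (intro sum.cong refl sum.swap)
    also have "\<dots> = (\<Sum>k\<in>S. \<Sum>i\<in>N. \<Sum>j\<in>N. e k * H k i j * ?Q j i)" by (rule sum.swap)
    also have "\<dots> = (\<Sum>k\<in>S. e k * mtr N (mmul N (H k) ?Q))"
      unfolding mtr_def mmul_def[of N "H _" ?Q] sum_distrib_left mult.assoc ..
    finally show "mtr N (mpow N (?X e) (2 * Suc r)) = (\<Sum>k\<in>S. e k * mtr N (mmul N (H k) ?Q))" .
  qed
  also have "\<dots> = (\<Sum>k\<in>S. \<Sum>e\<in>signs S. e k * mtr N (mmul N (H k) (mpow N (?X e) (Suc (2 * r)))))"
    by (rule sum.swap)
  also have "\<dots> \<le> (\<Sum>k\<in>S. 2 * (2 * real r + 1) * (\<Sum>e\<in>signs S. ?h k e))"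
    by (intro sum_mono main)
  also have "\<dots> = 2 * (2 * real r + 1) * (\<Sum>e\<in>signs S. \<Sum>k\<in>S. ?h k e)"
    by (subst sum.swap) (simp add: sum_distrib_left)
  also have "\<dots> \<le> 2 * (2 * real r + 1) * (\<Sum>e\<in>signs S. s\<^sup>2 * mtr N (mpow N (?X e) (2 * r)))"
    by (intro mult_left_mono sum_mono sum_mtr_sq_le fin X H le) auto
  finally show ?thesis by (simp add: sum_distrib_left mult_ac)
qed

text \<open>\<open>R\<close> stays fixed during the induction: each factor
  \<open>2 * (2 * r + 1)\<close> is at most \<open>4 * R\<close>, so the recursion produces a plain
  power instead of a double factorial.\<close>

lemma sum_signs_mtr_le:
  assumes fin: "finite N" "finite S" and H: "\<And>k. k \<in> S \<Longrightarrow> sym_on N (H k)"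
    and le: "\<And>v. (\<Sum>k\<in>S. (L2_set (mat_vec N (H k) v) N)\<^sup>2) \<le> s\<^sup>2 * (L2_set v N)\<^sup>2"
    and "r \<le> R"
  shows "(\<Sum>e\<in>signs S. mtr N (mpow N (sign_sum S H e) (2 * r)))
    \<le> (4 * real R * s\<^sup>2) ^ r * (real (card N) * 2 ^ card S)"
  using \<open>r \<le> R\<close>
proof (induction r)
  case 0
  show ?case using fin by (simp add: mtr_def mone_def card_signs)
next
  case (Suc r)
  have "(\<Sum>e\<in>signs S. mtr N (mpow N (sign_sum S H e) (2 * Suc r)))
    \<le> 2 * (2 * real r + 1) * s\<^sup>2 * (\<Sum>e\<in>signs S. mtr N (mpow N (sign_sum S H e) (2 * r)))"
    by (rule sum_signs_mtr_step[OF fin H le])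
  also have "\<dots> \<le> 2 * (2 * real r + 1) * s\<^sup>2 * ((4 * real R * s\<^sup>2) ^ r * (real (card N) * 2 ^ card S))"
    using Suc by (intro mult_left_mono) auto
  also have "\<dots> \<le> (4 * real R * s\<^sup>2) * ((4 * real R * s\<^sup>2) ^ r * (real (card N) * 2 ^ card S))"
    using Suc.prems by (intro mult_right_mono) auto
  finally show ?case by (simp add: mult_ac)
qed

text \<open>For symmetric \<open>X\<close> and \<open>|x| \<le> 1\<close>, \<open>|X^n x|^2\<close>
  is the quadratic form of \<open>X^(2n)\<close> at \<open>x\<close>, hence at most
  \<open>|X^(2n) x|\<close>. Iterating gives \<open>|X x|^(2^k) \<le> |X^(2^k) x|\<close>, and the
  squared Frobenius norm of \<open>X^(2^k)\<close> is the trace. The doubling is why the exponents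
  are powers of two.\<close>

lemma op_norm_power_le_mtr:
  assumes fin: "finite N" and X: "sym_on N X"
  shows "op_norm N N X ^ (2 * 2 ^ k) \<le> mtr N (mpow N X (2 * 2 ^ k))"
proof -
  let ?v = "\<lambda>n x. mat_vec N (mpow N X n) x"
  have sym: "mpow N X n i j = mpow N X n j i" for n i j
    using fun_cong[OF fun_cong[OF sym_onD(1)[OF sym_on_mpow[OF fin X, of n]]], of i j]
    by (simp add: transp_mat_def)
  have dbl: "(L2_set (?v n x) N)\<^sup>2 \<le> L2_set (?v (2 * n) x) N" if "L2_set x N \<le> 1" for n x
  proof -
    have "?v (2 * n) x i = (\<Sum>l\<in>N. mpow N X n i l * ?v n x l)" for i
    proof -
      have "?v (2 * n) x i = (\<Sum>j\<in>N. (\<Sum>l\<in>N. mpow N X n i l * mpow N X n l j) * x j)"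
        by (simp add: mult_2 mpow_add[OF fin X] mmul_def)
      also have "\<dots> = (\<Sum>l\<in>N. \<Sum>j\<in>N. mpow N X n i l * mpow N X n l j * x j)"
        unfolding sum_distrib_right by (rule sum.swap)
      finally show ?thesis by (simp add: sum_distrib_left mult.assoc)
    qed
    then have "(\<Sum>i\<in>N. x i * ?v (2 * n) x i) = (\<Sum>i\<in>N. \<Sum>l\<in>N. x i * (mpow N X n i l * ?v n x l))"
      by (simp add: sum_distrib_left)
    also have "\<dots> = (\<Sum>l\<in>N. \<Sum>i\<in>N. x i * (mpow N X n i l * ?v n x l))" by (rule sum.swap)
    also have "\<dots> = (\<Sum>l\<in>N. ?v n x l * ?v n x l)"
      unfolding sum_distrib_right
      by (intro sum.cong refl) (use sym in \<open>simp add: sum_distrib_left sum_distrib_right mult_ac\<close>)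
    also have "\<dots> = (L2_set (?v n x) N)\<^sup>2" unfolding L2_set_power2 by (simp add: power2_eq_square)
    finally have "(L2_set (?v n x) N)\<^sup>2 \<le> L2_set x N * L2_set (?v (2 * n) x) N"
      using abs_sum_mult_le_L2_set[of x "?v (2 * n) x" N] by linarith
    also have "\<dots> \<le> 1 * L2_set (?v (2 * n) x) N" using that by (intro mult_right_mono) auto
    finally show ?thesis by simp
  qed
  have pow: "L2_set (mat_vec N X x) N ^ 2 ^ k \<le> L2_set (?v (2 ^ k) x) N" if x: "L2_set x N \<le> 1" for x
  proof (induction k)
    case 0
    then show ?case using mone_right[OF fin X] by simp
  next
    case (Suc k)
    have "L2_set (mat_vec N X x) N ^ 2 ^ Suc k = (L2_set (mat_vec N X x) N ^ 2 ^ k)\<^sup>2"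
      by (simp add: power_mult[symmetric] mult.commute)
    also have "\<dots> \<le> (L2_set (?v (2 ^ k) x) N)\<^sup>2" by (intro power_mono Suc) auto
    also have "\<dots> \<le> L2_set (?v (2 ^ Suc k) x) N" using dbl[OF x] by simp
    finally show ?case .
  qed
  let ?T = "mtr N (mpow N X (2 * 2 ^ k))"
  have T: "?T = (L2_set (\<lambda>i. L2_set (mpow N X (2 ^ k) i) N) N)\<^sup>2"
  proof -
    have "?T = mtr N (mmul N (mpow N X (2 ^ k)) (transp_mat (mpow N X (2 ^ k))))"
      by (simp only: mult_2 mpow_add[OF fin X] sym_onD(1)[OF sym_on_mpow[OF fin X, of "2 ^ k"]])
    then show ?thesis unfolding mtr_transp L2_set_power2 by (simp add: power2_eq_square)
  qed
  have bound: "L2_set (mat_vec N X x) N ^ (2 * 2 ^ k) \<le> ?T" if x: "L2_set x N \<le> 1" for x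
  proof -
    have "L2_set (mat_vec N X x) N ^ 2 ^ k \<le> L2_set (\<lambda>i. L2_set (mpow N X (2 ^ k) i) N) N * L2_set x N"
      using pow[OF x] L2_set_mat_vec_le[of "mpow N X (2 ^ k)" x N N] by linarith
    also have "\<dots> \<le> L2_set (\<lambda>i. L2_set (mpow N X (2 ^ k) i) N) N * 1"
      using x by (intro mult_left_mono) auto
    finally have "(L2_set (mat_vec N X x) N ^ 2 ^ k)\<^sup>2 \<le> ?T"
      unfolding T by (intro power_mono) auto
    then show ?thesis by (simp add: power_mult[symmetric] mult.commute)
  qed
  have n0: "(2 * 2 ^ k :: nat) > 0" by simp
  have T0: "?T \<ge> 0" unfolding T by simp
  have "op_norm N N X \<le> root (2 * 2 ^ k) ?T"
    unfolding op_norm_def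
  proof (rule cSup_least)
    show "{L2_set (mat_vec N X x) N |x. L2_set x N \<le> 1} \<noteq> {}"
      by (auto intro!: exI[of _ "\<lambda>_. 0"] simp: L2_set_0')
    fix z assume "z \<in> {L2_set (mat_vec N X x) N |x. L2_set x N \<le> 1}"
    then obtain x where z: "z = L2_set (mat_vec N X x) N" "L2_set x N \<le> 1" by auto
    then have "z = root (2 * 2 ^ k) (z ^ (2 * 2 ^ k))" using n0 by (simp add: real_root_power_cancel)
    also have "\<dots> \<le> root (2 * 2 ^ k) ?T"
      using bound z n0 by (intro real_root_le_mono) auto
    finally show "z \<le> root (2 * 2 ^ k) ?T" .
  qed
  then have "op_norm N N X ^ (2 * 2 ^ k) \<le> root (2 * 2 ^ k) ?T ^ (2 * 2 ^ k)"
    by (intro power_mono) (auto simp: op_norm_nonneg)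
  also have "\<dots> = ?T" using n0 T0 by (rule real_root_pow_pos2)
  finally show ?thesis .
qed

text \<open>Jensen's inequality up to a factor 2, from the pointwise bound
  \<open>f \<le> M + f^n / M^(n-1)\<close>: either \<open>f \<le> M\<close>, or the second term is
  at least \<open>f\<close>.\<close>

lemma sum_le_of_sum_power_le:
  fixes f :: "'a \<Rightarrow> real"
  assumes fin: "finite E" and f: "\<And>e. e \<in> E \<Longrightarrow> 0 \<le> f e" and n: "n > 0"
    and M: "0 \<le> M" and le: "(\<Sum>e\<in>E. f e ^ n) \<le> M ^ n * real (card E)"
  shows "(\<Sum>e\<in>E. f e) \<le> 2 * M * real (card E)"
proof (cases "M = 0")
  case True
  then have "(\<Sum>e\<in>E. f e ^ n) \<le> 0" using le n by (simp add: zero_power)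
  moreover have "0 \<le> (\<Sum>e\<in>E. f e ^ n)" using f by (intro sum_nonneg) auto
  ultimately have "(\<Sum>e\<in>E. f e ^ n) = 0" by linarith
  then have "\<forall>e\<in>E. f e ^ n = 0"
    using sum_nonneg_eq_0_iff[OF fin, of "\<lambda>e. f e ^ n"] f by simp
  then show ?thesis using True n by simp
next
  case False
  then have M: "M > 0" using M by simp
  have "f e \<le> M + f e ^ n / M ^ (n - 1)" if "e \<in> E" for e
  proof (cases "f e \<le> M")
    case True
    then show ?thesis using f[OF that] M by (simp add: add_increasing2)
  next
    case False
    have "f e * M ^ (n - 1) \<le> f e * f e ^ (n - 1)"
      using False M f[OF that] by (intro mult_left_mono power_mono) auto
    also have "\<dots> = f e ^ n" using n by (simp flip: power_Suc)
    finally have "f e \<le> f e ^ n / M ^ (n - 1)" using M by (simp add: field_simps)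
    then show ?thesis using M by linarith
  qed
  then have "(\<Sum>e\<in>E. f e) \<le> (\<Sum>e\<in>E. M + f e ^ n / M ^ (n - 1))" by (intro sum_mono)
  also have "\<dots> = real (card E) * M + (\<Sum>e\<in>E. f e ^ n) / M ^ (n - 1)"
    by (simp add: sum.distrib sum_divide_distrib)
  also have "\<dots> \<le> real (card E) * M + M ^ n * real (card E) / M ^ (n - 1)"
    using M le by (intro add_left_mono divide_right_mono) auto
  also have "M ^ n * real (card E) / M ^ (n - 1) = M * real (card E)"
    using M n by (cases n) (auto simp: field_simps)
  finally show ?thesis by (simp add: mult_ac)
qed

text \<open>The comparison of norm and trace holds for powers of two; rounding the moment order to
  one costs a factor 2.\<close>

lemma power_of_two_between:
  fixes p :: real
  assumes "1 \<le> p"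
  obtains k :: nat where "p \<le> 2 ^ k" "2 ^ k \<le> 2 * p"
proof -
  define k where "k = nat \<lceil>log 2 p\<rceil>"
  have l: "0 \<le> log 2 p" using assms by simp
  have "p = 2 powr log 2 p" using assms by simp
  also have "\<dots> \<le> 2 powr real k" unfolding k_def using l by (intro powr_mono) (auto simp: of_nat_nat)
  finally have "p \<le> 2 ^ k" by (simp add: powr_realpow)
  have "2 powr real k \<le> 2 powr (log 2 p + 1)"
  proof (intro powr_mono)
    show "real k \<le> log 2 p + 1" unfolding k_def using l by linarith
  qed simp
  also have "\<dots> = 2 * p" using assms by (simp add: powr_add)
  finally have "2 ^ k \<le> 2 * p" by (simp add: powr_realpow)
  with \<open>p \<le> 2 ^ k\<close> show ?thesis by (rule that)
qed

text \<open>One factor 2 comes from \<open>sqrt (4 * R)\<close>, the other from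
  \<open>sum_le_of_sum_power_le\<close>; \<open>exp K\<close> bounds the root of the
  dimension.\<close>

definition nck_const :: "real \<Rightarrow> real" where "nck_const K = 4 * exp K"

lemma nck_const_pos: "nck_const K > 0" by (simp add: nck_const_def)

lemma noncommutative_khintchine_sym_on:
  assumes fin: "finite N" "finite S" and H: "\<And>k. k \<in> S \<Longrightarrow> sym_on N (H k)"
    and le: "\<And>v. (\<Sum>k\<in>S. (L2_set (mat_vec N (H k) v) N)\<^sup>2) \<le> s\<^sup>2 * (L2_set v N)\<^sup>2"
    and s: "0 \<le> s" and p: "2 \<le> p" and K: "0 \<le> K" and card: "real (card N) \<le> exp (K * p)"
  shows "(\<Sum>e\<in>signs S. op_norm N N (sign_sum S H e)) \<le> nck_const K * sqrt p * s * 2 ^ card S"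
proof -
  \<comment> \<open>The order \<open>n = 2 * 2 ^ j\<close> is at least \<open>p\<close>, so its root
    of the dimension is at most \<open>exp K\<close>, while \<open>R = 2 ^ j\<close> is at most
    \<open>p\<close>, which keeps the factor \<open>sqrt p\<close>.\<close>
  obtain j where j: "p / 2 \<le> 2 ^ j" "2 ^ j \<le> 2 * (p / 2)"
    using p by (auto intro: power_of_two_between[of "p / 2"])
  define R :: nat where "R = 2 ^ j"
  define n :: nat where "n = 2 * 2 ^ j"
  define M where "M = 2 * sqrt (real R) * s * exp K"
  have R: "p \<le> real n" "real R \<le> p" "n = 2 * R" using j by (auto simp: R_def n_def)
  have X: "sym_on N (sign_sum S H e)" for e by (rule sym_on_sign_sum[OF H])
  have "(\<Sum>e\<in>signs S. op_norm N N (sign_sum S H e) ^ n) \<le> (\<Sum>e\<in>signs S. mtr N (mpow N (sign_sum S H e) n))"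
    unfolding n_def by (intro sum_mono op_norm_power_le_mtr fin X)
  also have "\<dots> \<le> (4 * real R * s\<^sup>2) ^ R * (real (card N) * 2 ^ card S)"
    unfolding R(3) by (rule sum_signs_mtr_le[OF fin H le]) simp_all
  also have "\<dots> \<le> (4 * real R * s\<^sup>2) ^ R * (exp K ^ n * 2 ^ card S)"
  proof (intro mult_left_mono mult_right_mono)
    have "K * p \<le> real n * K" using R(1) K by (simp add: mult.commute[of K] mult_right_mono)
    then show "real (card N) \<le> exp K ^ n"
      using card order_trans by (fastforce simp flip: exp_of_nat_mult)
  qed auto
  also have "\<dots> = M ^ n * real (card (signs S))"
  proof -
    have "M\<^sup>2 = 4 * real R * s\<^sup>2 * (exp K)\<^sup>2" by (simp add: M_def power_mult_distrib)
    then have "M ^ n = (4 * real R * s\<^sup>2 * (exp K)\<^sup>2) ^ R" unfolding R(3) power_mult by simp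
    also have "\<dots> = (4 * real R * s\<^sup>2) ^ R * exp K ^ n" unfolding R(3) power_mult by (rule power_mult_distrib)
    finally show ?thesis using fin by (simp add: card_signs)
  qed
  finally have "(\<Sum>e\<in>signs S. op_norm N N (sign_sum S H e)) \<le> 2 * M * real (card (signs S))"
    using s by (intro sum_le_of_sum_power_le[of _ _ n] finite_signs fin op_norm_nonneg) (auto simp: n_def M_def)
  also have "\<dots> = sqrt (real R) * (4 * exp K * s * 2 ^ card S)"
    using fin by (simp add: M_def card_signs)
  also have "\<dots> \<le> sqrt p * (4 * exp K * s * 2 ^ card S)"
    using R(2) s by (intro mult_right_mono) auto
  finally show ?thesis by (simp add: nck_const_def mult_ac)
qed

lemma noncommutative_khintchine_sym:
  assumes fin: "finite N" "finite S"
    and H: "\<And>k i j. k \<in> S \<Longrightarrow> i \<in> N \<Longrightarrow> j \<in> N \<Longrightarrow> H k i j = H k j i"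
    and le: "\<And>v. (\<Sum>k\<in>S. (L2_set (mat_vec N (H k) v) N)\<^sup>2) \<le> s\<^sup>2 * (L2_set v N)\<^sup>2"
    and s: "0 \<le> s" and p: "2 \<le> p" and K: "0 \<le> K" and card: "real (card N) \<le> exp (K * p)"
  shows "(\<Sum>e\<in>signs S. op_norm N N (sign_sum S H e)) \<le> nck_const K * sqrt p * s * 2 ^ card S"
proof -
  define G where "G k i j = (if i \<in> N \<and> j \<in> N then H k i j else 0)" for k i j
  have "sym_on N (G k)" if "k \<in> S" for k
    using H[OF that] by (intro sym_onI) (auto simp: G_def transp_mat_def fun_eq_iff split: if_splits)
  moreover have "(\<Sum>k\<in>S. (L2_set (mat_vec N (G k) v) N)\<^sup>2) \<le> s\<^sup>2 * (L2_set v N)\<^sup>2" for v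
  proof -
    have "L2_set (mat_vec N (G k) v) N = L2_set (mat_vec N (H k) v) N" for k
      by (intro L2_set_cong sum.cong) (auto simp: G_def)
    then show ?thesis using le by simp
  qed
  ultimately have "(\<Sum>e\<in>signs S. op_norm N N (sign_sum S G e)) \<le> nck_const K * sqrt p * s * 2 ^ card S"
    using fin s p K card by (intro noncommutative_khintchine_sym_on)
  moreover have "op_norm N N (sign_sum S G e) = op_norm N N (sign_sum S H e)" for e
    by (intro op_norm_cong) (auto simp: G_def sign_sum_def)
  ultimately show ?thesis by simp
qed

text \<open>Hermitian dilation: the symmetric block matrix with \<open>B k\<close> and its transpose
  off the diagonal contains \<open>B k\<close> as a corner, and its square acts on the two halves
  separately, so the two variance bounds combine into one. The sum of the two dimensions costs a
  factor \<open>2 \<le> exp p\<close>, hence \<open>K + 1\<close>.\<close>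

lemma noncommutative_khintchine:
  assumes fin: "finite I" "finite J" "finite S"
    and le1: "\<And>v. (\<Sum>k\<in>S. (L2_set (mat_vec J (B k) v) I)\<^sup>2) \<le> s\<^sup>2 * (L2_set v J)\<^sup>2"
    and le2: "\<And>v. (\<Sum>k\<in>S. (L2_set (mat_vec I (transp_mat (B k)) v) J)\<^sup>2) \<le> s\<^sup>2 * (L2_set v I)\<^sup>2"
    and s: "0 \<le> s" and p: "2 \<le> p" and K: "0 \<le> K"
    and card: "real (card I) \<le> exp (K * p)" "real (card J) \<le> exp (K * p)"
  shows "(\<Sum>e\<in>signs S. op_norm I J (sign_sum S B e)) \<le> nck_const (K + 1) * sqrt p * s * 2 ^ card S"
proof -
  define H where "H k x y = (case (x, y) of (Inl i, Inr j) \<Rightarrow> B k i j | (Inr j, Inl i) \<Rightarrow> B k i j | _ \<Rightarrow> 0)"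
    for k x y
  let ?N = "I <+> J"
  have L2: "(L2_set v ?N)\<^sup>2 = (L2_set (\<lambda>i. v (Inl i)) I)\<^sup>2 + (L2_set (\<lambda>j. v (Inr j)) J)\<^sup>2" for v
    using fin by (simp add: L2_set_power2 sum.Plus)
  have mv: "mat_vec ?N (H k) v (Inl i) = mat_vec J (B k) (\<lambda>j. v (Inr j)) i"
    "mat_vec ?N (H k) v (Inr j) = mat_vec I (transp_mat (B k)) (\<lambda>i. v (Inl i)) j" for k v i j
    using fin by (auto simp: sum.Plus H_def transp_mat_def)
  have "(\<Sum>e\<in>signs S. op_norm I J (sign_sum S B e)) \<le> (\<Sum>e\<in>signs S. op_norm ?N ?N (sign_sum S H e))"
    using fin by (intro sum_mono op_norm_submatrix[where f = Inl and g = Inr])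
      (auto simp: sign_sum_def H_def)
  also have "\<dots> \<le> nck_const (K + 1) * sqrt p * s * 2 ^ card S"
  proof (rule noncommutative_khintchine_sym)
    show "H k x y = H k y x" for k x y by (simp add: H_def split: sum.split)
    fix v
    have "(\<Sum>k\<in>S. (L2_set (mat_vec ?N (H k) v) ?N)\<^sup>2)
        = (\<Sum>k\<in>S. (L2_set (mat_vec J (B k) (\<lambda>j. v (Inr j))) I)\<^sup>2)
          + (\<Sum>k\<in>S. (L2_set (mat_vec I (transp_mat (B k)) (\<lambda>i. v (Inl i))) J)\<^sup>2)"
      unfolding L2 mv by (rule sum.distrib)
    also have "\<dots> \<le> s\<^sup>2 * (L2_set v ?N)\<^sup>2"
      unfolding L2 using le1[of "\<lambda>j. v (Inr j)"] le2[of "\<lambda>i. v (Inl i)"] by (simp add: distrib_left)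
    finally show "(\<Sum>k\<in>S. (L2_set (mat_vec ?N (H k) v) ?N)\<^sup>2) \<le> s\<^sup>2 * (L2_set v ?N)\<^sup>2" .
  next
    have "real (card ?N) \<le> 2 * exp (K * p)" using card fin by (simp add: card_Plus)
    also have "2 \<le> exp p" using exp_ge_add_one_self[of p] p by linarith
    then have "2 * exp (K * p) \<le> exp p * exp (K * p)" by (intro mult_right_mono) auto
    also have "\<dots> = exp ((K + 1) * p)" by (simp add: algebra_simps flip: exp_add)
    finally show "real (card ?N) \<le> exp ((K + 1) * p)" .
  qed (use fin s p K in auto)
  finally show ?thesis .
qed

section \<open>Symmetrization and lower bounds\<close>

lemma sum_signs_insert:
  assumes "finite S" "k \<notin> S"
  shows "(\<Sum>e\<in>signs (insert k S). f e) = (\<Sum>e\<in>signs S. f (e(k := 1)) + f (e(k := -1)))"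
proof -
  let ?u = "\<lambda>(y, e). e(k := y)"
  have inj: "inj_on ?u ({-1, 1} \<times> signs S)"
    unfolding signs_def using assms(2) inj_combinator[of k S "\<lambda>_. {-1, 1 :: real}"] by simp
  have "signs (insert k S) = ?u ` ({-1, 1} \<times> signs S)"
    unfolding signs_def by (rule PiE_insert_eq)
  then have "(\<Sum>e\<in>signs (insert k S). f e) = (\<Sum>z\<in>{-1, 1} \<times> signs S. f (?u z))"
    using inj by (simp add: sum.reindex)
  also have "\<dots> = (\<Sum>y\<in>{-1, 1}. \<Sum>e\<in>signs S. f (e(k := y)))"
    by (simp add: sum.cartesian_product case_prod_beta)
  also have "\<dots> = (\<Sum>e\<in>signs S. f (e(k := 1)) + f (e(k := -1)))"
    by (simp add: sum.distrib add.commute)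
  finally show ?thesis .
qed

text \<open>With squared lengths \<open>s\<close>, \<open>t\<close> and inner product
  \<open>u\<close>, the squares of \<open>s + t + 2 u\<close> and \<open>s + t - 2 u\<close> add up
  to \<open>2 (s + t)^2 + 8 u^2\<close>; Cauchy-Schwarz \<open>u^2 \<le> s t\<close> then gives the
  coefficient 12.\<close>

lemma sum_sq_add_diff:
  fixes a b :: "'j \<Rightarrow> real"
  shows "(L2_set (\<lambda>j. a j + b j) J)\<^sup>2 + (L2_set (\<lambda>j. a j - b j) J)\<^sup>2
      = 2 * (L2_set a J)\<^sup>2 + 2 * (L2_set b J)\<^sup>2"
    and "((L2_set (\<lambda>j. a j + b j) J)\<^sup>2)\<^sup>2 + ((L2_set (\<lambda>j. a j - b j) J)\<^sup>2)\<^sup>2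
      \<le> 2 * ((L2_set a J)\<^sup>2)\<^sup>2 + 12 * (L2_set a J)\<^sup>2 * (L2_set b J)\<^sup>2 + 2 * ((L2_set b J)\<^sup>2)\<^sup>2"
proof -
  define s t u where "s = (L2_set a J)\<^sup>2" and "t = (L2_set b J)\<^sup>2" and "u = (\<Sum>j\<in>J. a j * b j)"
  have p: "(L2_set (\<lambda>j. a j + b j) J)\<^sup>2 = s + t + 2 * u"
    unfolding s_def t_def u_def L2_set_power2
    by (simp add: power2_sum sum.distrib sum_distrib_left mult_ac)
  have m: "(L2_set (\<lambda>j. a j - b j) J)\<^sup>2 = s + t - 2 * u"
    unfolding s_def t_def u_def L2_set_power2
    by (simp add: power2_diff sum.distrib sum_subtractf sum_distrib_left mult_ac)
  have "u\<^sup>2 \<le> s * t"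
    unfolding u_def s_def t_def L2_set_power2 by (rule Cauchy_Schwarz_ineq_sum)
  then show "((L2_set (\<lambda>j. a j + b j) J)\<^sup>2)\<^sup>2 + ((L2_set (\<lambda>j. a j - b j) J)\<^sup>2)\<^sup>2
      \<le> 2 * ((L2_set a J)\<^sup>2)\<^sup>2 + 12 * (L2_set a J)\<^sup>2 * (L2_set b J)\<^sup>2 + 2 * ((L2_set b J)\<^sup>2)\<^sup>2"
    unfolding p m s_def[symmetric] t_def[symmetric] by (simp add: power2_eq_square algebra_simps)
  show "(L2_set (\<lambda>j. a j + b j) J)\<^sup>2 + (L2_set (\<lambda>j. a j - b j) J)\<^sup>2
      = 2 * (L2_set a J)\<^sup>2 + 2 * (L2_set b J)\<^sup>2"
    unfolding p m s_def t_def by simp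
qed

text \<open>Both moments go through one induction because the fourth moment of a longer sum involves
  the second moment of the shorter one. The coefficient 12 is the mixed one in
  \<open>6 (V + t)^2\<close>, which is why the constant 3 persists.\<close>

lemma sum_signs_moments:
  fixes b :: "'k \<Rightarrow> 'j \<Rightarrow> real" and J :: "'j set"
  assumes "finite S"
  defines "V \<equiv> \<Sum>k\<in>S. (L2_set (b k) J)\<^sup>2"
  shows "(\<Sum>e\<in>signs S. (L2_set (\<lambda>j. \<Sum>k\<in>S. e k * b k j) J)\<^sup>2) = 2 ^ card S * V \<and>
    (\<Sum>e\<in>signs S. ((L2_set (\<lambda>j. \<Sum>k\<in>S. e k * b k j) J)\<^sup>2)\<^sup>2) \<le> 3 * 2 ^ card S * V\<^sup>2"
  unfolding V_def using assms(1)
proof (induction S)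
  case empty
  show ?case by (simp add: signs_def L2_set_0')
next
  case (insert k S)
  let ?a = "\<lambda>e j. \<Sum>k\<in>S. e k * b k j"
  let ?V = "\<Sum>k\<in>S. (L2_set (b k) J)\<^sup>2" and ?t = "(L2_set (b k) J)\<^sup>2"
  have eq: "(\<lambda>j. \<Sum>l\<in>insert k S. (e(k := 1)) l * b l j) = (\<lambda>j. ?a e j + b k j)"
    "(\<lambda>j. \<Sum>l\<in>insert k S. (e(k := - 1)) l * b l j) = (\<lambda>j. ?a e j - b k j)" for e :: "'k \<Rightarrow> real"
  proof -
    have "(\<Sum>l\<in>S. (e(k := y)) l * b l j) = ?a e j" for y j
      using insert.hyps by (intro sum.cong) auto
    then show "(\<lambda>j. \<Sum>l\<in>insert k S. (e(k := 1)) l * b l j) = (\<lambda>j. ?a e j + b k j)"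
      "(\<lambda>j. \<Sum>l\<in>insert k S. (e(k := - 1)) l * b l j) = (\<lambda>j. ?a e j - b k j)"
      using insert.hyps by (simp_all add: fun_eq_iff)
  qed
  have card: "real (card (signs S)) = 2 ^ card S" using insert.hyps by (simp add: card_signs)
  have IH: "(\<Sum>e\<in>signs S. (L2_set (?a e) J)\<^sup>2) = 2 ^ card S * ?V"
    "(\<Sum>e\<in>signs S. ((L2_set (?a e) J)\<^sup>2)\<^sup>2) \<le> 3 * 2 ^ card S * ?V\<^sup>2"
    using insert.IH by auto
  have "(\<Sum>e\<in>signs (insert k S). (L2_set (\<lambda>j. \<Sum>l\<in>insert k S. e l * b l j) J)\<^sup>2)
      = (\<Sum>e\<in>signs S. 2 * (L2_set (?a e) J)\<^sup>2 + 2 * ?t)"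
    unfolding sum_signs_insert[OF insert.hyps] eq sum_sq_add_diff(1) ..
  also have "\<dots> = 2 ^ card (insert k S) * (\<Sum>l\<in>insert k S. (L2_set (b l) J)\<^sup>2)"
    using insert.hyps by (simp add: sum.distrib IH card algebra_simps flip: sum_distrib_left)
  finally have 1: "(\<Sum>e\<in>signs (insert k S). (L2_set (\<lambda>j. \<Sum>l\<in>insert k S. e l * b l j) J)\<^sup>2)
    = 2 ^ card (insert k S) * (\<Sum>l\<in>insert k S. (L2_set (b l) J)\<^sup>2)" .
  have "(\<Sum>e\<in>signs (insert k S). ((L2_set (\<lambda>j. \<Sum>l\<in>insert k S. e l * b l j) J)\<^sup>2)\<^sup>2)
      \<le> (\<Sum>e\<in>signs S. 2 * ((L2_set (?a e) J)\<^sup>2)\<^sup>2 + 12 * (L2_set (?a e) J)\<^sup>2 * ?t + 2 * ?t\<^sup>2)"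
    unfolding sum_signs_insert[OF insert.hyps] eq by (intro sum_mono sum_sq_add_diff(2))
  also have "\<dots> = 2 * (\<Sum>e\<in>signs S. ((L2_set (?a e) J)\<^sup>2)\<^sup>2)
      + 12 * ?t * (\<Sum>e\<in>signs S. (L2_set (?a e) J)\<^sup>2) + 2 * ?t\<^sup>2 * 2 ^ card S"
    by (simp add: sum.distrib sum_distrib_left card mult_ac)
  also have "\<dots> \<le> 2 * (3 * 2 ^ card S * ?V\<^sup>2) + 12 * ?t * (2 ^ card S * ?V) + 2 * ?t\<^sup>2 * 2 ^ card S"
    using IH by simp
  also have "\<dots> \<le> 3 * 2 ^ card (insert k S) * (?t + ?V)\<^sup>2"
  proof -
    have "3 * 2 ^ card (insert k S) * (?t + ?V)\<^sup>2
        - (2 * (3 * 2 ^ card S * ?V\<^sup>2) + 12 * ?t * (2 ^ card S * ?V) + 2 * ?t\<^sup>2 * 2 ^ card S)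
        = 4 * 2 ^ card S * ?t\<^sup>2"
      using insert.hyps by (simp add: power2_sum algebra_simps)
    then show ?thesis by (smt (verit) mult_nonneg_nonneg zero_le_power zero_le_power2)
  qed
  finally show ?case using 1 insert.hyps by simp
qed

text \<open>The constant comes from \<open>2 t \<ge> 3 t\<^sup>2 - t\<^sup>4\<close>, rescaled by \<open>3 w / 2\<close>, which trades the
  first moment for the second and the fourth.\<close>

lemma khintchine_L1_lower:
  fixes b :: "'k \<Rightarrow> 'j \<Rightarrow> real"
  assumes "finite S"
  shows "2 ^ card S * sqrt (\<Sum>k\<in>S. (L2_set (b k) J)\<^sup>2)
    \<le> 2 * (\<Sum>e\<in>signs S. L2_set (\<lambda>j. \<Sum>k\<in>S. e k * b k j) J)"
proof -
  define V where "V = (\<Sum>k\<in>S. (L2_set (b k) J)\<^sup>2)"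
  define w where "w = sqrt V"
  let ?X = "\<lambda>e. L2_set (\<lambda>j. \<Sum>k\<in>S. e k * b k j) J"
  have V0: "V \<ge> 0" by (simp add: V_def sum_nonneg)
  then have V: "V = w\<^sup>2" and w0: "w \<ge> 0" by (simp_all add: w_def)
  have pt: "(27 / 4 * w ^ 2) * t\<^sup>2 - (t\<^sup>2)\<^sup>2 \<le> (27 / 4 * w ^ 3) * t" if "t \<ge> 0" for t :: real
  proof -
    \<comment> \<open>The difference of the two sides has a double root at \<open>3 w / 2\<close>, a
      rational scale near the optimal \<open>sqrt 3 * w\<close>.\<close>
    have "0 \<le> t * ((t - 3 / 2 * w)\<^sup>2 * (t + 3 * w))"
      using that w0 by (intro mult_nonneg_nonneg) auto
    also have "\<dots> = (27 / 4 * w ^ 3) * t - ((27 / 4 * w ^ 2) * t\<^sup>2 - (t\<^sup>2)\<^sup>2)"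
      by (simp add: power2_eq_square power3_eq_cube algebra_simps)
    finally show ?thesis by simp
  qed
  have "(\<Sum>e\<in>signs S. (27 / 4 * w ^ 2) * (?X e)\<^sup>2 - ((?X e)\<^sup>2)\<^sup>2) \<le> (\<Sum>e\<in>signs S. (27 / 4 * w ^ 3) * ?X e)"
    by (intro sum_mono pt) simp
  then have "(27 / 4 * w ^ 2) * (\<Sum>e\<in>signs S. (?X e)\<^sup>2) - (\<Sum>e\<in>signs S. ((?X e)\<^sup>2)\<^sup>2)
      \<le> (27 / 4 * w ^ 3) * (\<Sum>e\<in>signs S. ?X e)"
    by (simp add: sum_subtractf sum_distrib_left)
  moreover have "(\<Sum>e\<in>signs S. (?X e)\<^sup>2) = 2 ^ card S * w\<^sup>2"
    "(\<Sum>e\<in>signs S. ((?X e)\<^sup>2)\<^sup>2) \<le> 3 * 2 ^ card S * (w\<^sup>2)\<^sup>2"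
    using sum_signs_moments[OF assms, of b J] V unfolding V_def[symmetric] by auto
  ultimately have "(27 / 4 * w ^ 2) * (2 ^ card S * w\<^sup>2) - 3 * 2 ^ card S * (w\<^sup>2)\<^sup>2
      \<le> (27 / 4 * w ^ 3) * (\<Sum>e\<in>signs S. ?X e)"
    by (smt (verit))
  \<comment> \<open>The two moments leave \<open>27/4 - 3 = 15/4\<close>; the ratio 15/27 exceeds
    1/2, whence the factor 2.\<close>
  then have le: "w ^ 3 * (15 / 4 * (2 ^ card S * w)) \<le> w ^ 3 * (27 / 4 * (\<Sum>e\<in>signs S. ?X e))"
    by (simp add: power2_eq_square power3_eq_cube algebra_simps)
  show ?thesis
  proof (cases "w = 0")
    case True
    then show ?thesis by (simp add: w_def V_def sum_nonneg)
  next
    case False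
    then have "w > 0" using w0 by simp
    then have "15 / 4 * (2 ^ card S * w) \<le> 27 / 4 * (\<Sum>e\<in>signs S. ?X e)"
      using le by (simp add: mult_le_cancel_left_pos)
    moreover have "0 \<le> (\<Sum>e\<in>signs S. ?X e)" by (intro sum_nonneg) simp
    ultimately show ?thesis unfolding V_def[symmetric] w_def[symmetric] by linarith
  qed
qed

section \<open>Families of matrices stacked into one\<close>

definition row_mat :: "('k \<Rightarrow> 'i \<Rightarrow> 'j \<Rightarrow> real) \<Rightarrow> 'i \<Rightarrow> 'k \<times> 'j \<Rightarrow> real" where
  "row_mat A i l = A (fst l) i (snd l)"

definition col_mat :: "('k \<Rightarrow> 'i \<Rightarrow> 'j \<Rightarrow> real) \<Rightarrow> 'k \<times> 'i \<Rightarrow> 'j \<Rightarrow> real" where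
  "col_mat A l j = A (fst l) (snd l) j"

lemma col_mat_L2:
  "(L2_set (mat_vec J (col_mat A) v) (S \<times> I))\<^sup>2 = (\<Sum>k\<in>S. (L2_set (mat_vec J (A k) v) I)\<^sup>2)"
  unfolding L2_set_power2 col_mat_def by (simp add: sum.cartesian_product case_prod_beta)

text \<open>The variance hypothesis of the Khintchine inequality: as quadratic forms,
  \<open>\<Sum>\<^sub>k A\<^sub>k^T A\<^sub>k\<close> is at most the squared norm of the stacked
  matrix.\<close>

lemma col_mat_le:
  "(\<Sum>k\<in>S. (L2_set (mat_vec J (A k) v) I)\<^sup>2) \<le> (op_norm (S \<times> I) J (col_mat A))\<^sup>2 * (L2_set v J)\<^sup>2"
  unfolding col_mat_L2[symmetric] power_mult_distrib[symmetric]
  by (intro power_mono L2_set_mat_vec_le_op_norm) simp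

text \<open>Row norms become column norms of the transposed family, so the probabilistic estimates
  are proved for columns only.\<close>

lemma op_norm_row_transpose:
  "op_norm I (S \<times> J) (row_mat A) = op_norm (S \<times> J) I (col_mat (\<lambda>k. transp_mat (A k)))"
proof -
  have "(\<lambda>j i. row_mat A i j) = col_mat (\<lambda>k. transp_mat (A k))"
    by (simp add: fun_eq_iff row_mat_def col_mat_def transp_mat_def)
  then show ?thesis using op_norm_transpose[of "S \<times> J" I "row_mat A"] by simp
qed

text \<open>For fixed \<open>v\<close> the inequality for vectors is applied to the images
  \<open>A k v\<close>, and each signed sum of these is at most the norm of the signed matrix; the
  supremum over \<open>v\<close> is taken after averaging.\<close>

lemma khintchine_matrix_lower:
  assumes fin: "finite S"
  shows "2 ^ card S * op_norm (S \<times> I) J (col_mat A) \<le> 2 * (\<Sum>e\<in>signs S. op_norm I J (sign_sum S A e))"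
proof -
  have "op_norm (S \<times> I) J (col_mat A) \<le> 2 / 2 ^ card S * (\<Sum>e\<in>signs S. op_norm I J (sign_sum S A e))"
  proof (rule op_norm_leI)
    fix v
    have eq: "mat_vec J (sign_sum S A e) v i = (\<Sum>k\<in>S. e k * mat_vec J (A k) v i)" for e i
      unfolding sign_sum_def sum_distrib_right sum_distrib_left
      by (subst sum.swap) (simp add: mult_ac)
    have "2 ^ card S * L2_set (mat_vec J (col_mat A) v) (S \<times> I)
        = 2 ^ card S * sqrt (\<Sum>k\<in>S. (L2_set (mat_vec J (A k) v) I)\<^sup>2)"
      unfolding col_mat_L2[symmetric] by simp
    also have "\<dots> \<le> 2 * (\<Sum>e\<in>signs S. L2_set (mat_vec J (sign_sum S A e) v) I)"
      using khintchine_L1_lower[OF fin, of "\<lambda>k. mat_vec J (A k) v" I] unfolding eq .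
    also have "\<dots> \<le> 2 * (\<Sum>e\<in>signs S. op_norm I J (sign_sum S A e) * L2_set v J)"
      by (intro mult_left_mono sum_mono L2_set_mat_vec_le_op_norm) auto
    also have "\<dots> = 2 ^ card S * (2 / 2 ^ card S * (\<Sum>e\<in>signs S. op_norm I J (sign_sum S A e)) * L2_set v J)"
      by (simp add: sum_distrib_right)
    finally show "L2_set (mat_vec J (col_mat A) v) (S \<times> I)
        \<le> 2 / 2 ^ card S * (\<Sum>e\<in>signs S. op_norm I J (sign_sum S A e)) * L2_set v J"
      by (rule mult_left_le_imp_le) simp
  qed (simp add: sum_nonneg op_norm_nonneg)
  then show ?thesis by (simp add: field_simps)
qed

section \<open>Random sums over a product of copies of one law\<close>

lemma (in product_sigma_finite) integrable_PiM_fold: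
  fixes f :: "_ \<Rightarrow> real"
  assumes IJ: "I \<inter> J = {}" and fin: "finite I" "finite J"
    and f: "integrable (Pi\<^sub>M (I \<union> J) M) f"
  shows "integrable (Pi\<^sub>M I M) (\<lambda>x. \<integral>y. f (merge I J (x, y)) \<partial>Pi\<^sub>M J M)"
proof -
  interpret I: finite_product_sigma_finite M I by standard fact
  interpret J: finite_product_sigma_finite M J by standard fact
  interpret P: pair_sigma_finite "Pi\<^sub>M I M" "Pi\<^sub>M J M" ..
  have "integrable (Pi\<^sub>M I M \<Otimes>\<^sub>M Pi\<^sub>M J M) (\<lambda>x. f (merge I J x))"
    by (rule integrable_distr[OF measurable_merge]) (simp add: distr_merge[OF IJ fin] f)
  from P.integrable_fst'[OF this] show ?thesis by simp
qed

text \<open>All randomness lives on powers of one law on the reals, so that conditioning is Fubini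
  over a subset of the coordinates, and the given sample space enters only through the joint law of
  its variables.\<close>

locale coordinate_law = prob_space mu for mu :: "real measure" +
  assumes sets_mu [simp, measurable_cong]: "sets mu = sets borel"
begin

abbreviation PM :: "'k set \<Rightarrow> ('k \<Rightarrow> real) measure" where
  "PM S \<equiv> Pi\<^sub>M S (\<lambda>_. mu)"

lemma prob_space_PM: "prob_space (PM S)"
  by (rule prob_space_PiM) (rule prob_space_axioms)

lemma product_sigma_finite_mu: "product_sigma_finite (\<lambda>_ :: 'k. mu)"
  by unfold_locales

lemma coordinate_integral:
  fixes f :: "real \<Rightarrow> real"
  assumes "integrable mu f" "k \<in> S"
  shows "integrable (PM S) (\<lambda>x. f (x k))" "(\<integral>x. f (x k) \<partial>PM S) = (\<integral>y. f y \<partial>mu)"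
proof -
  have d: "distr (PM S) mu (\<lambda>x. x k) = mu"
    by (rule distr_PiM_component) (rule prob_space_axioms, rule assms)
  have m: "(\<lambda>x. x k) \<in> measurable (PM S) mu" by (rule measurable_component_singleton) fact
  have f: "f \<in> borel_measurable mu" using assms by auto
  show "integrable (PM S) (\<lambda>x. f (x k))"
    using integrable_distr_eq[OF m f] assms(1) unfolding d by simp
  show "(\<integral>x. f (x k) \<partial>PM S) = (\<integral>y. f y \<partial>mu)"
    using integral_distr[OF m f] unfolding d by simp
qed

text \<open>Two transforms \<open>g\<close> occur: the identity for the chaos itself, and
  \<open>y\<^sup>2 - 1\<close> for the deviation of the squared norms.\<close>

definition rand_sum :: "'k set \<Rightarrow> (real \<Rightarrow> real) \<Rightarrow> ('k \<Rightarrow> 'i \<Rightarrow> 'j \<Rightarrow> real) \<Rightarrow> ('k \<Rightarrow> real) \<Rightarrow> 'i \<Rightarrow> 'j \<Rightarrow> real" where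
  "rand_sum S g A x i j = (\<Sum>k\<in>S. g (x k) * A k i j)"

lemma integrable_rand_sum_entry:
  assumes "integrable mu g" "T \<subseteq> S"
  shows "integrable (PM S) (\<lambda>x. rand_sum T g A x i j)"
  unfolding rand_sum_def using assms by (intro Bochner_Integration.integrable_sum Bochner_Integration.integrable_mult_left coordinate_integral) auto

text \<open>The constant part \<open>B\<close> stands for the coordinates that are frozen while the
  remaining ones are averaged.\<close>

lemma integrable_op_norm_affine:
  assumes fin: "finite I" "finite J" "finite S" and g: "integrable mu g" and T: "T \<subseteq> S"
  shows "integrable (PM S) (\<lambda>x. op_norm I J (\<lambda>i j. B i j + rand_sum T g A x i j))"
proof (rule Bochner_Integration.integrable_bound)
  interpret PM: prob_space "PM S" by (rule prob_space_PM)
  show "integrable (PM S) (\<lambda>x. op_norm I J B + (\<Sum>k\<in>T. \<bar>g (x k)\<bar> * op_norm I J (A k)))"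
  proof (intro Bochner_Integration.integrable_add PM.integrable_const Bochner_Integration.integrable_sum)
    fix k assume "k \<in> T"
    then have "integrable (PM S) (\<lambda>x. g (x k))" using T g by (intro coordinate_integral(1)) auto
    then show "integrable (PM S) (\<lambda>x. \<bar>g (x k)\<bar> * op_norm I J (A k))" by simp
  qed
  show "(\<lambda>x. op_norm I J (\<lambda>i j. B i j + rand_sum T g A x i j)) \<in> borel_measurable (PM S)"
    using integrable_rand_sum_entry[OF g T, of A]
    by (intro borel_measurable_op_norm fin borel_measurable_add borel_measurable_const) auto
  have "op_norm I J (\<lambda>i j. B i j + rand_sum T g A x i j)
      \<le> op_norm I J B + (\<Sum>k\<in>T. \<bar>g (x k)\<bar> * op_norm I J (A k))" for x
    using op_norm_triangle[of I J B "rand_sum T g A x"] op_norm_sum[where S = T and c = "\<lambda>k. g (x k)" and A = A and I = I and J = J]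
    unfolding rand_sum_def by linarith
  then show "AE x in PM S. norm (op_norm I J (\<lambda>i j. B i j + rand_sum T g A x i j))
      \<le> norm (op_norm I J B + (\<Sum>k\<in>T. \<bar>g (x k)\<bar> * op_norm I J (A k)))"
    by (auto simp: op_norm_nonneg intro!: AE_I2 order_trans[OF _ abs_ge_self])
qed

lemma integrable_op_norm_rand_sum:
  assumes "finite I" "finite J" "finite S" "integrable mu g" "T \<subseteq> S"
  shows "integrable (PM S) (\<lambda>x. op_norm I J (rand_sum T g A x))"
  using integrable_op_norm_affine[OF assms, of "\<lambda>_ _. 0" A] by simp

text \<open>Jensen's inequality over the coordinates outside \<open>T\<close>.\<close>

lemma integral_op_norm_subset_le:
  assumes fin: "finite I" "finite J" "finite S" and g: "integrable mu g" "(\<integral>y. g y \<partial>mu) = 0"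
    and T: "T \<subseteq> S"
  shows "(\<integral>x. op_norm I J (rand_sum T g A x) \<partial>PM S) \<le> (\<integral>x. op_norm I J (rand_sum S g A x) \<partial>PM S)"
proof -
  interpret product_sigma_finite "\<lambda>_ :: 'c. mu" by (rule product_sigma_finite_mu)
  let ?U = "S - T"
  interpret U: prob_space "PM ?U" by (rule prob_space_PM)
  have TU: "T \<inter> ?U = {}" "finite T" "finite ?U" "T \<union> ?U = S"
    using T fin by (auto intro: finite_subset)
  have m1: "rand_sum T g A (merge T ?U (x, y)) = rand_sum T g A x" for x y
    by (auto simp: fun_eq_iff rand_sum_def intro!: sum.cong)
  have m2: "rand_sum S g A (merge T ?U (x, y)) = (\<lambda>i j. rand_sum T g A x i j + rand_sum ?U g A y i j)" for x y
  proof (intro ext)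
    fix i j
    have "rand_sum S g A (merge T ?U (x, y)) i j
       = (\<Sum>k\<in>T \<union> ?U. g (merge T ?U (x, y) k) * A k i j)" using TU(4) by (simp add: rand_sum_def)
    also have "\<dots> = (\<Sum>k\<in>T. g (merge T ?U (x, y) k) * A k i j) + (\<Sum>k\<in>?U. g (merge T ?U (x, y) k) * A k i j)"
      using TU by (intro sum.union_disjoint) auto
    also have "\<dots> = rand_sum T g A x i j + rand_sum ?U g A y i j"
      unfolding rand_sum_def by (intro arg_cong2[of _ _ _ _ "(+)"] sum.cong) auto
    finally show "rand_sum S g A (merge T ?U (x, y)) i j = rand_sum T g A x i j + rand_sum ?U g A y i j" .
  qed
  have i1: "integrable (PM (T \<union> ?U)) (\<lambda>x. op_norm I J (rand_sum T g A x))"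
    and i2: "integrable (PM (T \<union> ?U)) (\<lambda>x. op_norm I J (rand_sum S g A x))"
    unfolding TU(4) by (intro integrable_op_norm_rand_sum fin g T order_refl)+
  have "(\<integral>x. op_norm I J (rand_sum T g A x) \<partial>PM (T \<union> ?U))
      = (\<integral>x. \<integral>y. op_norm I J (rand_sum T g A x) \<partial>PM ?U \<partial>PM T)"
    by (subst product_integral_fold[OF TU(1-3) i1]) (simp add: m1)
  also have "\<dots> \<le> (\<integral>x. \<integral>y. op_norm I J (\<lambda>i j. rand_sum T g A x i j + rand_sum ?U g A y i j) \<partial>PM ?U \<partial>PM T)"
  proof (rule integral_mono')
    show "integrable (PM T) (\<lambda>x. \<integral>y. op_norm I J (\<lambda>i j. rand_sum T g A x i j + rand_sum ?U g A y i j) \<partial>PM ?U)"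
      using integrable_PiM_fold[OF TU(1-3) i2] by (simp add: m2)
    fix x
    let ?B = "rand_sum T g A x"
    let ?F = "\<lambda>y. op_norm I J (\<lambda>i j. ?B i j + rand_sum ?U g A y i j)"
    have iF: "integrable (PM ?U) ?F"
      using fin TU by (intro integrable_op_norm_affine g) auto
    \<comment> \<open>The form is linear in the matrix and \<open>g\<close> has mean 0, so averaging
      over the coordinates in \<open>?U\<close> returns the form of \<open>?B\<close>. Pairing with
      fixed \<open>u\<close> and \<open>v\<close> reduces Jensen's inequality for the norm to this
      identity.\<close>
    have "op_norm I J ?B \<le> (\<integral>y. ?F y \<partial>PM ?U)"
    proof (rule op_norm_leI_bil)
      fix u v
      let ?c = "L2_set u I * L2_set v J"
      let ?b = "\<lambda>y. bil I J ?B u v + (\<Sum>k\<in>?U. g (y k) * bil I J (A k) u v)"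
      have b: "bil I J (\<lambda>i j. ?B i j + rand_sum ?U g A y i j) u v = ?b y" for y
        unfolding bil_add unfolding rand_sum_def[of ?U] bil_sum ..
      have ik: "integrable (PM ?U) (\<lambda>y. g (y k) * bil I J (A k) u v)" if "k \<in> ?U" for k
        using coordinate_integral(1)[OF g(1) that] by simp
      have ib: "integrable (PM ?U) ?b"
        by (intro Bochner_Integration.integrable_add U.integrable_const Bochner_Integration.integrable_sum ik)
      have "(\<integral>y. ?b y \<partial>PM ?U) = bil I J ?B u v"
      proof -
        have "(\<integral>y. ?b y \<partial>PM ?U)
            = (\<integral>y. bil I J ?B u v \<partial>PM ?U) + (\<integral>y. (\<Sum>k\<in>?U. g (y k) * bil I J (A k) u v) \<partial>PM ?U)"
          by (intro Bochner_Integration.integral_add U.integrable_const Bochner_Integration.integrable_sum ik)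
        also have "\<dots> = bil I J ?B u v + (\<Sum>k\<in>?U. (\<integral>y. g (y k) * bil I J (A k) u v \<partial>PM ?U))"
          using Bochner_Integration.integral_sum[of ?U, OF ik] by (simp add: U.prob_space)
        also have "(\<Sum>k\<in>?U. (\<integral>y. g (y k) * bil I J (A k) u v \<partial>PM ?U)) = 0"
        proof (intro sum.neutral ballI)
          fix k assume "k \<in> ?U"
          from coordinate_integral(2)[OF g(1) this] g(2)
          show "(\<integral>y. g (y k) * bil I J (A k) u v \<partial>PM ?U) = 0" by simp
        qed
        finally show ?thesis by simp
      qed
      then have "bil I J ?B u v = (\<integral>y. ?b y \<partial>PM ?U)" by simp
      also have "\<dots> \<le> (\<integral>y. ?F y * ?c \<partial>PM ?U)"
      proof (rule integral_mono[OF ib])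
        show "integrable (PM ?U) (\<lambda>y. ?F y * ?c)" using iF by simp
        show "?b y \<le> ?F y * ?c" for y
          using abs_bil_le_op_norm[of I J "\<lambda>i j. ?B i j + rand_sum ?U g A y i j" u v]
          unfolding b[symmetric] by (simp add: mult.assoc)
      qed
      finally show "bil I J ?B u v \<le> (\<integral>y. ?F y \<partial>PM ?U) * L2_set u I * L2_set v J"
        by (simp add: mult.assoc)
    qed (simp add: integral_nonneg_AE op_norm_nonneg)
    then show "(\<integral>y. op_norm I J ?B \<partial>PM ?U) \<le> (\<integral>y. ?F y \<partial>PM ?U)"
      by (simp add: U.prob_space)
    show "0 \<le> (\<integral>y. ?F y \<partial>PM ?U)" by (simp add: integral_nonneg_AE op_norm_nonneg)
  qed
  also have "\<dots> = (\<integral>x. op_norm I J (rand_sum S g A x) \<partial>PM (T \<union> ?U))"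
    by (subst product_integral_fold[OF TU(1-3) i2]) (simp add: m2)
  finally show ?thesis unfolding TU(4) .
qed

text \<open>Splitting by sign and applying the previous inequality to both parts removes the signs
  without an independent copy.\<close>

lemma integral_op_norm_sign_le:
  assumes fin: "finite I" "finite J" "finite S" and g: "integrable mu g" "(\<integral>y. g y \<partial>mu) = 0"
    and e: "\<And>k. k \<in> S \<Longrightarrow> e k = 1 \<or> e k = -1"
  shows "(\<integral>x. op_norm I J (rand_sum S g (\<lambda>k i j. e k * A k i j) x) \<partial>PM S)
    \<le> 2 * (\<integral>x. op_norm I J (rand_sum S g A x) \<partial>PM S)"
proof -
  let ?P = "{k\<in>S. e k = 1}" and ?N = "{k\<in>S. e k = -1}"
  have S: "S = ?P \<union> ?N" "?P \<inter> ?N = {}" using e by auto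
  have split: "rand_sum S g (\<lambda>k i j. e k * A k i j) x i j = rand_sum ?P g A x i j + (- 1) * rand_sum ?N g A x i j"
    for x i j
  proof -
    have "rand_sum S g (\<lambda>k i j. e k * A k i j) x i j = (\<Sum>k\<in>?P \<union> ?N. g (x k) * (e k * A k i j))"
      using S(1) by (simp add: rand_sum_def)
    also have "\<dots> = (\<Sum>k\<in>?P. g (x k) * (e k * A k i j)) + (\<Sum>k\<in>?N. g (x k) * (e k * A k i j))"
      using S(2) fin by (intro sum.union_disjoint) auto
    also have "\<dots> = rand_sum ?P g A x i j + (- 1) * rand_sum ?N g A x i j"
      unfolding rand_sum_def sum_distrib_left by (intro arg_cong2[of _ _ _ _ "(+)"] sum.cong) auto
    finally show ?thesis .
  qed
  have int: "integrable (PM S) (\<lambda>x. op_norm I J (rand_sum T g B x))" if "T \<subseteq> S"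
    for T and B :: "'c \<Rightarrow> 'a \<Rightarrow> 'b \<Rightarrow> real"
    using that by (intro integrable_op_norm_rand_sum fin g)
  have "(\<integral>x. op_norm I J (rand_sum S g (\<lambda>k i j. e k * A k i j) x) \<partial>PM S)
      \<le> (\<integral>x. op_norm I J (rand_sum ?P g A x) + op_norm I J (rand_sum ?N g A x) \<partial>PM S)"
  proof (rule integral_mono)
    fix x
    have "op_norm I J (rand_sum S g (\<lambda>k i j. e k * A k i j) x)
        = op_norm I J (\<lambda>i j. rand_sum ?P g A x i j + (- 1) * rand_sum ?N g A x i j)"
      by (intro op_norm_cong split)
    also have "\<dots> \<le> op_norm I J (rand_sum ?P g A x) + op_norm I J (rand_sum ?N g A x)"
      using op_norm_triangle[of I J "rand_sum ?P g A x" "\<lambda>i j. (- 1) * rand_sum ?N g A x i j"]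
        op_norm_scale[of I J "- 1" "rand_sum ?N g A x"] by simp
    finally show "op_norm I J (rand_sum S g (\<lambda>k i j. e k * A k i j) x)
      \<le> op_norm I J (rand_sum ?P g A x) + op_norm I J (rand_sum ?N g A x)" .
  qed (use int in auto)
  also have "\<dots> = (\<integral>x. op_norm I J (rand_sum ?P g A x) \<partial>PM S) + (\<integral>x. op_norm I J (rand_sum ?N g A x) \<partial>PM S)"
    by (intro Bochner_Integration.integral_add int) auto
  also have "\<dots> \<le> 2 * (\<integral>x. op_norm I J (rand_sum S g A x) \<partial>PM S)"
    using integral_op_norm_subset_le[OF fin g, of ?P A] integral_op_norm_subset_le[OF fin g, of ?N A]
    by simp
  finally show ?thesis .
qed

section \<open>Symmetrization\<close>

lemma rand_sum_sign: "rand_sum S g (\<lambda>k i j. e k * A k i j) x = sign_sum S (\<lambda>k i j. g (x k) * A k i j) e"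
  by (simp add: rand_sum_def sign_sum_def fun_eq_iff mult_ac)

lemma integrable_sign_sum:
  assumes "finite I" "finite J" "finite S" "integrable mu g"
  shows "integrable (PM S) (\<lambda>x. op_norm I J (sign_sum S (\<lambda>k i j. g (x k) * A k i j) e))"
  unfolding rand_sum_sign[symmetric] using assms by (intro integrable_op_norm_rand_sum) auto

text \<open>Signing the matrices \<open>e k * A k\<close> with the same signs restores
  \<open>A k\<close>, so the bound for signed sums holds in the reverse direction as well, for every
  single sign vector. Summing over the sign vectors gives the average form.\<close>

lemma symmetrization_upper:
  assumes fin: "finite I" "finite J" "finite S" and g: "integrable mu g" "(\<integral>y. g y \<partial>mu) = 0"
  shows "2 ^ card S * (\<integral>x. op_norm I J (rand_sum S g A x) \<partial>PM S)
    \<le> 2 * (\<integral>x. (\<Sum>e\<in>signs S. op_norm I J (sign_sum S (\<lambda>k i j. g (x k) * A k i j) e)) \<partial>PM S)"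
proof -
  have "(\<integral>x. op_norm I J (rand_sum S g A x) \<partial>PM S)
      \<le> 2 * (\<integral>x. op_norm I J (sign_sum S (\<lambda>k i j. g (x k) * A k i j) e) \<partial>PM S)" if e: "e \<in> signs S" for e
  proof -
    have "rand_sum S g (\<lambda>k i j. e k * (e k * A k i j)) x = rand_sum S g A x" for x
      unfolding rand_sum_def fun_eq_iff using signs_sq[OF e]
      by (auto simp: mult.assoc[symmetric] intro!: sum.cong)
    moreover have "e k = 1 \<or> e k = -1" if "k \<in> S" for k using that e by (auto simp: signs_def PiE_iff)
    ultimately show ?thesis
      using integral_op_norm_sign_le[OF fin g, of e "\<lambda>k i j. e k * A k i j"] by (simp add: rand_sum_sign)
  qed
  then have "(\<Sum>e\<in>signs S. (\<integral>x. op_norm I J (rand_sum S g A x) \<partial>PM S))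
      \<le> (\<Sum>e\<in>signs S. 2 * (\<integral>x. op_norm I J (sign_sum S (\<lambda>k i j. g (x k) * A k i j) e) \<partial>PM S))"
    by (intro sum_mono)
  then show ?thesis
    using fin integrable_sign_sum[OF fin g(1), of A]
    by (simp add: card_signs Bochner_Integration.integral_sum sum_distrib_left)
qed

lemma symmetrization_lower:
  assumes fin: "finite I" "finite J" "finite S" and g: "integrable mu g" "(\<integral>y. g y \<partial>mu) = 0"
  shows "(\<integral>x. (\<Sum>e\<in>signs S. op_norm I J (sign_sum S (\<lambda>k i j. g (x k) * A k i j) e)) \<partial>PM S)
    \<le> 2 ^ card S * (2 * (\<integral>x. op_norm I J (rand_sum S g A x) \<partial>PM S))"
proof -
  have "(\<integral>x. op_norm I J (sign_sum S (\<lambda>k i j. g (x k) * A k i j) e) \<partial>PM S)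
      \<le> 2 * (\<integral>x. op_norm I J (rand_sum S g A x) \<partial>PM S)" if e: "e \<in> signs S" for e
    unfolding rand_sum_sign[symmetric] using e
    by (intro integral_op_norm_sign_le fin g) (auto simp: signs_def PiE_iff)
  then have "(\<Sum>e\<in>signs S. \<integral>x. op_norm I J (sign_sum S (\<lambda>k i j. g (x k) * A k i j) e) \<partial>PM S)
      \<le> (\<Sum>e\<in>signs S. 2 * (\<integral>x. op_norm I J (rand_sum S g A x) \<partial>PM S))"
    by (intro sum_mono)
  then show ?thesis
    using fin integrable_sign_sum[OF fin g(1), of A]
    by (simp add: card_signs Bochner_Integration.integral_sum)
qed

end

section \<open>A single sum with independent coefficients\<close>

text \<open>Cauchy-Schwarz through the arithmetic-geometric mean inequality for \<open>c * f\<close>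
  and \<open>g / c\<close>, where \<open>c\<close> equalises their integrals. Positivity of both
  integrals makes this choice possible.\<close>

lemma integral_sqrt_mult_le:
  fixes f g :: "'a \<Rightarrow> real"
  assumes f: "integrable M f" "\<And>x. 0 \<le> f x" "0 < (\<integral>x. f x \<partial>M)"
    and g: "integrable M g" "\<And>x. 0 \<le> g x" "0 < (\<integral>x. g x \<partial>M)"
  shows "integrable M (\<lambda>x. sqrt (f x * g x))"
    and "(\<integral>x. sqrt (f x * g x) \<partial>M) \<le> sqrt ((\<integral>x. f x \<partial>M) * (\<integral>x. g x \<partial>M))"
proof -
  let ?F = "\<integral>x. f x \<partial>M" and ?G = "\<integral>x. g x \<partial>M"
  define c where "c = sqrt (?G / ?F)"
  have c: "c > 0" using f g by (simp add: c_def)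
  let ?h = "\<lambda>x. (c * f x + g x / c) / 2"
  have h: "integrable M ?h" using f g by auto
  have le: "sqrt (f x * g x) \<le> ?h x" for x
    using arith_geo_mean_sqrt[of "c * f x" "g x / c"] f(2)[of x] g(2)[of x] c by simp
  have m: "(\<lambda>x. sqrt (f x * g x)) \<in> borel_measurable M" using f(1) g(1) by measurable
  show i: "integrable M (\<lambda>x. sqrt (f x * g x))"
  proof (rule Bochner_Integration.integrable_bound[OF h m])
    show "AE x in M. norm (sqrt (f x * g x)) \<le> norm (?h x)"
      using le f(2) g(2) by (auto intro!: AE_I2 order_trans[OF _ abs_ge_self])
  qed
  have "(\<integral>x. sqrt (f x * g x) \<partial>M) \<le> (\<integral>x. ?h x \<partial>M)" by (rule integral_mono[OF i h le])
  also have "\<dots> = (c * ?F + ?G / c) / 2" using f g by simp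
  also have "\<dots> = sqrt (?F * ?G)"
  proof -
    have "c * ?F = sqrt (?F * ?G)" "?G / c = sqrt (?F * ?G)"
      using f g unfolding c_def by (simp_all add: real_sqrt_mult real_sqrt_divide field_simps)
    then show ?thesis by simp
  qed
  finally show "(\<integral>x. sqrt (f x * g x) \<partial>M) \<le> sqrt (?F * ?G)" .
qed

lemma sq_le_one_plus_powr:
  fixes t p :: real
  assumes "0 \<le> t" "2 \<le> p"
  shows "t\<^sup>2 \<le> 1 + t powr p"
proof (cases "t \<le> 1")
  case True
  then have "t\<^sup>2 \<le> 1" using assms by (intro power_le_one) auto
  then show ?thesis using powr_ge_zero[of t p] by linarith
next
  case False
  then have "t\<^sup>2 = t powr 2" by (simp add: powr_numeral)
  also have "\<dots> \<le> t powr p" using False assms by (intro powr_mono) auto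
  finally show ?thesis by simp
qed

text \<open>Here \<open>p\<close> plays the part of the logarithm of the dimensions, raised to at
  least 2, and \<open>a\<close> bounds the moment norm of order \<open>p\<close>. Since
  \<open>a \<ge> 1\<close>, upper bounds may be multiplied by powers of \<open>a\<close> to match
  each other.\<close>

locale chaos_law = coordinate_law +
  fixes p a :: real
  assumes p: "2 \<le> p" and a: "1 \<le> a"
    and mean: "integrable mu (\<lambda>y. y)" "(\<integral>y. y \<partial>mu) = 0"
    and var: "integrable mu (\<lambda>y. y\<^sup>2)" "(\<integral>y. y\<^sup>2 \<partial>mu) = 1"
    and mom: "integrable mu (\<lambda>y. \<bar>y\<bar> powr p)" "(\<integral>y. \<bar>y\<bar> powr p \<partial>mu) \<le> a powr p"
begin

text \<open>An integrable majorant of all the \<open>x\<^sub>k\<^sup>2\<close>. At the scale \<open>3 * a\<close>, the factor \<open>3 powr - p\<close>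
  from the \<open>p\<close>-th moment compensates the number \<open>card S \<le> exp p\<close> of variables.\<close>

definition sq_bound :: "'k set \<Rightarrow> ('k \<Rightarrow> real) \<Rightarrow> real" where
  "sq_bound S x = (3 * a)\<^sup>2 * (1 + (\<Sum>k\<in>S. (\<bar>x k\<bar> / (3 * a)) powr p))"

lemma sq_bound_ge: "(3 * a)\<^sup>2 \<le> sq_bound S x"
  unfolding sq_bound_def by (simp add: distrib_left sum_nonneg)

lemma sq_bound_nonneg: "0 \<le> sq_bound S x"
  using sq_bound_ge[of S x] zero_le_power2[of "3 * a"] by linarith

lemma sq_le_sq_bound:
  assumes "finite S" "k \<in> S"
  shows "(x k)\<^sup>2 \<le> sq_bound S x"
proof -
  let ?t = "\<bar>x k\<bar> / (3 * a)"
  have t: "?t\<^sup>2 \<le> 1 + ?t powr p" using a p by (intro sq_le_one_plus_powr) auto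
  have "(x k)\<^sup>2 = (3 * a)\<^sup>2 * ?t\<^sup>2" using a by (simp add: power_divide)
  also have "\<dots> \<le> (3 * a)\<^sup>2 * (1 + ?t powr p)" by (intro mult_left_mono t) auto
  also have "\<dots> \<le> sq_bound S x"
    unfolding sq_bound_def using assms
    by (intro mult_left_mono add_left_mono member_le_sum[of k S "\<lambda>k. (\<bar>x k\<bar> / (3 * a)) powr p"]) auto
  finally show ?thesis .
qed

lemma sq_bound_integral:
  assumes S: "finite S" "real (card S) \<le> exp p"
  shows "integrable (PM S) (sq_bound S)" "(\<integral>x. sq_bound S x \<partial>PM S) \<le> 18 * a\<^sup>2"
proof -
  interpret PM: prob_space "PM S" by (rule prob_space_PM)
  have eq: "(\<bar>y\<bar> / (3 * a)) powr p = \<bar>y\<bar> powr p * (1 / (3 * a) powr p)" for y :: real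
    using a by (simp add: powr_divide)
  have int: "integrable mu (\<lambda>y. (\<bar>y\<bar> / (3 * a)) powr p)" unfolding eq using mom(1) by simp
  have "(\<integral>y. (\<bar>y\<bar> / (3 * a)) powr p \<partial>mu) = (\<integral>y. \<bar>y\<bar> powr p \<partial>mu) * (1 / (3 * a) powr p)"
    unfolding eq by simp
  also have "\<dots> \<le> a powr p * (1 / (3 * a) powr p)" using mom(2) by (intro mult_right_mono) auto
  also have "\<dots> = 1 / 3 powr p" using a by (simp add: powr_mult)
  finally have small: "(\<integral>y. (\<bar>y\<bar> / (3 * a)) powr p \<partial>mu) \<le> 1 / 3 powr p" .
  have ik: "integrable (PM S) (\<lambda>x. (\<bar>x k\<bar> / (3 * a)) powr p)" if "k \<in> S" for k
    using coordinate_integral(1)[OF int that] .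
  have isum: "integrable (PM S) (\<lambda>x. \<Sum>k\<in>S. (\<bar>x k\<bar> / (3 * a)) powr p)"
    by (intro Bochner_Integration.integrable_sum ik)
  show "integrable (PM S) (sq_bound S)"
    unfolding sq_bound_def[abs_def] using isum by simp
  have "(\<integral>x. (\<Sum>k\<in>S. (\<bar>x k\<bar> / (3 * a)) powr p) \<partial>PM S) = (\<Sum>k\<in>S. (\<integral>y. (\<bar>y\<bar> / (3 * a)) powr p \<partial>mu))"
    by (simp only: Bochner_Integration.integral_sum[OF ik] coordinate_integral(2)[OF int] cong: sum.cong)
  also have "\<dots> \<le> (\<Sum>k\<in>S. 1 / 3 powr p)" by (intro sum_mono small)
  also have "\<dots> = real (card S) / 3 powr p" by simp
  also have "\<dots> \<le> 1"
  proof -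
    have "real (card S) \<le> (exp 1) powr p" using S by (simp add: powr_def)
    also have "\<dots> \<le> 3 powr p" using exp_le p by (intro powr_mono2) auto
    finally show ?thesis by simp
  qed
  finally have "(\<integral>x. (\<Sum>k\<in>S. (\<bar>x k\<bar> / (3 * a)) powr p) \<partial>PM S) \<le> 1" .
  then have "(3 * a)\<^sup>2 * (1 + (\<integral>x. (\<Sum>k\<in>S. (\<bar>x k\<bar> / (3 * a)) powr p) \<partial>PM S)) \<le> (3 * a)\<^sup>2 * 2"
    by (intro mult_left_mono) auto
  moreover have "(\<integral>x. sq_bound S x \<partial>PM S)
      = (3 * a)\<^sup>2 * (1 + (\<integral>x. (\<Sum>k\<in>S. (\<bar>x k\<bar> / (3 * a)) powr p) \<partial>PM S))"
    unfolding sq_bound_def using isum by (simp add: PM.prob_space)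
  ultimately show "(\<integral>x. sq_bound S x \<partial>PM S) \<le> 18 * a\<^sup>2" by (simp add: power_mult_distrib)
qed

section \<open>Column norms with random coefficients\<close>

abbreviation scaled :: "('k \<Rightarrow> real) \<Rightarrow> ('k \<Rightarrow> 'i \<Rightarrow> 'j \<Rightarrow> real) \<Rightarrow> 'k \<Rightarrow> 'i \<Rightarrow> 'j \<Rightarrow> real" where
  "scaled x A \<equiv> \<lambda>k i j. x k * A k i j"

abbreviation col_norm :: "'k set \<Rightarrow> 'i set \<Rightarrow> 'j set \<Rightarrow> ('k \<Rightarrow> 'i \<Rightarrow> 'j \<Rightarrow> real) \<Rightarrow> real" where
  "col_norm S I J A \<equiv> op_norm (S \<times> I) J (col_mat A)"

lemma L2_mat_vec_scaled: "L2_set (mat_vec J (\<lambda>i j. c * B i j) v) I = \<bar>c\<bar> * L2_set (mat_vec J B v) I"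
proof -
  have "mat_vec J (\<lambda>i j. c * B i j) v = (\<lambda>i. c * mat_vec J B v i)"
    by (simp add: sum_distrib_left mult.assoc)
  then show ?thesis by (simp add: L2_set_scale)
qed

lemma col_norm_scaled_le:
  assumes "finite S"
  shows "col_norm S I J (scaled x A) \<le> sqrt (sq_bound S x) * col_norm S I J A"
proof (rule op_norm_leI)
  fix v
  have "(L2_set (mat_vec J (col_mat (scaled x A)) v) (S \<times> I))\<^sup>2
      = (\<Sum>k\<in>S. (x k)\<^sup>2 * (L2_set (mat_vec J (A k) v) I)\<^sup>2)"
    unfolding col_mat_L2 L2_mat_vec_scaled by (simp add: power_mult_distrib)
  also have "\<dots> \<le> (\<Sum>k\<in>S. sq_bound S x * (L2_set (mat_vec J (A k) v) I)\<^sup>2)"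
    using assms by (intro sum_mono mult_right_mono sq_le_sq_bound) auto
  also have "\<dots> = sq_bound S x * (L2_set (mat_vec J (col_mat A) v) (S \<times> I))\<^sup>2"
    by (simp only: col_mat_L2 sum_distrib_left)
  also have "\<dots> \<le> sq_bound S x * (col_norm S I J A * L2_set v J)\<^sup>2"
    by (intro mult_left_mono power_mono L2_set_mat_vec_le_op_norm) (auto simp: sq_bound_nonneg)
  also have "\<dots> = (sqrt (sq_bound S x) * col_norm S I J A * L2_set v J)\<^sup>2"
    by (simp add: power_mult_distrib sq_bound_nonneg)
  finally show "L2_set (mat_vec J (col_mat (scaled x A)) v) (S \<times> I)
      \<le> sqrt (sq_bound S x) * col_norm S I J A * L2_set v J"
    by (rule power2_le_imp_le) (simp add: op_norm_nonneg sq_bound_nonneg)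
qed (simp add: op_norm_nonneg sq_bound_nonneg)

lemma integrable_col_norm:
  assumes fin: "finite S" "finite I" "finite J"
  shows "integrable (PM S) (\<lambda>x. col_norm S I J (scaled x A))"
proof -
  \<comment> \<open>\<open>E k\<close> keeps only the \<open>k\<close>-th block, so the stacked
    matrix is itself a random sum and its norm inherits integrability.\<close>
  define E where "E k l j = of_bool (k = fst l) * A k (snd l) j" for k l j
  have "col_norm S I J (scaled x A) = op_norm (S \<times> I) J (rand_sum S (\<lambda>y. y) E x)" for x
  proof (rule op_norm_cong)
    fix l j assume "l \<in> S \<times> I" "j \<in> J"
    then have "rand_sum S (\<lambda>y. y) E x l j = (\<Sum>k\<in>S. if k = fst l then x k * A k (snd l) j else 0)"
      unfolding rand_sum_def E_def by (intro sum.cong) auto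
    also have "\<dots> = x (fst l) * A (fst l) (snd l) j" using fin \<open>l \<in> S \<times> I\<close> by auto
    finally show "col_mat (scaled x A) l j = rand_sum S (\<lambda>y. y) E x l j" by (simp add: col_mat_def)
  qed
  then show ?thesis
    using fin mean by (simp add: integrable_op_norm_rand_sum)
qed

lemma integrable_col_norm_sq:
  assumes fin: "finite S" "finite I" "finite J" and S: "real (card S) \<le> exp p"
  shows "integrable (PM S) (\<lambda>x. (col_norm S I J (scaled x A))\<^sup>2)"
proof (rule Bochner_Integration.integrable_bound)
  show "integrable (PM S) (\<lambda>x. sq_bound S x * (col_norm S I J A)\<^sup>2)"
    using sq_bound_integral(1)[OF fin(1) S] by simp
  show "(\<lambda>x. (col_norm S I J (scaled x A))\<^sup>2) \<in> borel_measurable (PM S)"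
    using borel_measurable_integrable[OF integrable_col_norm[OF fin, of A]] by measurable
  have "(col_norm S I J (scaled x A))\<^sup>2 \<le> sq_bound S x * (col_norm S I J A)\<^sup>2" for x
  proof -
    have "(col_norm S I J (scaled x A))\<^sup>2 \<le> (sqrt (sq_bound S x) * col_norm S I J A)\<^sup>2"
      by (intro power_mono col_norm_scaled_le fin op_norm_nonneg)
    also have "\<dots> = sq_bound S x * (col_norm S I J A)\<^sup>2"
      by (simp add: power_mult_distrib sq_bound_nonneg)
    finally show ?thesis .
  qed
  then show "AE x in PM S. norm ((col_norm S I J (scaled x A))\<^sup>2)
      \<le> norm (sq_bound S x * (col_norm S I J A)\<^sup>2)"
    by (auto intro!: AE_I2 order_trans[OF _ abs_ge_self])
qed

lemma integral_col_norm_le: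
  assumes fin: "finite S" "finite I" "finite J" and S: "real (card S) \<le> exp p"
  shows "(\<integral>x. col_norm S I J (scaled x A) \<partial>PM S) \<le> 5 * a * col_norm S I J A"
proof -
  interpret PM: prob_space "PM S" by (rule prob_space_PM)
  note isq = sq_bound_integral[OF fin(1) S]
  have "(\<integral>x. col_norm S I J (scaled x A) \<partial>PM S)
      \<le> (\<integral>x. (sq_bound S x / (3 * a) + 3 * a) / 2 * col_norm S I J A \<partial>PM S)"
  proof (rule integral_mono)
    fix x
    \<comment> \<open>Linearising the root at scale \<open>3 * a\<close>, with the expectation bound
      \<open>18 * a\<^sup>2\<close>, gives \<open>(6 * a + 3 * a) / 2\<close>, which is rounded up
      to \<open>5 * a\<close>.\<close>
    have "sqrt (sq_bound S x) = sqrt (sq_bound S x / (3 * a) * (3 * a))" using a by simp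
    also have "\<dots> \<le> (sq_bound S x / (3 * a) + 3 * a) / 2"
      using a sq_bound_nonneg[of S x] by (intro arith_geo_mean_sqrt) auto
    finally show "col_norm S I J (scaled x A) \<le> (sq_bound S x / (3 * a) + 3 * a) / 2 * col_norm S I J A"
      using col_norm_scaled_le[OF fin(1), of I J x A]
      by (meson mult_right_mono op_norm_nonneg order_trans)
  qed (use fin isq integrable_col_norm in auto)
  also have "\<dots> = ((\<integral>x. sq_bound S x \<partial>PM S) / (3 * a) + 3 * a) / 2 * col_norm S I J A"
    using isq(1) by (simp add: PM.prob_space)
  also have "\<dots> \<le> 5 * a * col_norm S I J A"
  proof (rule mult_right_mono[OF _ op_norm_nonneg])
    have "(\<integral>x. sq_bound S x \<partial>PM S) / (3 * a) \<le> 18 * a\<^sup>2 / (3 * a)"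
      using a isq(2) by (intro divide_right_mono) auto
    also have "\<dots> = 6 * a" using a by (simp add: power2_eq_square)
    finally show "((\<integral>x. sq_bound S x \<partial>PM S) / (3 * a) + 3 * a) / 2 \<le> 5 * a" using a by simp
  qed
  finally show ?thesis .
qed

text \<open>After symmetrization the signs are averaged for each fixed \<open>x\<close>, with the
  sum of the column and row norms of the matrices \<open>x k * A k\<close> as variance parameter
  \<open>s\<close>.\<close>

lemma integral_op_norm_le_row_col:
  fixes A :: "'k \<Rightarrow> 'i \<Rightarrow> 'j \<Rightarrow> real"
  assumes fin: "finite S" "finite I" "finite J" and K: "0 \<le> K"
    and card: "real (card I) \<le> exp (K * p)" "real (card J) \<le> exp (K * p)"
  shows "(\<integral>x. op_norm I J (rand_sum S (\<lambda>y. y) A x) \<partial>PM S)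
    \<le> 2 * nck_const (K + 1) * sqrt p * ((\<integral>x. col_norm S I J (scaled x A) \<partial>PM S)
        + (\<integral>x. col_norm S J I (scaled x (\<lambda>k. transp_mat (A k))) \<partial>PM S))"
proof -
  let ?C = "nck_const (K + 1)" and ?n = "2 ^ card S :: real"
  let ?c = "\<lambda>x. col_norm S I J (scaled x A)"
    and ?r = "\<lambda>x. col_norm S J I (scaled x (\<lambda>k. transp_mat (A k)))"
  have ic: "integrable (PM S) ?c" and ir: "integrable (PM S) ?r"
    using fin by (auto intro: integrable_col_norm)
  have pt: "(\<Sum>e\<in>signs S. op_norm I J (sign_sum S (scaled x A) e)) \<le> ?C * sqrt p * (?c x + ?r x) * ?n" for x
  proof (rule noncommutative_khintchine)
    have "(?c x)\<^sup>2 \<le> (?c x + ?r x)\<^sup>2" by (intro power_mono) (simp_all add: op_norm_nonneg)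
    then show "(\<Sum>k\<in>S. (L2_set (mat_vec J (scaled x A k) v) I)\<^sup>2) \<le> (?c x + ?r x)\<^sup>2 * (L2_set v J)\<^sup>2" for v
      using col_mat_le[where J = J and A = "scaled x A" and v = v and I = I and S = S] by (meson mult_right_mono order_trans zero_le_power2)
    have 2: "(?r x)\<^sup>2 \<le> (?c x + ?r x)\<^sup>2" by (intro power_mono) (simp_all add: op_norm_nonneg)
    have t: "transp_mat (scaled x A k) = scaled x (\<lambda>k. transp_mat (A k)) k" for k
      by (simp add: transp_mat_def[abs_def])
    show "(\<Sum>k\<in>S. (L2_set (mat_vec I (transp_mat (scaled x A k)) v) J)\<^sup>2)
        \<le> (?c x + ?r x)\<^sup>2 * (L2_set v I)\<^sup>2" for v
      unfolding t by (rule order_trans[OF col_mat_le mult_right_mono[OF 2 zero_le_power2]])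
  qed (use fin K card p in \<open>auto simp: op_norm_nonneg\<close>)
  have "?n * (\<integral>x. op_norm I J (rand_sum S (\<lambda>y. y) A x) \<partial>PM S)
      \<le> 2 * (\<integral>x. (\<Sum>e\<in>signs S. op_norm I J (sign_sum S (scaled x A) e)) \<partial>PM S)"
    by (rule symmetrization_upper[OF fin(2,3,1) mean])
  also have "\<dots> \<le> 2 * (\<integral>x. ?C * sqrt p * (?c x + ?r x) * ?n \<partial>PM S)"
    by (intro mult_left_mono integral_mono pt Bochner_Integration.integrable_sum
        integrable_sign_sum[OF fin(2,3,1) mean(1)]) (use ic ir in auto)
  also have "\<dots> = ?n * (2 * ?C * sqrt p * ((\<integral>x. ?c x \<partial>PM S) + (\<integral>x. ?r x \<partial>PM S)))"
    using ic ir by simp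
  finally show ?thesis by simp
qed

text \<open>The squared norm is the norm of
  \<open>\<Sum>\<^sub>k x\<^sub>k\<^sup>2 P\<^sub>k\<close> with
  \<open>P\<^sub>k = A\<^sub>k^T A\<^sub>k\<close>, so its deviation is at most the norm of a
  centred random sum. The variance of that sum contains the squared column norm again, so the bound
  refers to itself through \<open>w\<close>; the resulting quadratic inequality is solved in
  \<open>integral_col_norm_bounds\<close>.\<close>

lemma col_norm_sq_deviation:
  fixes A :: "'k \<Rightarrow> 'i \<Rightarrow> 'j \<Rightarrow> real"
  assumes fin: "finite S" "finite I" "finite J" and K: "0 \<le> K"
    and card: "real (card S) \<le> exp p" "real (card J) \<le> exp (K * p)"
    and rho: "0 \<le> \<rho>" "\<And>k. k \<in> S \<Longrightarrow> op_norm I J (A k) \<le> \<rho>" and pos: "0 < col_norm S I J A"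
  defines "c \<equiv> col_norm S I J A"
    and "w \<equiv> (\<integral>x. (col_norm S I J (scaled x A))\<^sup>2 \<partial>PM S) + (col_norm S I J A)\<^sup>2"
  shows "(\<integral>x. \<bar>(col_norm S I J (scaled x A))\<^sup>2 - c\<^sup>2\<bar> \<partial>PM S) \<le> 10 * nck_const K * sqrt p * a * \<rho> * sqrt w"
proof -
  interpret PM: prob_space "PM S" by (rule prob_space_PM)
  let ?C = "nck_const K" and ?n = "2 ^ card S :: real"
  let ?c = "\<lambda>x. col_norm S I J (scaled x A)"
  define P where "P k j j' = (\<Sum>i\<in>I. A k i j * A k i j')" for k j j'
  let ?g = "\<lambda>y :: real. y\<^sup>2 - 1"
  let ?f = "\<lambda>x. 1 + sq_bound S x" and ?h = "\<lambda>x. (?c x)\<^sup>2 + c\<^sup>2"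
  have sq0: "0 \<le> sq_bound S x" for x by (rule sq_bound_nonneg)
  have gram: "(col_norm S I J B)\<^sup>2 = op_norm J J (\<lambda>j j'. \<Sum>k\<in>S. \<Sum>i\<in>I. B k i j * B k i j')"
    for B :: "'k \<Rightarrow> 'i \<Rightarrow> 'j \<Rightarrow> real"
  proof -
    have "op_norm J (S \<times> I) (\<lambda>j l. col_mat B l j) = col_norm S I J B" by (rule op_norm_transpose)
    then have "(col_norm S I J B)\<^sup>2 = op_norm J J (\<lambda>j j'. \<Sum>l\<in>S \<times> I. col_mat B l j * col_mat B l j')"
      by (simp add: op_norm_gram)
    then show ?thesis by (simp add: col_mat_def sum.cartesian_product case_prod_beta)
  qed
  have gx: "(?c x)\<^sup>2 = op_norm J J (\<lambda>j j'. \<Sum>k\<in>S. (x k)\<^sup>2 * P k j j')" for x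
    unfolding gram P_def sum_distrib_left by (simp add: power2_eq_square mult_ac)
  have g1: "c\<^sup>2 = op_norm J J (\<lambda>j j'. \<Sum>k\<in>S. P k j j')"
    unfolding c_def gram P_def ..
  have dev: "\<bar>(?c x)\<^sup>2 - c\<^sup>2\<bar> \<le> op_norm J J (rand_sum S ?g P x)" for x
  proof -
    let ?X = "\<lambda>j j'. \<Sum>k\<in>S. (x k)\<^sup>2 * P k j j'" and ?Y = "\<lambda>j j'. \<Sum>k\<in>S. P k j j'"
    have 1: "(\<lambda>j j'. ?X j j' - ?Y j j') = rand_sum S ?g P x"
      by (simp add: rand_sum_def fun_eq_iff algebra_simps sum_subtractf)
    have 2: "op_norm J J (\<lambda>j j'. ?Y j j' - ?X j j') = op_norm J J (rand_sum S ?g P x)"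
    proof -
      have "(\<lambda>j j'. ?Y j j' - ?X j j') = (\<lambda>j j'. (- 1) * rand_sum S ?g P x j j')"
        by (simp add: rand_sum_def fun_eq_iff algebra_simps sum_subtractf)
      then show ?thesis using op_norm_scale[of J J "- 1" "rand_sum S ?g P x"] by simp
    qed
    show ?thesis
      using op_norm_diff[of J J ?X ?Y] op_norm_diff[of J J ?Y ?X] unfolding gx g1 1 2 by linarith
  qed
  have gi: "integrable mu ?g" "(\<integral>y. ?g y \<partial>mu) = 0"
    using var by (simp_all add: prob_space)
  have w0: "w > 0" using pos by (simp add: w_def add_nonneg_pos)
  have ih: "integrable (PM S) ?h"
    using integrable_col_norm_sq[OF fin card(1), of A] by simp
  have ih': "(\<integral>x. ?h x \<partial>PM S) = w"
    using integrable_col_norm_sq[OF fin card(1), of A] by (simp add: w_def c_def PM.prob_space)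
  have if1: "integrable (PM S) ?f"
    using sq_bound_integral(1)[OF fin(1) card(1)] by simp
  have "(\<integral>x. ?f x \<partial>PM S) = 1 + (\<integral>x. sq_bound S x \<partial>PM S)"
    using sq_bound_integral(1)[OF fin(1) card(1)] by (simp add: PM.prob_space)
  moreover have "1 \<le> a\<^sup>2" using a by simp
  moreover have "0 \<le> (\<integral>x. sq_bound S x \<partial>PM S)" using sq0 by (simp add: integral_nonneg_AE)
  \<comment> \<open>The bound \<open>1 + 18 * a\<^sup>2\<close> is rounded up to the perfect square
    \<open>25 * a\<^sup>2\<close>; its root 5 and the 2 from symmetrization make the final factor
    10.\<close>
  ultimately have if2: "(\<integral>x. ?f x \<partial>PM S) \<le> 25 * a\<^sup>2" "0 < (\<integral>x. ?f x \<partial>PM S)"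
    using sq_bound_integral(2)[OF fin(1) card(1)] by simp_all
  note cs = integral_sqrt_mult_le[of "PM S" ?f ?h, OF if1 _ if2(2) ih]
  have cs: "integrable (PM S) (\<lambda>x. sqrt (?f x * ?h x))"
    "(\<integral>x. sqrt (?f x * ?h x) \<partial>PM S) \<le> sqrt ((\<integral>x. ?f x \<partial>PM S) * w)"
    using cs w0 sq0 by (simp_all add: ih' add_nonneg_nonneg)
  have pt: "(\<Sum>e\<in>signs S. op_norm J J (sign_sum S (\<lambda>k j j'. ?g (x k) * P k j j') e))
      \<le> ?C * sqrt p * (\<rho> * sqrt (?f x * ?h x)) * ?n" for x
  proof (rule noncommutative_khintchine_sym)
    show "?g (x k) * P k i j = ?g (x k) * P k j i" for k i j by (simp add: P_def mult.commute)
    fix v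
    let ?b = "\<lambda>k. L2_set (mat_vec J (A k) v) I"
    \<comment> \<open>\<open>P k v\<close> is the transpose of \<open>A k\<close> applied to
      \<open>A k v\<close>: one factor is paid with \<open>\<rho>\<close>, the other is kept to
      rebuild the column norm.\<close>
    have Pk: "L2_set (mat_vec J (P k) v) J \<le> \<rho> * ?b k" if "k \<in> S" for k
    proof -
      have "mat_vec J (P k) v j = mat_vec I (\<lambda>j i. A k i j) (mat_vec J (A k) v) j" for j
        unfolding P_def sum_distrib_left sum_distrib_right by (subst sum.swap) (simp add: mult.assoc)
      then have "L2_set (mat_vec J (P k) v) J = L2_set (mat_vec I (\<lambda>j i. A k i j) (mat_vec J (A k) v)) J"
        by simp
      also have "\<dots> \<le> op_norm J I (\<lambda>j i. A k i j) * ?b k" by (rule L2_set_mat_vec_le_op_norm)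
      also have "\<dots> \<le> \<rho> * ?b k"
        unfolding op_norm_transpose[of J I "A k"] using rho(2)[OF that] by (intro mult_right_mono) auto
      finally show ?thesis .
    qed
    \<comment> \<open>One of the two factors \<open>(x k)\<^sup>2 + 1\<close> is replaced by a
      majorant independent of \<open>k\<close>; the other stays and weights the terms of the column
      norm.\<close>
    have sc: "((x k)\<^sup>2 - 1)\<^sup>2 \<le> ?f x * ((x k)\<^sup>2 + 1)" if "k \<in> S" for k
    proof -
      have "((x k)\<^sup>2 - 1)\<^sup>2 \<le> (1 + (x k)\<^sup>2) * ((x k)\<^sup>2 + 1)"
        by (simp add: power2_eq_square algebra_simps)
      also have "\<dots> \<le> ?f x * ((x k)\<^sup>2 + 1)"
        using sq_le_sq_bound[OF fin(1) that, of x] by (intro mult_right_mono) auto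
      finally show ?thesis .
    qed
    have "(\<Sum>k\<in>S. (L2_set (mat_vec J (\<lambda>j j'. ?g (x k) * P k j j') v) J)\<^sup>2)
        = (\<Sum>k\<in>S. ((x k)\<^sup>2 - 1)\<^sup>2 * (L2_set (mat_vec J (P k) v) J)\<^sup>2)"
      unfolding L2_mat_vec_scaled by (simp add: power_mult_distrib)
    also have "\<dots> \<le> (\<Sum>k\<in>S. (?f x * ((x k)\<^sup>2 + 1)) * (\<rho> * ?b k)\<^sup>2)"
      using sq0 by (intro sum_mono mult_mono sc power_mono Pk) auto
    also have "\<dots> = \<rho>\<^sup>2 * ?f x * ((\<Sum>k\<in>S. (x k)\<^sup>2 * (?b k)\<^sup>2) + (\<Sum>k\<in>S. (?b k)\<^sup>2))"
      unfolding sum.distrib[symmetric] sum_distrib_left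
      by (intro sum.cong refl) (simp add: power_mult_distrib algebra_simps)
    also have "\<dots> \<le> \<rho>\<^sup>2 * ?f x * ((?c x)\<^sup>2 * (L2_set v J)\<^sup>2 + c\<^sup>2 * (L2_set v J)\<^sup>2)"
    proof (intro mult_left_mono add_mono)
      have "(\<Sum>k\<in>S. (x k)\<^sup>2 * (?b k)\<^sup>2) = (\<Sum>k\<in>S. (L2_set (mat_vec J (scaled x A k) v) I)\<^sup>2)"
        unfolding L2_mat_vec_scaled by (simp add: power_mult_distrib)
      then show "(\<Sum>k\<in>S. (x k)\<^sup>2 * (?b k)\<^sup>2) \<le> (?c x)\<^sup>2 * (L2_set v J)\<^sup>2"
        using col_mat_le[where J = J and A = "scaled x A" and v = v and I = I and S = S] by simp
      show "(\<Sum>k\<in>S. (?b k)\<^sup>2) \<le> c\<^sup>2 * (L2_set v J)\<^sup>2" unfolding c_def by (rule col_mat_le)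
    qed (use sq0 in simp)
    also have "\<dots> = (\<rho> * sqrt (?f x * ?h x))\<^sup>2 * (L2_set v J)\<^sup>2"
      using sq0[of x] by (simp add: power_mult_distrib distrib_left distrib_right)
    finally show "(\<Sum>k\<in>S. (L2_set (mat_vec J (\<lambda>j j'. ?g (x k) * P k j j') v) J)\<^sup>2)
        \<le> (\<rho> * sqrt (?f x * ?h x))\<^sup>2 * (L2_set v J)\<^sup>2" .
  qed (use fin p K card rho sq0 in \<open>auto intro!: mult_nonneg_nonneg simp: add_nonneg_nonneg\<close>)
  have "?n * (\<integral>x. op_norm J J (rand_sum S ?g P x) \<partial>PM S)
      \<le> 2 * (\<integral>x. (\<Sum>e\<in>signs S. op_norm J J (sign_sum S (\<lambda>k j j'. ?g (x k) * P k j j') e)) \<partial>PM S)"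
    by (rule symmetrization_upper[OF fin(3,3,1) gi])
  also have "\<dots> \<le> 2 * (\<integral>x. ?C * sqrt p * (\<rho> * sqrt (?f x * ?h x)) * ?n \<partial>PM S)"
    by (intro mult_left_mono integral_mono pt Bochner_Integration.integrable_sum
        integrable_sign_sum[OF fin(3,3,1) gi(1)]) (use cs(1) in auto)
  also have "\<dots> = ?n * (2 * ?C * sqrt p * \<rho> * (\<integral>x. sqrt (?f x * ?h x) \<partial>PM S))" by simp
  finally have "(\<integral>x. op_norm J J (rand_sum S ?g P x) \<partial>PM S)
      \<le> 2 * ?C * sqrt p * \<rho> * (\<integral>x. sqrt (?f x * ?h x) \<partial>PM S)" by simp
  also have "\<dots> \<le> 2 * ?C * sqrt p * \<rho> * sqrt ((\<integral>x. ?f x \<partial>PM S) * w)"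
    using p rho(1) nck_const_pos[of K] by (intro mult_left_mono cs(2)) (auto intro!: mult_nonneg_nonneg)
  also have "\<dots> \<le> 2 * ?C * sqrt p * \<rho> * sqrt (25 * a\<^sup>2 * w)"
    using p rho(1) nck_const_pos[of K] w0 if2
    by (intro mult_left_mono real_sqrt_le_mono mult_right_mono) (auto intro!: mult_nonneg_nonneg)
  also have "sqrt (25 * a\<^sup>2 * w) = 5 * a * sqrt w"
  proof -
    have "25 * a\<^sup>2 * w = (5 * a)\<^sup>2 * w" by (simp add: power_mult_distrib)
    then show ?thesis using a by (simp add: real_sqrt_mult)
  qed
  finally have main: "(\<integral>x. op_norm J J (rand_sum S ?g P x) \<partial>PM S)
      \<le> 10 * nck_const K * sqrt p * a * \<rho> * sqrt w" by (simp add: mult_ac)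
  have "(\<integral>x. \<bar>(?c x)\<^sup>2 - c\<^sup>2\<bar> \<partial>PM S) \<le> (\<integral>x. op_norm J J (rand_sum S ?g P x) \<partial>PM S)"
    using ih integrable_col_norm_sq[OF fin card(1), of A]
    by (intro integral_mono dev integrable_op_norm_rand_sum fin gi) auto
  with main show ?thesis by linarith
qed

text \<open>With \<open>z\<^sup>2 = w\<close>, the deviation bound implies
  \<open>z\<^sup>2 \<le> 2 c\<^sup>2 + \<kappa> z\<close>, hence
  \<open>z \<le> 2 c + \<kappa>\<close>, and the first moment is at most \<open>z\<close>. For the
  lower bound, dividing the deviation by \<open>c\<close> converts squares into norms, with error
  \<open>\<kappa> z / c\<close>.\<close>

lemma integral_col_norm_bounds:
  fixes A :: "'k \<Rightarrow> 'i \<Rightarrow> 'j \<Rightarrow> real"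
  assumes fin: "finite S" "finite I" "finite J" and K: "0 \<le> K"
    and card: "real (card S) \<le> exp p" "real (card J) \<le> exp (K * p)"
    and rho: "0 \<le> \<rho>" "\<And>k. k \<in> S \<Longrightarrow> op_norm I J (A k) \<le> \<rho>"
  defines "c \<equiv> col_norm S I J A" and "\<kappa> \<equiv> 10 * nck_const K * sqrt p * a * \<rho>"
    and "E \<equiv> (\<integral>x. col_norm S I J (scaled x A) \<partial>PM S)"
  shows "E \<le> 2 * c + \<kappa>" "c - 3 * \<kappa> \<le> E"
proof -
  interpret PM: prob_space "PM S" by (rule prob_space_PM)
  let ?c = "\<lambda>x. col_norm S I J (scaled x A)"
  have k0: "\<kappa> \<ge> 0" unfolding \<kappa>_def using rho(1) a p nck_const_pos[of K] by simp
  have E0: "E \<ge> 0" unfolding E_def by (simp add: integral_nonneg_AE op_norm_nonneg)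
  have c0: "c \<ge> 0" by (simp add: c_def op_norm_nonneg)
  have "E \<le> 2 * c + \<kappa> \<and> c - 3 * \<kappa> \<le> E"
  proof (cases "c = 0")
    case True
    \<comment> \<open>The deviation bound assumes \<open>c > 0\<close>; for \<open>c = 0\<close> the
      cruder estimate already forces \<open>E = 0\<close>.\<close>
    then have "E \<le> 0" using integral_col_norm_le[OF fin card(1), of A] by (simp add: E_def c_def)
    then show ?thesis using True k0 E0 by linarith
  next
    case False
    then have c: "c > 0" using c0 by simp
    define w where "w = (\<integral>x. (?c x)\<^sup>2 \<partial>PM S) + c\<^sup>2"
    define z where "z = sqrt w"
    note isq = integrable_col_norm_sq[OF fin card(1), of A]
    have w: "w > 0" using c by (simp add: w_def add_nonneg_pos)
    then have z: "z > 0" "w = z\<^sup>2" by (simp_all add: z_def)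
    have D: "(\<integral>x. \<bar>(?c x)\<^sup>2 - c\<^sup>2\<bar> \<partial>PM S) \<le> \<kappa> * z"
      using col_norm_sq_deviation[OF fin K card rho] c unfolding c_def \<kappa>_def z_def w_def by simp
    have "(\<integral>x. (?c x)\<^sup>2 \<partial>PM S) - c\<^sup>2 = (\<integral>x. (?c x)\<^sup>2 - c\<^sup>2 \<partial>PM S)"
      using isq by (simp add: PM.prob_space)
    also have "\<dots> \<le> (\<integral>x. \<bar>(?c x)\<^sup>2 - c\<^sup>2\<bar> \<partial>PM S)" using isq by (intro integral_mono) auto
    finally have "z\<^sup>2 \<le> 2 * c\<^sup>2 + \<kappa> * z" using D unfolding z(2)[symmetric] w_def by linarith
    moreover have "2 * (\<kappa> * z) \<le> \<kappa>\<^sup>2 + z\<^sup>2" using sum_squares_bound[of \<kappa> z] by simp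
    ultimately have "z\<^sup>2 \<le> 4 * c\<^sup>2 + \<kappa>\<^sup>2" by linarith
    also have "\<dots> \<le> (2 * c + \<kappa>)\<^sup>2" using c0 k0 by (simp add: power2_sum power_mult_distrib)
    finally have zle: "z \<le> 2 * c + \<kappa>" using c0 k0 by (intro power2_le_imp_le[of z]) auto
    have "E \<le> (\<integral>x. ((?c x)\<^sup>2 / z + z) / 2 \<partial>PM S)"
      unfolding E_def
    proof (rule integral_mono)
      fix x
      have "2 * (?c x * z) \<le> (?c x)\<^sup>2 + z\<^sup>2" using sum_squares_bound[of "?c x" z] by simp
      then show "?c x \<le> ((?c x)\<^sup>2 / z + z) / 2" using z by (simp add: field_simps power2_eq_square)
    qed (use isq fin integrable_col_norm in auto)
    also have "\<dots> = ((\<integral>x. (?c x)\<^sup>2 \<partial>PM S) / z + z) / 2" using isq by (simp add: PM.prob_space)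
    also have "\<dots> \<le> (w / z + z) / 2"
      using z(1) by (intro divide_right_mono add_right_mono) (auto simp: w_def)
    also have "\<dots> = z" using z by (simp add: power2_eq_square)
    finally have 1: "E \<le> 2 * c + \<kappa>" using zle by simp
    \<comment> \<open>If \<open>c \<le> \<kappa>\<close>, the left side is not positive. Otherwise
      \<open>z \<le> 3 c\<close>, which is where the 3 comes from.\<close>
    have 2: "c - 3 * \<kappa> \<le> E"
    proof (cases "c \<le> \<kappa>")
      case True
      then show ?thesis using k0 E0 by linarith
    next
      case False
      have "c - \<kappa> * z / c \<le> c - (\<integral>x. \<bar>(?c x)\<^sup>2 - c\<^sup>2\<bar> \<partial>PM S) / c"
        using D c by (simp add: divide_right_mono)
      also have "\<dots> = (\<integral>x. c - \<bar>(?c x)\<^sup>2 - c\<^sup>2\<bar> / c \<partial>PM S)" using isq by (simp add: PM.prob_space)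
      also have "\<dots> \<le> E" unfolding E_def
      proof (rule integral_mono)
        fix x
        have "c * (c - ?c x) \<le> c * \<bar>?c x - c\<bar>" using c0 by (intro mult_left_mono) auto
        also have "\<dots> \<le> (?c x + c) * \<bar>?c x - c\<bar>"
          by (intro mult_right_mono) (auto simp: op_norm_nonneg)
        also have "\<dots> = \<bar>(?c x)\<^sup>2 - c\<^sup>2\<bar>"
        proof -
          have "(?c x)\<^sup>2 - c\<^sup>2 = (?c x + c) * (?c x - c)" by (simp add: power2_eq_square algebra_simps)
          then show ?thesis using c0 op_norm_nonneg[of "S \<times> I" J "col_mat (scaled x A)"] by (simp add: abs_mult)
        qed
        finally show "c - \<bar>(?c x)\<^sup>2 - c\<^sup>2\<bar> / c \<le> ?c x" using c by (simp add: field_simps)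
      qed (use isq fin integrable_col_norm in auto)
      finally have "c - \<kappa> * z / c \<le> E" .
      moreover have "\<kappa> * z / c \<le> 3 * \<kappa>"
      proof -
        have "z \<le> 3 * c" using zle False by linarith
        then have "\<kappa> * z \<le> \<kappa> * (3 * c)" using k0 by (intro mult_left_mono)
        then show ?thesis using c by (simp add: field_simps)
      qed
      ultimately show ?thesis by linarith
    qed
    show ?thesis using 1 2 by simp
  qed
  then show "E \<le> 2 * c + \<kappa>" "c - 3 * \<kappa> \<le> E" by auto
qed

text \<open>The factor 4 is 2 from the first-moment Khintchine inequality times 2 from
  symmetrization.\<close>

lemma integral_col_norm_le_lower:
  assumes fin: "finite S" "finite I" "finite J"
  shows "(\<integral>x. col_norm S I J (scaled x A) \<partial>PM S) \<le> 4 * (\<integral>x. op_norm I J (rand_sum S (\<lambda>y. y) A x) \<partial>PM S)"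
proof -
  let ?n = "2 ^ card S :: real"
  have "?n * (\<integral>x. col_norm S I J (scaled x A) \<partial>PM S) = (\<integral>x. ?n * col_norm S I J (scaled x A) \<partial>PM S)"
    by simp
  also have "\<dots> \<le> (\<integral>x. 2 * (\<Sum>e\<in>signs S. op_norm I J (sign_sum S (scaled x A) e)) \<partial>PM S)"
    by (intro integral_mono khintchine_matrix_lower fin integrable_mult_right Bochner_Integration.integrable_sum
        integrable_sign_sum[OF fin(2,3,1) mean(1)] integrable_col_norm)
  also have "\<dots> \<le> 2 * (?n * (2 * (\<integral>x. op_norm I J (rand_sum S (\<lambda>y. y) A x) \<partial>PM S)))"
    using symmetrization_lower[OF fin(2,3,1) mean, of A] by simp
  also have "\<dots> = ?n * (4 * (\<integral>x. op_norm I J (rand_sum S (\<lambda>y. y) A x) \<partial>PM S))" by simp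
  finally show ?thesis by (rule mult_left_le_imp_le) simp
qed

end

section \<open>Removing one position of the tensor\<close>

text \<open>The square arises because the Khintchine inequality is applied to the sum and again to
  the deviation of the squares. The coefficient \<open>40 = 2 * 20\<close> of the remainder in the
  sharp upper bound dominates all the others.\<close>

definition step_const :: "real \<Rightarrow> real" where "step_const K = 40 * (nck_const (K + 1))\<^sup>2"

lemma nck_const_ge_one: "0 \<le> K \<Longrightarrow> 1 \<le> nck_const K"
  using one_le_exp_iff[of K] unfolding nck_const_def by linarith

lemma step_const_ge_one: "0 \<le> K \<Longrightarrow> 1 \<le> step_const K"
  using nck_const_ge_one[of "K + 1"] one_le_power[of "nck_const (K + 1)" 2]
  unfolding step_const_def by linarith

context chaos_law
begin

text \<open>The first bound pays \<open>a * sqrt p\<close> and has no remainder; it serves tensors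
  that already have a position on both sides. The second has the right power of the logarithm at the
  price of a remainder in \<open>\<rho>\<close>. The last two recover either norm from
  \<open>Y\<close>.\<close>

lemma chaos_one_step:
  fixes A :: "'k \<Rightarrow> 'i \<Rightarrow> 'j \<Rightarrow> real"
  assumes fin: "finite S" "finite I" "finite J" and K: "0 \<le> K"
    and card: "real (card S) \<le> exp p" "real (card I) \<le> exp (K * p)" "real (card J) \<le> exp (K * p)"
    and rho: "0 \<le> \<rho>" "\<And>k. k \<in> S \<Longrightarrow> op_norm I J (A k) \<le> \<rho>"
  defines "c \<equiv> op_norm (S \<times> I) J (col_mat A)" and "r \<equiv> op_norm I (S \<times> J) (row_mat A)"
    and "Y \<equiv> (\<integral>x. op_norm I J (rand_sum S (\<lambda>y. y) A x) \<partial>PM S)"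
  shows "Y \<le> step_const K * (a * sqrt p) * (r + c)"
    and "Y \<le> step_const K * (sqrt p * (r + c) + a * (sqrt p)\<^sup>2 * \<rho>)"
    and "c \<le> 4 * Y + step_const K * (a * sqrt p * \<rho>)"
    and "r \<le> 4 * Y + step_const K * (a * sqrt p * \<rho>)"
proof -
  let ?T = "\<lambda>k. transp_mat (A k)"
  define Ec where "Ec = (\<integral>x. col_norm S I J (scaled x A) \<partial>PM S)"
  define Er where "Er = (\<integral>x. col_norm S J I (scaled x ?T) \<partial>PM S)"
  define N where "N = nck_const (K + 1)"
  define b where "b = a * sqrt p * \<rho>"
  have N1: "N \<ge> 1" using K by (simp add: N_def nck_const_ge_one)
  have NK: "nck_const K \<le> N" by (simp add: N_def nck_const_def)
  have N2: "N \<le> N\<^sup>2" using N1 by (simp add: power2_eq_square)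
  have b0: "b \<ge> 0" using a p rho by (simp add: b_def)
  have sp: "sqrt p \<ge> 0" using p by simp
  have c0: "c \<ge> 0" and r0: "r \<ge> 0" by (simp_all add: c_def r_def op_norm_nonneg)
  have rT: "r = col_norm S J I ?T" unfolding r_def by (rule op_norm_row_transpose)
  have rhoT: "op_norm J I (?T k) \<le> \<rho>" if "k \<in> S" for k
    using rho(2)[OF that] op_norm_transpose[of J I "A k"] by (simp add: transp_mat_def[abs_def])
  have YT: "Y = (\<integral>x. op_norm J I (rand_sum S (\<lambda>y. y) ?T x) \<partial>PM S)"
  proof -
    have "rand_sum S (\<lambda>y. y) ?T x = (\<lambda>j i. rand_sum S (\<lambda>y. y) A x i j)" for x
      by (simp add: rand_sum_def transp_mat_def fun_eq_iff)
    then have "op_norm J I (rand_sum S (\<lambda>y. y) ?T x) = op_norm I J (rand_sum S (\<lambda>y. y) A x)" for x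
      using op_norm_transpose[of J I "rand_sum S (\<lambda>y. y) A x"] by simp
    then show ?thesis by (simp add: Y_def)
  qed
  have kap: "10 * nck_const K * sqrt p * a * \<rho> \<le> 10 * N * b"
  proof -
    have "nck_const K * b \<le> N * b" using NK b0 by (rule mult_right_mono)
    then show ?thesis by (simp add: b_def mult_ac)
  qed
  have up: "Y \<le> 2 * N * sqrt p * (Ec + Er)"
    unfolding Y_def Ec_def Er_def N_def by (rule integral_op_norm_le_row_col[OF fin K card(2,3)])
  have "Ec \<le> 5 * a * c" "Er \<le> 5 * a * r"
    unfolding Ec_def Er_def c_def rT using fin card(1) by (auto intro: integral_col_norm_le)
  then have "Ec + Er \<le> 5 * a * (r + c)" by (simp add: algebra_simps)
  then have "Y \<le> 2 * N * sqrt p * (5 * a * (r + c))"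
    using order_trans[OF up mult_left_mono[of "Ec + Er" "5 * a * (r + c)" "2 * N * sqrt p"]] sp N1 by simp
  also have "\<dots> = 10 * N * (a * sqrt p * (r + c))" by simp
  also have "\<dots> \<le> 40 * N\<^sup>2 * (a * sqrt p * (r + c))"
    using N1 N2 a sp r0 c0 by (intro mult_right_mono) auto
  finally show "Y \<le> step_const K * (a * sqrt p) * (r + c)" by (simp add: step_const_def N_def mult_ac)
  define \<kappa> where "\<kappa> = 10 * nck_const K * sqrt p * a * \<rho>"
  have bc: "Ec \<le> 2 * c + \<kappa>" "c - 3 * \<kappa> \<le> Ec"
    unfolding Ec_def c_def \<kappa>_def by (rule integral_col_norm_bounds[OF fin K card(1,3) rho], assumption)+
  have br: "Er \<le> 2 * r + \<kappa>" "r - 3 * \<kappa> \<le> Er"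
    unfolding Er_def rT \<kappa>_def by (rule integral_col_norm_bounds[OF fin(1,3,2) K card(1,2) rho(1) rhoT], assumption)+
  have kap: "\<kappa> \<le> 10 * (N * b)" using kap by (simp add: \<kappa>_def)
  have "Ec + Er \<le> 2 * (r + c) + 20 * (N * b)"
  proof -
    have "Ec + Er \<le> (2 * c + \<kappa>) + (2 * r + \<kappa>)" by (rule add_mono[OF bc(1) br(1)])
    also have "\<dots> = 2 * (r + c) + 2 * \<kappa>" by (simp add: algebra_simps)
    also have "\<dots> \<le> 2 * (r + c) + 2 * (10 * (N * b))" by (intro add_left_mono mult_left_mono kap) simp
    finally show ?thesis by (simp add: mult.assoc)
  qed
  then have "Ec + Er \<le> 2 * (r + c) + 20 * N * b" by simp
  then have "Y \<le> 2 * N * sqrt p * (2 * (r + c) + 20 * N * b)"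
    using order_trans[OF up mult_left_mono[of "Ec + Er" "2 * (r + c) + 20 * N * b" "2 * N * sqrt p"]] sp N1 by simp
  also have "\<dots> = 4 * N * (sqrt p * (r + c)) + 40 * N\<^sup>2 * (sqrt p * b)"
    by (simp add: algebra_simps power2_eq_square)
  also have "\<dots> \<le> 40 * N\<^sup>2 * (sqrt p * (r + c)) + 40 * N\<^sup>2 * (sqrt p * b)"
    using N1 N2 sp r0 c0 by (intro add_right_mono mult_right_mono) auto
  also have "\<dots> = step_const K * (sqrt p * (r + c) + a * (sqrt p)\<^sup>2 * \<rho>)"
    by (simp add: step_const_def N_def b_def algebra_simps power2_eq_square)
  finally show "Y \<le> step_const K * (sqrt p * (r + c) + a * (sqrt p)\<^sup>2 * \<rho>)" .
  have Nb: "30 * (N * b) \<le> step_const K * (a * sqrt p * \<rho>)"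
  proof -
    have "30 * N * b \<le> 40 * N\<^sup>2 * b" using N1 N2 b0 by (intro mult_right_mono) auto
    then show ?thesis by (simp add: step_const_def N_def b_def)
  qed
  show "c \<le> 4 * Y + step_const K * (a * sqrt p * \<rho>)"
    using bc(2) kap Nb integral_col_norm_le_lower[OF fin, of A] unfolding Ec_def Y_def by linarith
  show "r \<le> 4 * Y + step_const K * (a * sqrt p * \<rho>)"
    using br(2) kap Nb integral_col_norm_le_lower[OF fin(1,3,2), of ?T] unfolding Er_def YT by linarith
qed

end

section \<open>Multi-indices with one position added\<close>

lemma flattening_alt:
  "flattening n D (\<lambda>i. T i * w i) R C r c
    = (\<Sum>i\<in>multi_indices D {1..n}. w i * (of_bool (r = restrict i R) * of_bool (c = restrict i C) * T i))"
  unfolding flattening_def by (intro sum.cong) auto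

lemma finite_multi_indices: "finite R \<Longrightarrow> finite (multi_indices D R)"
  unfolding multi_indices_def by (rule finite_PiE) auto

text \<open>Adding position \<open>k\<close> to one side of a flattening contributes only the
  indicator of \<open>i k = j\<close>; this is the algebra behind all three block
  constructions.\<close>

lemma fun_upd_eq_restrict_iff:
  assumes "c \<in> multi_indices D C" "k \<notin> C"
  shows "c(k := j) = restrict i (insert k C) \<longleftrightarrow> c = restrict i C \<and> i k = j"
proof -
  have ck: "c k = undefined" using assms by (auto simp: multi_indices_def)
  show ?thesis
  proof
    assume e: "c(k := j) = restrict i (insert k C)"
    have "c x = restrict i C x" for x
    proof (cases "x = k")
      case True
      then show ?thesis using ck assms(2) by simp
    next
      case False
      have "(c(k := j)) x = restrict i (insert k C) x" by (rule fun_cong[OF e])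
      then show ?thesis using False by (simp only: restrict_def fun_upd_apply insert_iff if_False simp_thms)
    qed
    then have "c = restrict i C" by (rule ext)
    moreover have "j = i k" using fun_cong[OF e, of k] by (simp add: restrict_def)
    ultimately show "c = restrict i C \<and> i k = j" by (intro conjI) (simp_all only:)
  next
    assume "c = restrict i C \<and> i k = j"
    then show "c(k := j) = restrict i (insert k C)" by (simp add: fun_eq_iff restrict_def)
  qed
qed

lemma multi_indices_upd:
  "c \<in> multi_indices D C \<Longrightarrow> j \<in> {1..D k} \<Longrightarrow> c(k := j) \<in> multi_indices D (insert k C)"
  unfolding multi_indices_def by (rule PiE_fun_upd)

lemma restrict_multi_indices_upd:
  assumes "c \<in> multi_indices D C" "k \<notin> C"
  shows "restrict (c(k := j)) C = c"
proof
  fix x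
  have "c \<in> extensional C" using assms(1) by (simp add: multi_indices_def PiE_def)
  then have "x \<notin> C \<Longrightarrow> c x = undefined" by (rule extensional_arb)
  then show "restrict (c(k := j)) C x = c x" using assms(2) by (cases "x \<in> C") auto
qed

text \<open>The block label is the pair \<open>(k, j)\<close> and not \<open>j\<close> alone,
  because random coordinates are labelled by position and index together.\<close>

lemma bij_betw_multi_indices_insert:
  assumes "k \<notin> C"
  shows "bij_betw (\<lambda>l. (snd l)(k := snd (fst l))) (({k} \<times> {1..D k}) \<times> multi_indices D C) (multi_indices D (insert k C))"
proof (rule bij_betwI[where g = "\<lambda>c. ((k, c k), restrict c C)"])
  show "(\<lambda>l. (snd l)(k := snd (fst l))) \<in> ({k} \<times> {1..D k}) \<times> multi_indices D C \<rightarrow> multi_indices D (insert k C)"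
    by (intro Pi_I multi_indices_upd) (simp_all add: mem_Times_iff)
  show "(\<lambda>c. ((k, c k), restrict c C)) \<in> multi_indices D (insert k C) \<rightarrow> ({k} \<times> {1..D k}) \<times> multi_indices D C"
  proof (rule Pi_I)
    fix c assume c: "c \<in> multi_indices D (insert k C)"
    then have "c x \<in> {1..D x}" if "x \<in> insert k C" for x
      using that unfolding multi_indices_def by (rule PiE_mem)
    then show "((k, c k), restrict c C) \<in> ({k} \<times> {1..D k}) \<times> multi_indices D C"
      unfolding multi_indices_def by (intro SigmaI restrict_PiE_iff[THEN iffD2]) blast+
  qed
  show "((k, ((snd l)(k := snd (fst l))) k), restrict ((snd l)(k := snd (fst l))) C) = l"
    if "l \<in> ({k} \<times> {1..D k}) \<times> multi_indices D C" for l
    using that restrict_multi_indices_upd[OF _ assms, of "snd l" D] by (cases l) (simp add: mem_Times_iff prod_eq_iff)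
  show "(snd ((k, c k), restrict c C))(k := snd (fst ((k, c k), restrict c C))) = c"
    if "c \<in> multi_indices D (insert k C)" for c
  proof
    fix x
    have "c \<in> extensional (insert k C)" using that by (simp add: multi_indices_def PiE_def)
    then have "x \<notin> insert k C \<Longrightarrow> c x = undefined" by (rule extensional_arb)
    then show "((snd ((k, c k), restrict c C))(k := snd (fst ((k, c k), restrict c C)))) x = c x"
      by (cases "x \<in> C") auto
  qed
qed

section \<open>Contracting positions with random coordinates\<close>

locale tensor_chaos = chaos_law +
  fixes n :: nat and D :: "nat \<Rightarrow> nat" and T :: "(nat \<Rightarrow> nat) \<Rightarrow> real"
  assumes D: "\<And>t. t \<in> {1..n} \<Longrightarrow> real (D t) \<le> exp p"
begin

definition idx :: "nat \<Rightarrow> (nat \<times> nat) set" where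
  "idx k = Sigma {1..k} (\<lambda>t. {1..D t})"

definition wt :: "nat \<Rightarrow> (nat \<times> nat \<Rightarrow> real) \<Rightarrow> (nat \<Rightarrow> nat) \<Rightarrow> real" where
  "wt k x i = (\<Prod>t\<in>{1..k}. x (t, i t))"

text \<open>The flattened tensor whose positions \<open>1, \<dots>, k\<close> have been contracted with the random
  coordinates.\<close>

definition partial_norm :: "nat \<Rightarrow> nat set \<Rightarrow> nat set \<Rightarrow> (nat \<times> nat \<Rightarrow> real) \<Rightarrow> real" where
  "partial_norm k R C x =
    op_norm (multi_indices D R) (multi_indices D C) (flattening n D (\<lambda>i. T i * wt k x i) R C)"

definition mean_norm :: "nat \<Rightarrow> nat set \<Rightarrow> nat set \<Rightarrow> real" where
  "mean_norm k R C = (\<integral>x. partial_norm k R C x \<partial>PM (idx k))"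

lemma finite_idx: "finite (idx k)"
  by (auto simp: idx_def)

lemma partial_norm_nonneg: "0 \<le> partial_norm k R C x"
  by (simp add: partial_norm_def op_norm_nonneg)

lemma mean_norm_0: "mean_norm 0 R C = flattening_norm n D T R C"
proof -
  interpret PM: prob_space "PM (idx 0)" by (rule prob_space_PM)
  show ?thesis by (simp add: mean_norm_def partial_norm_def flattening_norm_def wt_def PM.prob_space)
qed

text \<open>The coordinates \<open>(t, i t)\<close> are distinct for distinct \<open>t\<close>, so
  the weight is a product of independent variables and integrability of each factor suffices.
  Factors 1 extend it to a product over all coordinates.\<close>

lemma integrable_wt:
  assumes "k \<le> n" "i \<in> multi_indices D {1..n}"
  shows "integrable (PM (idx k)) (\<lambda>x. wt k x i)"
proof -
  interpret product_sigma_finite "\<lambda>_ :: nat \<times> nat. mu" by (rule product_sigma_finite_mu)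
  let ?G = "(\<lambda>t. (t, i t)) ` {1..k}"
  define f where "f s = (\<lambda>y :: real. if s \<in> ?G then y else 1)" for s
  have G: "?G \<subseteq> idx k" using assms by (auto simp: idx_def multi_indices_def PiE_iff)
  have "integrable mu (f s)" for s using mean(1) by (cases "s \<in> ?G") (auto simp: f_def)
  then have "integrable (PM (idx k)) (\<lambda>x. \<Prod>s\<in>idx k. f s (x s))"
    by (intro product_integrable_prod finite_idx)
  moreover have "(\<Prod>s\<in>idx k. f s (x s)) = wt k x i" for x
  proof -
    have "(\<Prod>s\<in>idx k. f s (x s)) = (\<Prod>s\<in>?G. f s (x s))"
      using G finite_idx by (intro prod.mono_neutral_right) (auto simp: f_def)
    also have "\<dots> = (\<Prod>s\<in>?G. x s)" by (intro prod.cong) (auto simp: f_def)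
    also have "\<dots> = wt k x i" unfolding wt_def by (subst prod.reindex) (auto simp: inj_on_def)
    finally show ?thesis .
  qed
  ultimately show ?thesis by simp
qed

lemma integrable_partial_norm:
  assumes k: "k \<le> n" and RC: "finite R" "finite C"
  shows "integrable (PM (idx k)) (partial_norm k R C)"
proof (rule Bochner_Integration.integrable_bound)
  let ?M = "\<lambda>i r c. of_bool (r = restrict i R) * of_bool (c = restrict i C) * T i"
  let ?N = "\<lambda>i. op_norm (multi_indices D R) (multi_indices D C) (?M i)"
  let ?b = "\<lambda>x. \<Sum>i\<in>multi_indices D {1..n}. \<bar>wt k x i\<bar> * ?N i"
  show "integrable (PM (idx k)) ?b"
    using integrable_wt[OF k] by (intro Bochner_Integration.integrable_sum) simp
  show "partial_norm k R C \<in> borel_measurable (PM (idx k))"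
    unfolding partial_norm_def[abs_def] flattening_alt
    using integrable_wt[OF k] RC
    by (intro borel_measurable_op_norm finite_multi_indices borel_measurable_sum borel_measurable_times
        borel_measurable_const) auto
  have "partial_norm k R C x \<le> ?b x" for x
    unfolding partial_norm_def flattening_alt[abs_def] by (rule op_norm_sum)
  then show "AE x in PM (idx k). norm (partial_norm k R C x) \<le> norm (?b x)"
    by (auto intro!: AE_I2 order_trans[OF _ abs_ge_self] simp: partial_norm_nonneg)
qed

text \<open>This allows \<open>K = n\<close> in the single-sum bounds, so that their constant
  depends only on the order of the tensor.\<close>

lemma card_multi_indices:
  assumes "R \<subseteq> {1..n}"
  shows "real (card (multi_indices D R)) \<le> exp (real n * p)"
proof -
  have fin: "finite R" using assms finite_subset by auto
  have "real (card (multi_indices D R)) = (\<Prod>t\<in>R. real (D t))"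
    unfolding multi_indices_def using fin by (simp add: card_PiE)
  also have "\<dots> \<le> (\<Prod>t\<in>R. exp p)" using D assms by (intro prod_mono) auto
  also have "\<dots> = exp (real (card R) * p)" by (simp add: exp_of_nat_mult)
  also have "\<dots> \<le> exp (real n * p)"
    using card_mono[OF _ assms] p by (auto intro: mult_right_mono)
  finally show ?thesis .
qed

section \<open>Integrating over one further position\<close>

context
  fixes k :: nat and R C :: "nat set"
  assumes k: "Suc k \<le> n" and RC: "R \<subseteq> {1..n}" "C \<subseteq> {1..n}" "Suc k \<notin> R" "Suc k \<notin> C"
begin

text \<open>With the coordinates \<open>y\<close> of the first \<open>k\<close> positions frozen,
  this is the matrix that multiplies the single coordinate \<open>s\<close>.\<close>

abbreviation (input) slice :: "(nat \<times> nat \<Rightarrow> real) \<Rightarrow> nat \<times> nat \<Rightarrow> (nat \<Rightarrow> nat) \<Rightarrow> (nat \<Rightarrow> nat) \<Rightarrow> real" where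
  "slice y s \<equiv> flattening n D (\<lambda>i. T i * (wt k y i * of_bool (i (Suc k) = snd s))) R C"

abbreviation (input) newvars :: "(nat \<times> nat) set" where
  "newvars \<equiv> {Suc k} \<times> {1..D (Suc k)}"

lemma finite_RC: "finite R" "finite C"
  using RC finite_subset by auto

lemma idx_Suc: "idx (Suc k) = idx k \<union> newvars" "idx k \<inter> newvars = {}"
  by (auto simp: idx_def le_Suc_eq)

lemma partial_norm_merge:
  "partial_norm (Suc k) R C (merge (idx k) newvars (y, x))
    = op_norm (multi_indices D R) (multi_indices D C) (rand_sum newvars (\<lambda>z. z) (slice y) x)"
  unfolding partial_norm_def
proof (rule op_norm_cong)
  fix r c
  let ?m = "merge (idx k) newvars (y, x)"
  have wt: "wt (Suc k) ?m i = (\<Sum>s\<in>newvars. x s * (wt k y i * of_bool (i (Suc k) = snd s)))"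
    if "i \<in> multi_indices D {1..n}" for i
  proof -
    have i: "i t \<in> {1..D t}" if "t \<in> {1..n}" for t
      using \<open>i \<in> _\<close> that by (auto simp: multi_indices_def)
    have new: "(Suc k, i (Suc k)) \<in> newvars" using i[of "Suc k"] k by auto
    have "wt (Suc k) ?m i = wt k y i * x (Suc k, i (Suc k))"
    proof -
      have "wt k ?m i = wt k y i"
        unfolding wt_def using i k by (intro prod.cong) (auto simp: merge_def idx_def)
      moreover have "?m (Suc k, i (Suc k)) = x (Suc k, i (Suc k))"
        using new idx_Suc(2) by (auto simp: merge_def)
      ultimately show ?thesis by (simp add: wt_def)
    qed
    \<comment> \<open>Only one new coordinate enters the weight of a given \<open>i\<close>; writing
      it as a sum over all of them exposes the linear dependence on \<open>x\<close>.\<close>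
    also have "\<dots> = (\<Sum>s\<in>newvars. if s = (Suc k, i (Suc k)) then x s * wt k y i else 0)"
      using new by simp
    also have "\<dots> = (\<Sum>s\<in>newvars. x s * (wt k y i * of_bool (i (Suc k) = snd s)))"
      by (intro sum.cong) auto
    finally show ?thesis .
  qed
  have "flattening n D (\<lambda>i. T i * wt (Suc k) ?m i) R C r c
      = (\<Sum>i\<in>multi_indices D {1..n}. \<Sum>s\<in>newvars. x s * (of_bool (r = restrict i R) * of_bool (c = restrict i C)
          * (T i * (wt k y i * of_bool (i (Suc k) = snd s)))))"
    unfolding flattening_def
  proof (intro sum.cong refl)
    fix i assume i: "i \<in> multi_indices D {1..n}"
    show "of_bool (r = restrict i R) * of_bool (c = restrict i C) * (T i * wt (Suc k) ?m i)
        = (\<Sum>s\<in>newvars. x s * (of_bool (r = restrict i R) * of_bool (c = restrict i C)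
          * (T i * (wt k y i * of_bool (i (Suc k) = snd s)))))"
      unfolding wt[OF i] sum_distrib_left by (intro sum.cong refl) (simp only: mult_ac)
  qed
  also have "\<dots> = rand_sum newvars (\<lambda>z. z) (slice y) x r c"
    unfolding rand_sum_def flattening_def sum_distrib_left by (rule sum.swap)
  finally show "flattening n D (\<lambda>i. T i * wt (Suc k) ?m i) R C r c = rand_sum newvars (\<lambda>z. z) (slice y) x r c" .
qed

lemma row_slice:
  "op_norm (multi_indices D R) (newvars \<times> multi_indices D C) (row_mat (slice y)) = partial_norm k R (insert (Suc k) C) y"
  unfolding partial_norm_def
proof (rule op_norm_reindex[OF bij_betw_id bij_betw_multi_indices_insert[OF RC(4)]])
  fix r l assume "r \<in> multi_indices D R" and l: "l \<in> newvars \<times> multi_indices D C"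
  then have c: "snd l \<in> multi_indices D C" by auto
  show "row_mat (slice y) r l
      = flattening n D (\<lambda>i. T i * wt k y i) R (insert (Suc k) C) (id r) ((snd l)(Suc k := snd (fst l)))"
    unfolding row_mat_def flattening_def fun_upd_eq_restrict_iff[OF c RC(4)]
    by (intro sum.cong) auto
qed (use finite_RC in \<open>auto intro: finite_multi_indices\<close>)

lemma col_slice:
  "op_norm (newvars \<times> multi_indices D R) (multi_indices D C) (col_mat (slice y)) = partial_norm k (insert (Suc k) R) C y"
  unfolding partial_norm_def
proof (rule op_norm_reindex[OF bij_betw_multi_indices_insert[OF RC(3)] bij_betw_id])
  fix l c assume "c \<in> multi_indices D C" and l: "l \<in> newvars \<times> multi_indices D R"
  then have r: "snd l \<in> multi_indices D R" by auto
  show "col_mat (slice y) l c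
      = flattening n D (\<lambda>i. T i * wt k y i) (insert (Suc k) R) C ((snd l)(Suc k := snd (fst l))) (id c)"
    unfolding col_mat_def flattening_def fun_upd_eq_restrict_iff[OF r RC(3)]
    by (intro sum.cong) auto
qed (use finite_RC in \<open>auto intro: finite_multi_indices\<close>)

text \<open>A slice is the diagonal block, in the flattening with the new position on both sides,
  where both copies of that position equal \<open>snd s\<close>. One norm thus bounds all
  coefficient matrices.\<close>

lemma op_norm_slice_le:
  assumes s: "s \<in> newvars"
  shows "op_norm (multi_indices D R) (multi_indices D C) (slice y s)
    \<le> partial_norm k (insert (Suc k) R) (insert (Suc k) C) y"
  unfolding partial_norm_def
proof (rule op_norm_submatrix[where f = "\<lambda>r. r(Suc k := snd s)" and g = "\<lambda>c. c(Suc k := snd s)"])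
  have im: "(\<lambda>r. r(Suc k := snd s)) ` multi_indices D U \<subseteq> multi_indices D (insert (Suc k) U)" for U
    using s by (intro image_subsetI multi_indices_upd) (simp_all add: mem_Times_iff)
  have inj: "inj_on (\<lambda>r. r(Suc k := snd s)) (multi_indices D U)" if "Suc k \<notin> U" for U
    by (rule inj_on_inverseI[where g = "\<lambda>r. restrict r U"]) (rule restrict_multi_indices_upd[OF _ that])
  show "inj_on (\<lambda>r. r(Suc k := snd s)) (multi_indices D R)" "inj_on (\<lambda>r. r(Suc k := snd s)) (multi_indices D C)"
    "(\<lambda>r. r(Suc k := snd s)) ` multi_indices D R \<subseteq> multi_indices D (insert (Suc k) R)"
    "(\<lambda>r. r(Suc k := snd s)) ` multi_indices D C \<subseteq> multi_indices D (insert (Suc k) C)"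
    using inj im RC by auto
  fix r c assume r: "r \<in> multi_indices D R" and c: "c \<in> multi_indices D C"
  show "slice y s r c
      = flattening n D (\<lambda>i. T i * wt k y i) (insert (Suc k) R) (insert (Suc k) C) (r(Suc k := snd s)) (c(Suc k := snd s))"
    unfolding flattening_def fun_upd_eq_restrict_iff[OF r RC(3)] fun_upd_eq_restrict_iff[OF c RC(4)]
    by (intro sum.cong) auto
qed (use finite_RC in \<open>auto intro: finite_multi_indices\<close>)

lemma mean_norm_step:
  fixes C1 :: real
  defines "C1 \<equiv> step_const (real n)"
    and "er \<equiv> mean_norm k R (insert (Suc k) C)" and "ec \<equiv> mean_norm k (insert (Suc k) R) C"
    and "eb \<equiv> mean_norm k (insert (Suc k) R) (insert (Suc k) C)"
  shows "mean_norm (Suc k) R C \<le> C1 * (a * sqrt p) * (er + ec)"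
    and "mean_norm (Suc k) R C \<le> C1 * (sqrt p * (er + ec) + a * (sqrt p)\<^sup>2 * eb)"
    and "ec \<le> 4 * mean_norm (Suc k) R C + C1 * (a * sqrt p * eb)"
    and "er \<le> 4 * mean_norm (Suc k) R C + C1 * (a * sqrt p * eb)"
proof -
  interpret product_sigma_finite "\<lambda>_ :: nat \<times> nat. mu" by (rule product_sigma_finite_mu)
  let ?r = "partial_norm k R (insert (Suc k) C)" and ?c = "partial_norm k (insert (Suc k) R) C"
    and ?b = "partial_norm k (insert (Suc k) R) (insert (Suc k) C)"
  define Y where "Y y = (\<integral>x. op_norm (multi_indices D R) (multi_indices D C)
      (rand_sum newvars (\<lambda>z. z) (slice y) x) \<partial>PM newvars)" for y
  have fin: "finite newvars" "finite (multi_indices D R)" "finite (multi_indices D C)"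
    using finite_RC by (auto intro: finite_multi_indices)
  have "real (card newvars) \<le> exp p" using D[of "Suc k"] k by simp
  note card = this card_multi_indices[OF RC(1)] card_multi_indices[OF RC(2)]
  note st = chaos_one_step[where A = "slice y" for y, OF fin of_nat_0_le_iff card partial_norm_nonneg op_norm_slice_le,
      unfolded row_slice col_slice, folded Y_def C1_def]
  have int: "integrable (PM (idx (Suc k))) (partial_norm (Suc k) R C)"
    using k finite_RC by (intro integrable_partial_norm)
  have EY: "mean_norm (Suc k) R C = (\<integral>y. Y y \<partial>PM (idx k))"
    using product_integral_fold[OF idx_Suc(2) finite_idx fin(1), folded idx_Suc(1), OF int]
    unfolding mean_norm_def Y_def partial_norm_merge .
  have iY: "integrable (PM (idx k)) Y"
    using integrable_PiM_fold[OF idx_Suc(2) finite_idx fin(1), folded idx_Suc(1), OF int]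
    unfolding Y_def[abs_def] partial_norm_merge .
  have ir: "integrable (PM (idx k)) ?r" "integrable (PM (idx k)) ?c" "integrable (PM (idx k)) ?b"
    using k finite_RC by (auto intro: integrable_partial_norm)
  have "(\<integral>y. Y y \<partial>PM (idx k)) \<le> (\<integral>y. C1 * (a * sqrt p) * (?r y + ?c y) \<partial>PM (idx k))"
    by (intro integral_mono st(1) iY) (use ir in auto)
  then show "mean_norm (Suc k) R C \<le> C1 * (a * sqrt p) * (er + ec)"
    using ir unfolding EY by (simp add: er_def ec_def mean_norm_def)
  have "(\<integral>y. Y y \<partial>PM (idx k)) \<le> (\<integral>y. C1 * (sqrt p * (?r y + ?c y) + a * (sqrt p)\<^sup>2 * ?b y) \<partial>PM (idx k))"
    by (intro integral_mono st(2) iY) (use ir in auto)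
  then show "mean_norm (Suc k) R C \<le> C1 * (sqrt p * (er + ec) + a * (sqrt p)\<^sup>2 * eb)"
    using ir unfolding EY by (simp add: er_def ec_def eb_def mean_norm_def)
  have "(\<integral>y. ?c y \<partial>PM (idx k)) \<le> (\<integral>y. 4 * Y y + C1 * (a * sqrt p * ?b y) \<partial>PM (idx k))"
    by (intro integral_mono st(3)) (use ir iY in auto)
  then show "ec \<le> 4 * mean_norm (Suc k) R C + C1 * (a * sqrt p * eb)"
    using ir iY unfolding EY by (simp add: ec_def eb_def mean_norm_def)
  have "(\<integral>y. ?r y \<partial>PM (idx k)) \<le> (\<integral>y. 4 * Y y + C1 * (a * sqrt p * ?b y) \<partial>PM (idx k))"
    by (intro integral_mono st(4)) (use ir iY in auto)
  then show "er \<le> 4 * mean_norm (Suc k) R C + C1 * (a * sqrt p * eb)"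
    using ir iY unfolding EY by (simp add: er_def eb_def mean_norm_def)
qed

end

end

section \<open>Induction over the positions\<close>

context tensor_chaos
begin

abbreviation "C1 \<equiv> step_const (real n)"
abbreviation "ap \<equiv> a * sqrt p"

lemma constants: "1 \<le> C1" "1 \<le> sqrt p" "1 \<le> ap"
proof -
  show "1 \<le> C1" by (rule step_const_ge_one) simp
  show "1 \<le> sqrt p" using p by simp
  then show "1 \<le> ap" using a mult_mono[of 1 a 1 "sqrt p"] by simp
qed

lemma partition_insert:
  assumes s: "\<And>U. U \<subseteq> {1..Suc k} \<Longrightarrow> flattening_norm n D T (R \<union> U) (C \<union> ({1..Suc k} - U)) \<le> s"
    and U: "U \<subseteq> {1..k}"
  shows "flattening_norm n D T (insert (Suc k) R \<union> U) (C \<union> ({1..k} - U)) \<le> s"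
    and "flattening_norm n D T (R \<union> U) (insert (Suc k) C \<union> ({1..k} - U)) \<le> s"
proof -
  have K: "{Suc 0..Suc k} = insert (Suc k) {Suc 0..k}" by auto
  have "C \<union> ({1..k} - U) = C \<union> ({1..Suc k} - insert (Suc k) U)" using U by (auto simp: K)
  moreover have "insert (Suc k) R \<union> U = R \<union> insert (Suc k) U" by auto
  ultimately show "flattening_norm n D T (insert (Suc k) R \<union> U) (C \<union> ({1..k} - U)) \<le> s"
    using s[of "insert (Suc k) U"] U by (auto simp: K)
  have "insert (Suc k) C \<union> ({1..k} - U) = C \<union> ({1..Suc k} - U)" using U by (auto simp: K)
  then show "flattening_norm n D T (R \<union> U) (insert (Suc k) C \<union> ({1..k} - U)) \<le> s"
    using s[of U] U by (simp add: subset_insertI2 K)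
qed

text \<open>\<open>R\<close> and \<open>C\<close> may share positions beyond \<open>k\<close>, and
  \<open>s\<close> is any common bound for the flattenings reached, so the lemma also covers tensors
  with a position on both sides. Each step branches into two, hence \<open>2 * C1\<close>.\<close>

lemma mean_norm_le_sigma:
  assumes "k \<le> n" "R \<subseteq> {Suc k..n}" "C \<subseteq> {Suc k..n}"
    and "\<And>U. U \<subseteq> {1..k} \<Longrightarrow> flattening_norm n D T (R \<union> U) (C \<union> ({1..k} - U)) \<le> s"
  shows "mean_norm k R C \<le> (2 * C1 * ap) ^ k * s"
  using assms
proof (induction k arbitrary: R C)
  case 0
  then show ?case using "0.prems"(4)[of "{}"] by (simp add: mean_norm_0)
next
  case (Suc k)
  have sub: "R \<subseteq> {1..n}" "C \<subseteq> {1..n}" "Suc k \<notin> R" "Suc k \<notin> C" using Suc.prems by auto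
  have K: "{Suc 0..Suc k} = insert (Suc k) {Suc 0..k}" by auto
  have r: "mean_norm k R (insert (Suc k) C) \<le> (2 * C1 * ap) ^ k * s"
  proof (rule Suc.IH)
    show "flattening_norm n D T (R \<union> U) (insert (Suc k) C \<union> ({1..k} - U)) \<le> s" if "U \<subseteq> {1..k}" for U
      using that by (intro partition_insert(2) Suc.prems(4))
  qed (use Suc.prems in auto)
  have c: "mean_norm k (insert (Suc k) R) C \<le> (2 * C1 * ap) ^ k * s"
  proof (rule Suc.IH)
    show "flattening_norm n D T (insert (Suc k) R \<union> U) (C \<union> ({1..k} - U)) \<le> s" if "U \<subseteq> {1..k}" for U
      using that by (intro partition_insert(1) Suc.prems(4))
  qed (use Suc.prems in auto)
  have "mean_norm (Suc k) R C
      \<le> C1 * ap * (mean_norm k R (insert (Suc k) C) + mean_norm k (insert (Suc k) R) C)"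
    by (rule mean_norm_step(1)[OF Suc.prems(1) sub])
  also have "\<dots> \<le> C1 * ap * ((2 * C1 * ap) ^ k * s + (2 * C1 * ap) ^ k * s)"
    using constants by (intro mult_left_mono add_mono r c) auto
  finally show ?case by (simp add: algebra_simps)
qed

text \<open>Once \<open>Suc k\<close> lies on both sides, every distribution of the other positions
  overlaps, so the crude recursion can run with \<open>s = \<rho>\<close> and never produces a
  remainder.\<close>

lemma mean_norm_both_le:
  assumes "Suc k \<le> n" "R \<subseteq> {Suc (Suc k)..n}" "C \<subseteq> {Suc (Suc k)..n}"
    and \<rho>: "\<And>U V. U \<union> V = {1..Suc k} \<Longrightarrow> U \<inter> V \<noteq> {} \<Longrightarrow> flattening_norm n D T (R \<union> U) (C \<union> V) \<le> \<rho>"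
  shows "mean_norm k (insert (Suc k) R) (insert (Suc k) C) \<le> (2 * C1 * ap) ^ k * \<rho>"
proof (rule mean_norm_le_sigma)
  fix U assume U: "U \<subseteq> {1..k}"
  have "insert (Suc k) R \<union> U = R \<union> insert (Suc k) U"
    "insert (Suc k) C \<union> ({1..k} - U) = C \<union> insert (Suc k) ({1..k} - U)" by auto
  moreover have "insert (Suc k) U \<union> insert (Suc k) ({1..k} - U) = {1..Suc k}" using U by auto
  ultimately show "flattening_norm n D T (insert (Suc k) R \<union> U) (insert (Suc k) C \<union> ({1..k} - U)) \<le> \<rho>"
    using \<rho>[of "insert (Suc k) U" "insert (Suc k) ({1..k} - U)"] by auto
qed (use assms in auto)

lemma overlap_insert:
  assumes \<rho>: "\<And>U V. U \<union> V = {1..Suc k} \<Longrightarrow> U \<inter> V \<noteq> {} \<Longrightarrow> flattening_norm n D T (R \<union> U) (C \<union> V) \<le> \<rho>"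
    and UV: "U \<union> V = {1..k}" "U \<inter> V \<noteq> {}"
  shows "flattening_norm n D T (insert (Suc k) R \<union> U) (C \<union> V) \<le> \<rho>"
    and "flattening_norm n D T (R \<union> U) (insert (Suc k) C \<union> V) \<le> \<rho>"
proof -
  have K: "{Suc 0..Suc k} = insert (Suc k) {Suc 0..k}" by auto
  have "insert (Suc k) R \<union> U = R \<union> insert (Suc k) U" by auto
  then show "flattening_norm n D T (insert (Suc k) R \<union> U) (C \<union> V) \<le> \<rho>"
    using \<rho>[of "insert (Suc k) U" V] UV K by auto
  have "insert (Suc k) C \<union> V = C \<union> insert (Suc k) V" by auto
  then show "flattening_norm n D T (R \<union> U) (insert (Suc k) C \<union> V) \<le> \<rho>"
    using \<rho>[of U "insert (Suc k) V"] UV K by auto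
qed

text \<open>Up to constants, a step adds the remainder
  \<open>a * p * (a * sqrt p) ^ k * \<rho>\<close>, which is
  \<open>a ^ Suc k * sqrt p ^ Suc (Suc k) * \<rho>\<close>. Inherited remainders only gain a factor
  \<open>sqrt p\<close>, and \<open>a \<ge> 1\<close> lets them take the same form.\<close>

lemma mean_norm_upper:
  assumes "k \<le> n" "R \<subseteq> {Suc k..n}" "C \<subseteq> {Suc k..n}" and s0: "0 \<le> s" and \<rho>0: "0 \<le> \<rho>"
    and "\<And>U. U \<subseteq> {1..k} \<Longrightarrow> flattening_norm n D T (R \<union> U) (C \<union> ({1..k} - U)) \<le> s"
    and "\<And>U V. U \<union> V = {1..k} \<Longrightarrow> U \<inter> V \<noteq> {} \<Longrightarrow> flattening_norm n D T (R \<union> U) (C \<union> V) \<le> \<rho>"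
  shows "mean_norm k R C \<le> (4 * C1) ^ k * (sqrt p ^ k * s + a ^ k * sqrt p ^ Suc k * \<rho>)"
  using assms(1-3,6,7)
proof (induction k arbitrary: R C)
  case 0
  have "mean_norm 0 R C \<le> s" using "0.prems"(4)[of "{}"] by (simp add: mean_norm_0)
  moreover have "0 \<le> sqrt p * \<rho>" using \<rho>0 p by simp
  ultimately show ?case by simp
next
  case (Suc k)
  let ?B = "(4 * C1) ^ k * (sqrt p ^ k * s + a ^ k * sqrt p ^ Suc k * \<rho>)"
  have sub: "R \<subseteq> {1..n}" "C \<subseteq> {1..n}" "Suc k \<notin> R" "Suc k \<notin> C" using Suc.prems by auto
  have K: "{Suc 0..Suc k} = insert (Suc k) {Suc 0..k}" by auto
  have r: "mean_norm k R (insert (Suc k) C) \<le> ?B"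
  proof (rule Suc.IH)
    show "flattening_norm n D T (R \<union> U) (insert (Suc k) C \<union> ({1..k} - U)) \<le> s" if "U \<subseteq> {1..k}" for U
      using that by (intro partition_insert(2) Suc.prems(4))
  next
    show "flattening_norm n D T (R \<union> U) (insert (Suc k) C \<union> V) \<le> \<rho>"
      if "U \<union> V = {1..k}" "U \<inter> V \<noteq> {}" for U V
      using that by (intro overlap_insert(2) Suc.prems(5))
  qed (use Suc.prems in auto)
  have c: "mean_norm k (insert (Suc k) R) C \<le> ?B"
  proof (rule Suc.IH)
    show "flattening_norm n D T (insert (Suc k) R \<union> U) (C \<union> ({1..k} - U)) \<le> s" if "U \<subseteq> {1..k}" for U
      using that by (intro partition_insert(1) Suc.prems(4))
  next
    show "flattening_norm n D T (insert (Suc k) R \<union> U) (C \<union> V) \<le> \<rho>"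
      if "U \<union> V = {1..k}" "U \<inter> V \<noteq> {}" for U V
      using that by (intro overlap_insert(1) Suc.prems(5))
  qed (use Suc.prems in auto)
  have b: "mean_norm k (insert (Suc k) R) (insert (Suc k) C) \<le> (2 * C1 * ap) ^ k * \<rho>"
    using Suc.prems(2,3) by (intro mean_norm_both_le Suc.prems(1,5)) auto
  define X where "X = sqrt p ^ Suc k * s"
  define Z where "Z = a ^ k * sqrt p ^ Suc (Suc k) * \<rho>"
  have XZ: "0 \<le> X" "0 \<le> Z" using a p s0 \<rho>0 by (auto simp: X_def Z_def)
  have "mean_norm (Suc k) R C
      \<le> C1 * (sqrt p * (mean_norm k R (insert (Suc k) C) + mean_norm k (insert (Suc k) R) C)
        + a * (sqrt p)\<^sup>2 * mean_norm k (insert (Suc k) R) (insert (Suc k) C))"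
    by (rule mean_norm_step(2)[OF Suc.prems(1) sub])
  also have "\<dots> \<le> C1 * (sqrt p * (?B + ?B) + a * (sqrt p)\<^sup>2 * ((2 * C1 * ap) ^ k * \<rho>))"
    using constants a p by (intro mult_left_mono add_mono r c b) auto
  also have "\<dots> = 2 * C1 * (4 * C1) ^ k * (X + Z) + C1 * (2 * C1) ^ k * (a * Z)"
    by (simp add: X_def Z_def algebra_simps power_mult_distrib power2_eq_square)
  also have "\<dots> \<le> 2 * C1 * (4 * C1) ^ k * (X + a * Z) + C1 * (4 * C1) ^ k * (X + a * Z)"
  proof (intro add_mono mult_left_mono mult_mono power_mono)
    show "Z \<le> a * Z" using a XZ mult_right_mono[of 1 a Z] by simp
    show "a * Z \<le> X + a * Z" using XZ by simp
  qed (use constants XZ a in auto)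
  \<comment> \<open>Two inherited copies and one new remainder fit into the factor 4 of
    \<open>(4 * C1) ^ Suc k\<close>.\<close>
  also have "\<dots> = 3 * C1 * (4 * C1) ^ k * (X + a * Z)" by (simp add: algebra_simps)
  also have "\<dots> \<le> (4 * C1) ^ Suc k * (X + a * Z)"
    using constants XZ a by (intro mult_right_mono) auto
  also have "\<dots> = (4 * C1) ^ Suc k * (sqrt p ^ Suc k * s + a ^ Suc k * sqrt p ^ Suc (Suc k) * \<rho>)"
    by (simp add: X_def Z_def mult_ac)
  finally show ?case .
qed

text \<open>The set \<open>U\<close> decides at each position whether the column or the row bound is
  used, so a single partition is followed until all positions are contracted. The remainders have a
  position on both sides and are bounded crudely.\<close>

lemma mean_norm_lower:
  assumes "k \<le> n" "R \<subseteq> {Suc k..n}" "C \<subseteq> {Suc k..n}" and \<rho>0: "0 \<le> \<rho>" and "U \<subseteq> {1..k}"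
    and "\<And>U V. U \<union> V = {1..k} \<Longrightarrow> U \<inter> V \<noteq> {} \<Longrightarrow> flattening_norm n D T (R \<union> U) (C \<union> V) \<le> \<rho>"
  shows "flattening_norm n D T (R \<union> U) (C \<union> ({1..k} - U)) \<le> 4 ^ k * mean_norm k R C + (16 * C1) ^ k * ap ^ k * \<rho>"
  using assms(1-3,5,6)
proof (induction k arbitrary: R C U)
  case 0
  then show ?case using \<rho>0 by (simp add: mean_norm_0)
next
  case (Suc k)
  have sub: "R \<subseteq> {1..n}" "C \<subseteq> {1..n}" "Suc k \<notin> R" "Suc k \<notin> C" using Suc.prems by auto
  have K: "{Suc 0..Suc k} = insert (Suc k) {Suc 0..k}" by auto
  let ?f = "flattening_norm n D T (R \<union> U) (C \<union> ({1..Suc k} - U))"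
  let ?eb = "mean_norm k (insert (Suc k) R) (insert (Suc k) C)"
  have b: "?eb \<le> (2 * C1 * ap) ^ k * \<rho>"
    using Suc.prems(2,3) by (intro mean_norm_both_le Suc.prems(1,5)) auto
  \<comment> \<open>Both branches lead to the same inequality with a different mean norm
    \<open>e\<close>; the existential statement merges them.\<close>
  have step: "\<exists>e. ?f \<le> 4 ^ k * e + (16 * C1) ^ k * ap ^ k * \<rho> \<and> e \<le> 4 * mean_norm (Suc k) R C + C1 * (ap * ?eb)"
  proof (cases "Suc k \<in> U")
    case True
    define W where "W = U - {Suc k}"
    have W: "W \<subseteq> {1..k}" "R \<union> U = insert (Suc k) R \<union> W" "C \<union> ({1..Suc k} - U) = C \<union> ({1..k} - W)"
      using True Suc.prems(4) by (auto simp: W_def K)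
    have "?f \<le> 4 ^ k * mean_norm k (insert (Suc k) R) C + (16 * C1) ^ k * ap ^ k * \<rho>"
      unfolding W(2,3)
    proof (rule Suc.IH)
      show "flattening_norm n D T (insert (Suc k) R \<union> U) (C \<union> V) \<le> \<rho>"
        if "U \<union> V = {1..k}" "U \<inter> V \<noteq> {}" for U V
        using that by (intro overlap_insert(1) Suc.prems(5))
    qed (use Suc.prems W in auto)
    then show ?thesis using mean_norm_step(3)[OF Suc.prems(1) sub] by blast
  next
    case False
    have W: "U \<subseteq> {1..k}" "C \<union> ({1..Suc k} - U) = insert (Suc k) C \<union> ({1..k} - U)"
      using False Suc.prems(4) by (auto simp: K)
    have "?f \<le> 4 ^ k * mean_norm k R (insert (Suc k) C) + (16 * C1) ^ k * ap ^ k * \<rho>"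
      unfolding W(2)
    proof (rule Suc.IH)
      show "flattening_norm n D T (R \<union> U) (insert (Suc k) C \<union> V) \<le> \<rho>"
        if "U \<union> V = {1..k}" "U \<inter> V \<noteq> {}" for U V
        using that by (intro overlap_insert(2) Suc.prems(5))
    qed (use Suc.prems W in auto)
    then show ?thesis using mean_norm_step(4)[OF Suc.prems(1) sub] by blast
  qed
  then obtain e where e: "?f \<le> 4 ^ k * e + (16 * C1) ^ k * ap ^ k * \<rho>"
    "e \<le> 4 * mean_norm (Suc k) R C + C1 * (ap * ?eb)" by blast
  define Z where "Z = ap ^ Suc k * \<rho>"
  have Z: "0 \<le> Z" using constants \<rho>0 by (simp add: Z_def)
  have "?f \<le> 4 ^ k * (4 * mean_norm (Suc k) R C + C1 * (ap * ((2 * C1 * ap) ^ k * \<rho>))) + (16 * C1) ^ k * ap ^ k * \<rho>"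
  proof -
    have "C1 * (ap * ?eb) \<le> C1 * (ap * ((2 * C1 * ap) ^ k * \<rho>))"
      using constants by (intro mult_left_mono b) auto
    then have "4 ^ k * e \<le> 4 ^ k * (4 * mean_norm (Suc k) R C + C1 * (ap * ((2 * C1 * ap) ^ k * \<rho>)))"
      using e(2) by (intro mult_left_mono) auto
    then show ?thesis using e(1) by linarith
  qed
  also have "\<dots> = 4 ^ Suc k * mean_norm (Suc k) R C + C1 * (8 * C1) ^ k * Z + (16 * C1) ^ k * (ap ^ k * \<rho>)"
  proof -
    have 8: "(8 * C1) ^ k = 4 ^ k * (2 * C1) ^ k" by (subst power_mult_distrib [symmetric]) simp
    have 2: "(2 * C1 * ap) ^ k = (2 * C1) ^ k * ap ^ k" by (rule power_mult_distrib)
    have "f * (4 * M + c * (y * ((u * v) * \<rho>))) + w * v * \<rho> = 4 * f * M + c * (f * u) * (y * v * \<rho>) + w * (v * \<rho>)"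
      for f M c u v w y :: real by (simp add: algebra_simps)
    then show ?thesis unfolding 8 2 Z_def power_Suc .
  qed
  also have "\<dots> \<le> 4 ^ Suc k * mean_norm (Suc k) R C + C1 * (16 * C1) ^ k * Z + C1 * (16 * C1) ^ k * Z"
  proof (intro add_mono order_refl mult_right_mono mult_left_mono power_mono)
    have "ap ^ k \<le> ap ^ Suc k" using constants by (intro power_increasing) auto
    then have "ap ^ k * \<rho> \<le> Z" unfolding Z_def using \<rho>0 by (rule mult_right_mono)
    then show "(16 * C1) ^ k * (ap ^ k * \<rho>) \<le> C1 * (16 * C1) ^ k * Z"
      using constants \<rho>0 by (intro mult_mono) auto
  qed (use constants Z in auto)
  also have "\<dots> = 4 ^ Suc k * mean_norm (Suc k) R C + 2 * C1 * (16 * C1) ^ k * Z" by simp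
  also have "\<dots> \<le> 4 ^ Suc k * mean_norm (Suc k) R C + (16 * C1) ^ Suc k * Z"
    using constants Z by (intro add_left_mono mult_right_mono) auto
  finally show ?case by (simp add: Z_def mult_ac)
qed

end

section \<open>Entries of the tensor and its two parameters\<close>

lemma flattening_norm_nonneg: "0 \<le> flattening_norm n D T R C"
  by (simp add: flattening_norm_def op_norm_nonneg)

text \<open>Because \<open>R \<union> C\<close> covers all positions, a multi-index is determined by
  its two restrictions, so only one term of the sum survives.\<close>

lemma flattening_entry:
  assumes "R \<union> C = {1..n}" "i \<in> multi_indices D {1..n}"
  shows "flattening n D T R C (restrict i R) (restrict i C) = T i"
proof -
  have "flattening n D T R C (restrict i R) (restrict i C)
      = (\<Sum>j\<in>multi_indices D {1..n}. if j = i then T j else 0)"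
    unfolding flattening_def
  proof (intro sum.cong refl)
    fix j assume j: "j \<in> multi_indices D {1..n}"
    have "j = i" if e: "restrict i R = restrict j R" "restrict i C = restrict j C"
    proof (rule PiE_ext[OF j[unfolded multi_indices_def] assms(2)[unfolded multi_indices_def]])
      fix t assume "t \<in> {1..n}"
      then have "t \<in> R \<or> t \<in> C" using assms(1) by blast
      then show "j t = i t"
      proof
        assume "t \<in> R"
        then show ?thesis using fun_cong[OF e(1), of t] by (simp only: restrict_apply')
      next
        assume "t \<in> C"
        then show ?thesis using fun_cong[OF e(2), of t] by (simp only: restrict_apply')
      qed
    qed
    then show "of_bool (restrict i R = restrict j R) * of_bool (restrict i C = restrict j C) * T j
        = (if j = i then T j else 0)" by auto
  qed
  also have "\<dots> = T i" using assms(2) finite_multi_indices[of "{1..n}" D] by simp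
  finally show ?thesis .
qed

lemma abs_entry_le_op_norm:
  assumes "finite I" "finite J" "i \<in> I" "j \<in> J"
  shows "\<bar>B i j\<bar> \<le> op_norm I J B"
proof -
  let ?x = "\<lambda>l. of_bool (l = j) :: real"
  have "(\<Sum>l\<in>J. (?x l)\<^sup>2) = (\<Sum>l\<in>J. if l = j then 1 else 0)" by (intro sum.cong) auto
  then have x: "L2_set ?x J = 1" using assms by (simp add: L2_set_def)
  have "mat_vec J B ?x i = (\<Sum>l\<in>J. if l = j then B i l else 0)" for i by (intro sum.cong) auto
  then have mv: "mat_vec J B ?x i = B i j" for i using assms by simp
  have "\<bar>B i j\<bar> \<le> L2_set (\<lambda>i. \<bar>mat_vec J B ?x i\<bar>) I"
    using member_le_L2_set[OF assms(1,3), of "\<lambda>i. \<bar>mat_vec J B ?x i\<bar>"] unfolding mv .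
  also have "\<dots> = L2_set (mat_vec J B ?x) I" by (simp add: L2_set_def)
  also have "\<dots> \<le> op_norm I J B * L2_set ?x J" by (rule L2_set_mat_vec_le_op_norm)
  finally show ?thesis unfolding x by simp
qed

lemma abs_le_flattening_norm:
  assumes "R \<union> C = {1..n}" "i \<in> multi_indices D {1..n}"
  shows "\<bar>T i\<bar> \<le> flattening_norm n D T R C"
proof -
  have "finite (R \<union> C)" unfolding assms(1) by simp
  moreover have "restrict i R \<in> multi_indices D R" "restrict i C \<in> multi_indices D C"
    using assms by (auto simp: multi_indices_def restrict_PiE_iff)
  ultimately show ?thesis
    using abs_entry_le_op_norm[of "multi_indices D R" "multi_indices D C" "restrict i R" "restrict i C"
        "flattening n D T R C"] finite_multi_indices[of R D] finite_multi_indices[of C D]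
    unfolding flattening_norm_def flattening_entry[OF assms] by auto
qed

lemma flattening_norm_zero:
  assumes "\<And>i. i \<in> multi_indices D {1..n} \<Longrightarrow> T i = 0"
  shows "flattening_norm n D T R C = 0"
proof -
  have "flattening n D T R C = (\<lambda>r c. 0)" using assms by (simp add: flattening_def fun_eq_iff)
  then show ?thesis using op_norm_scale[of _ _ 0 "\<lambda>r c. 0"] by (simp add: flattening_norm_def)
qed

context
  fixes q m d1 d2 :: nat and A :: "(nat \<Rightarrow> nat) \<Rightarrow> nat \<Rightarrow> nat \<Rightarrow> real"
begin

abbreviation (input) cfn :: "nat set \<Rightarrow> nat set \<Rightarrow> real" where
  "cfn R C \<equiv> flattening_norm (q + 2) (chaos_dim q m d1 d2) (coeff_tensor q A) R C"

lemma finite_cfn_set: "finite {cfn R C | R C. R \<subseteq> {1..q + 2} \<and> C \<subseteq> {1..q + 2}}"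
proof (rule finite_subset)
  show "{cfn R C | R C. R \<subseteq> {1..q + 2} \<and> C \<subseteq> {1..q + 2}}
      \<subseteq> (\<lambda>(R, C). cfn R C) ` (Pow {1..q + 2} \<times> Pow {1..q + 2})" by auto
qed simp

lemma positions: "{1..q + 2} = insert (q + 1) (insert (q + 2) {1..q})"
  by auto

lemma positions': "{Suc 0..Suc (Suc q)} = insert (Suc q) (insert (Suc (Suc q)) {Suc 0..q})"
  by auto

text \<open>Parametrising by \<open>U\<close>, the positions of \<open>{1..q}\<close> sent to the
  rows, gives the form in which the induction enumerates partitions.\<close>

lemma sigma_set_eq:
  "{cfn R C | R C. C \<subseteq> {1..q + 2} \<and> R = {1..q + 2} - C \<and> q + 1 \<in> R \<and> q + 2 \<in> C}
    = {cfn ({q + 1} \<union> U) ({q + 2} \<union> ({1..q} - U)) | U. U \<subseteq> {1..q}}" (is "?L = ?R")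
proof (intro antisym subsetI)
  fix x assume "x \<in> ?L"
  then obtain C where C: "C \<subseteq> {1..q + 2}" "q + 1 \<notin> C" "q + 2 \<in> C" "x = cfn ({1..q + 2} - C) C" by auto
  let ?U = "{1..q} - C"
  have e: "{1..q + 2} - C = {q + 1} \<union> ?U" "C = {q + 2} \<union> ({1..q} - ?U)"
    using C(1-3) unfolding positions by blast+
  have "x = cfn ({q + 1} \<union> ?U) ({q + 2} \<union> ({1..q} - ?U))"
    by (rule trans[OF C(4) arg_cong2[where f = "\<lambda>R C. cfn R C", OF e]])
  then show "x \<in> ?R" by blast
next
  fix x assume "x \<in> ?R"
  then obtain U where U: "U \<subseteq> {1..q}" "x = cfn ({q + 1} \<union> U) ({q + 2} \<union> ({1..q} - U))" by auto
  let ?C = "{q + 2} \<union> ({1..q} - U)"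
  have q: "q + 1 \<notin> {1..q}" "q + 2 \<notin> {1..q}" "q + 1 \<noteq> q + 2" by auto
  have "{u} \<union> U = insert u (insert v S) - ({v} \<union> (S - U))"
    if "u \<notin> S" "v \<notin> S" "u \<noteq> v" "U \<subseteq> S" for u v :: nat and U S
    using that by auto
  from this[OF q U(1)] have "{q + 1} \<union> U = {1..q + 2} - ?C" unfolding positions .
  moreover have "?C \<subseteq> {1..q + 2}" unfolding positions by blast
  ultimately have "?C \<subseteq> {1..q + 2}" "{q + 1} \<union> U = {1..q + 2} - ?C" by simp_all
  then show "x \<in> ?L" unfolding U(2)
    by (intro CollectI exI[of _ "{q + 1} \<union> U"] exI[of _ ?C] conjI) simp_all
qed

lemma finite_sigma_set: "finite {cfn ({q + 1} \<union> U) ({q + 2} \<union> ({1..q} - U)) | U. U \<subseteq> {1..q}}"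
proof -
  have "{cfn ({q + 1} \<union> U) ({q + 2} \<union> ({1..q} - U)) | U. U \<subseteq> {1..q}}
      = (\<lambda>U. cfn ({q + 1} \<union> U) ({q + 2} \<union> ({1..q} - U))) ` Pow {1..q}" by auto
  then show ?thesis by simp
qed

lemma chaos_sigma_ge: "U \<subseteq> {1..q} \<Longrightarrow> cfn ({q + 1} \<union> U) ({q + 2} \<union> ({1..q} - U)) \<le> chaos_sigma q m d1 d2 A"
  unfolding chaos_sigma_def sigma_set_eq by (intro Max_ge finite_sigma_set) auto

lemma chaos_sigma_attained:
  obtains U where "U \<subseteq> {1..q}" "chaos_sigma q m d1 d2 A = cfn ({q + 1} \<union> U) ({q + 2} \<union> ({1..q} - U))"
proof -
  have "chaos_sigma q m d1 d2 A \<in> {cfn ({q + 1} \<union> U) ({q + 2} \<union> ({1..q} - U)) | U. U \<subseteq> {1..q}}"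
    unfolding chaos_sigma_def sigma_set_eq by (intro Max_in finite_sigma_set) auto
  then show ?thesis using that by auto
qed

lemma chaos_r_ge:
  assumes "U \<union> V = {1..q}" "U \<inter> V \<noteq> {}"
  shows "cfn ({q + 1} \<union> U) ({q + 2} \<union> V) \<le> chaos_r q m d1 d2 A"
  unfolding chaos_r_def
proof (rule Max_ge)
  show "finite {cfn R C | R C. R \<union> C = {1..q + 2} \<and> q + 1 \<in> R \<and> q + 2 \<in> C \<and> R \<inter> C \<noteq> {} \<and> R \<inter> C \<subseteq> {1..q}}"
    by (rule finite_subset[OF _ finite_cfn_set]) blast
  have "U \<subseteq> {1..q}" "V \<subseteq> {1..q}" using assms by auto
  have q: "q + 1 \<notin> {1..q}" "q + 2 \<notin> {1..q}" "q + 1 \<noteq> q + 2" by auto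
  have u1: "({q + 1} \<union> U) \<union> ({q + 2} \<union> V) = {1..q + 2}" using assms(1) unfolding positions by blast
  have u2: "({q + 1} \<union> U) \<inter> ({q + 2} \<union> V) = U \<inter> V"
    using \<open>U \<subseteq> _\<close> \<open>V \<subseteq> _\<close> q by blast
  have u3: "U \<inter> V \<subseteq> {1..q}" using \<open>U \<subseteq> _\<close> by blast
  show "cfn ({q + 1} \<union> U) ({q + 2} \<union> V) \<in> {cfn R C | R C. R \<union> C = {1..q + 2} \<and> q + 1 \<in> R \<and> q + 2 \<in> C
      \<and> R \<inter> C \<noteq> {} \<and> R \<inter> C \<subseteq> {1..q}}"
    by (rule CollectI, rule exI[of _ "{q + 1} \<union> U"], rule exI[of _ "{q + 2} \<union> V"], intro conjI refl u1,
        unfold u2) (use assms(2) u3 in blast)+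
qed

text \<open>Consequently \<open>chaos_r = 0\<close> forces the whole tensor to vanish, which settles
  the case of an infinite moment.\<close>

lemma chaos_r_ge_abs:
  assumes "q \<ge> 1" "i \<in> multi_indices (chaos_dim q m d1 d2) {1..q + 2}"
  shows "\<bar>coeff_tensor q A i\<bar> \<le> chaos_r q m d1 d2 A"
proof -
  have "({q + 1} \<union> {1..q}) \<union> ({q + 2} \<union> {1..q}) = {1..q + 2}" by (auto simp: positions')
  from abs_le_flattening_norm[OF this assms(2), of "coeff_tensor q A"]
  show ?thesis using chaos_r_ge[of "{1..q}" "{1..q}"] assms(1) by auto
qed

lemma chaos_sigma_nonneg: "0 \<le> chaos_sigma q m d1 d2 A"
  using chaos_sigma_ge[of "{}"] flattening_norm_nonneg order_trans by blast

lemma chaos_r_nonneg: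
  assumes "q \<ge> 1"
  shows "0 \<le> chaos_r q m d1 d2 A"
proof -
  have "cfn ({q + 1} \<union> {1..q}) ({q + 2} \<union> {1..q}) \<le> chaos_r q m d1 d2 A"
    using assms by (intro chaos_r_ge) auto
  then show ?thesis by (rule order_trans[OF flattening_norm_nonneg])
qed

section \<open>The chaos as a fully contracted flattening\<close>

lemma chaos_index_upd:
  assumes "i \<in> multi_indices (\<lambda>_. m) {1..q}" "j \<in> {1..d1}" "l \<in> {1..d2}"
  shows "i(q + 1 := j, q + 2 := l) \<in> multi_indices (chaos_dim q m d1 d2) {1..q + 2}"
proof -
  have "multi_indices (\<lambda>_. m) {1..q} = multi_indices (chaos_dim q m d1 d2) {1..q}"
    unfolding multi_indices_def by (intro PiE_cong) (auto simp: chaos_dim_def)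
  then have "i(q + 1 := j, q + 2 := l) \<in> multi_indices (chaos_dim q m d1 d2) (insert (q + 2) (insert (q + 1) {1..q}))"
    using assms by (intro multi_indices_upd) (auto simp: chaos_dim_def)
  then show ?thesis by (simp only: positions insert_commute)
qed

lemma matrix_chaos_eq_flattening:
  assumes j: "j \<in> {1..d1}" and l: "l \<in> {1..d2}"
  shows "matrix_chaos q m H A \<omega> j l
    = flattening (q + 2) (chaos_dim q m d1 d2) (\<lambda>i. coeff_tensor q A i * (\<Prod>t\<in>{1..q}. H t (i t) \<omega>)) {q + 1} {q + 2}
        (\<lambda>t\<in>{q + 1}. j) (\<lambda>t\<in>{q + 2}. l)"
proof -
  let ?M = "multi_indices (chaos_dim q m d1 d2) {1..q + 2}" and ?M' = "multi_indices (\<lambda>_. m) {1..q}"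
  let ?F = "\<lambda>i. coeff_tensor q A i * (\<Prod>t\<in>{1..q}. H t (i t) \<omega>)"
  have iff: "(\<lambda>t\<in>{u}. x) = restrict i {u} \<longleftrightarrow> i u = x" for u x and i :: "nat \<Rightarrow> nat"
    by (auto simp: fun_eq_iff restrict_def)
  have "flattening (q + 2) (chaos_dim q m d1 d2) ?F {q + 1} {q + 2} (\<lambda>t\<in>{q + 1}. j) (\<lambda>t\<in>{q + 2}. l)
      = (\<Sum>i\<in>?M. if i (q + 1) = j \<and> i (q + 2) = l then ?F i else 0)"
    unfolding flattening_def iff by (intro sum.cong) auto
  also have "\<dots> = (\<Sum>i\<in>{i\<in>?M. i (q + 1) = j \<and> i (q + 2) = l}. ?F i)"
    by (rule sum.inter_filter[symmetric, OF finite_multi_indices]) simp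
  also have "\<dots> = (\<Sum>i\<in>?M'. (\<Prod>t\<in>{1..q}. H t (i t) \<omega>) * A i j l)"
  proof (rule sum.reindex_bij_witness[where i = "\<lambda>i. i(q + 1 := j, q + 2 := l)" and j = "\<lambda>i. restrict i {1..q}"])
    fix i assume i: "i \<in> {i\<in>?M. i (q + 1) = j \<and> i (q + 2) = l}"
    then have mem: "i t \<in> {1..chaos_dim q m d1 d2 t}" if "t \<in> {1..q + 2}" for t
      using that unfolding multi_indices_def by (blast intro: PiE_mem)
    have arb: "i t = undefined" if "t \<notin> {1..q + 2}" for t
      using i that unfolding multi_indices_def by (blast intro: PiE_arb)
    show "(restrict i {1..q})(q + 1 := j, q + 2 := l) = i"
    proof
      fix t
      consider "t = q + 1" | "t = q + 2" | "t \<in> {1..q}" | "t \<notin> {1..q + 2}" by (auto simp: positions')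
      then show "((restrict i {1..q})(q + 1 := j, q + 2 := l)) t = i t"
        using i arb[of t] by cases (auto simp: positions')
    qed
    show "restrict i {1..q} \<in> ?M'"
      unfolding multi_indices_def
    proof (rule restrict_PiE_iff[THEN iffD2], rule ballI)
      fix t assume "t \<in> {1..q}"
      then show "i t \<in> {1..m}" using mem[of t] by (simp add: chaos_dim_def)
    qed
    show "(\<Prod>t\<in>{1..q}. H t (restrict i {1..q} t) \<omega>) * A (restrict i {1..q}) j l = ?F i"
      using i by (simp add: coeff_tensor_def mult.commute)
  next
    fix i assume i: "i \<in> ?M'"
    then have arb: "i t = undefined" if "t \<notin> {1..q}" for t
      using that unfolding multi_indices_def by (blast intro: PiE_arb)
    show "restrict (i(q + 1 := j, q + 2 := l)) {1..q} = i"
    proof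
      fix t show "restrict (i(q + 1 := j, q + 2 := l)) {1..q} t = i t"
        using arb[of t] by (cases "t \<in> {1..q}") auto
    qed
    show "i(q + 1 := j, q + 2 := l) \<in> {i\<in>?M. i (q + 1) = j \<and> i (q + 2) = l}"
      using chaos_index_upd[OF i j l] by simp
  qed
  finally show ?thesis by (simp add: matrix_chaos_def)
qed

lemma op_norm_matrix_chaos:
  "op_norm {1..d1} {1..d2} (matrix_chaos q m H A \<omega>)
    = op_norm (multi_indices (chaos_dim q m d1 d2) {q + 1}) (multi_indices (chaos_dim q m d1 d2) {q + 2})
        (flattening (q + 2) (chaos_dim q m d1 d2)
          (\<lambda>i. coeff_tensor q A i * (\<Prod>t\<in>{1..q}. H t (i t) \<omega>)) {q + 1} {q + 2})"
proof (rule op_norm_reindex)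
  have b: "bij_betw (\<lambda>x. \<lambda>t\<in>{u}. x) {1..D u} (multi_indices D {u})" for u and D :: "nat \<Rightarrow> nat"
  proof (rule bij_betwI[where g = "\<lambda>i. i u"])
    show "(\<lambda>t\<in>{u}. i u) = i" if "i \<in> multi_indices D {u}" for i
    proof
      fix t
      have "t \<noteq> u \<Longrightarrow> i t = undefined" using that unfolding multi_indices_def by (blast intro: PiE_arb)
      then show "(\<lambda>t\<in>{u}. i u) t = i t" by auto
    qed
    show "(\<lambda>i. i u) \<in> multi_indices D {u} \<rightarrow> {1..D u}"
      unfolding multi_indices_def by (blast intro: PiE_mem)
    show "(\<lambda>x. \<lambda>t\<in>{u}. x) \<in> {1..D u} \<rightarrow> multi_indices D {u}"
      unfolding multi_indices_def by (auto simp: restrict_PiE_iff)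
  qed simp
  show "bij_betw (\<lambda>x. \<lambda>t\<in>{q + 1}. x) {1..d1} (multi_indices (chaos_dim q m d1 d2) {q + 1})"
    using b[where u = "q + 1" and D = "chaos_dim q m d1 d2"] by (simp add: chaos_dim_def)
  show "bij_betw (\<lambda>x. \<lambda>t\<in>{q + 2}. x) {1..d2} (multi_indices (chaos_dim q m d1 d2) {q + 2})"
    using b[where u = "q + 2" and D = "chaos_dim q m d1 d2"] by (simp add: chaos_dim_def)
  fix j l assume "j \<in> {1..d1}" "l \<in> {1..d2}"
  then show "matrix_chaos q m H A \<omega> j l
    = flattening (q + 2) (chaos_dim q m d1 d2) (\<lambda>i. coeff_tensor q A i * (\<Prod>t\<in>{1..q}. H t (i t) \<omega>)) {q + 1} {q + 2}
        (\<lambda>t\<in>{q + 1}. j) (\<lambda>t\<in>{q + 2}. l)"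
    by (rule matrix_chaos_eq_flattening)
qed (auto intro: finite_multi_indices)

end

section \<open>The theorem\<close>

text \<open>Transfer from the given sample space: independence and equality of the laws say that the
  joint law of the family is the product measure used so far.\<close>

lemma expectation_op_norm_matrix_chaos:
  fixes M :: "'w measure" and H :: "nat \<Rightarrow> nat \<Rightarrow> 'w \<Rightarrow> real"
  assumes M: "prob_space M" and h: "h \<in> borel_measurable M" and iid: "iid_copies M q m h H"
    and q: "q \<ge> 1" and m: "m \<ge> 1"
    and tc: "tensor_chaos (distr M borel h) p a (q + 2) (chaos_dim q m d1 d2)"
  shows "(\<integral>\<omega>. op_norm {1..d1} {1..d2} (matrix_chaos q m H A \<omega>) \<partial>M)
    = tensor_chaos.mean_norm (distr M borel h) (q + 2) (chaos_dim q m d1 d2) (coeff_tensor q A) q {q + 1} {q + 2}"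
proof -
  interpret M: prob_space M by fact
  let ?D = "chaos_dim q m d1 d2"
  interpret tensor_chaos "distr M borel h" p a "q + 2" ?D "coeff_tensor q A" by fact
  let ?I = "{1..q} \<times> {1..m}"
  let ?X = "\<lambda>s. H (fst s) (snd s)"
  have I: "idx q = ?I"
    unfolding idx_def by (intro Sigma_cong refl) (auto simp: chaos_dim_def)
  have ne: "?I \<noteq> {}" using q m by auto
  have ind: "M.indep_vars (\<lambda>_. borel) ?X ?I"
    using iid by (simp add: iid_copies_def case_prod_beta')
  then have rv: "?X s \<in> borel_measurable M" if "s \<in> ?I" for s
    using that unfolding M.indep_vars_def by auto
  have "distr M (Pi\<^sub>M ?I (\<lambda>_. borel)) (\<lambda>x. \<lambda>s\<in>?I. ?X s x) = Pi\<^sub>M ?I (\<lambda>s. distr M borel (?X s))"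
    using M.indep_vars_iff_distr_eq_PiM'[OF ne, where M' = "\<lambda>_. borel" and X = ?X] rv ind by blast
  also have "\<dots> = PM (idx q)"
    unfolding I using iid by (intro PiM_cong refl) (auto simp: iid_copies_def)
  finally have d: "distr M (Pi\<^sub>M ?I (\<lambda>_. borel)) (\<lambda>x. \<lambda>s\<in>?I. ?X s x) = PM (idx q)" .
  have meas: "(\<lambda>x. \<lambda>s\<in>?I. ?X s x) \<in> measurable M (Pi\<^sub>M ?I (\<lambda>_. borel))"
    by (intro measurable_restrict rv)
  have sets: "sets (Pi\<^sub>M ?I (\<lambda>_. borel)) = sets (PM (idx q))"
    unfolding I by (intro sets_PiM_cong refl) simp
  have "integrable (PM (idx q)) (partial_norm q {q + 1} {q + 2})"
    by (intro integrable_partial_norm) auto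
  then have "partial_norm q {q + 1} {q + 2} \<in> borel_measurable (Pi\<^sub>M ?I (\<lambda>_. borel))"
    using measurable_cong_sets[OF sets refl] by (metis borel_measurable_integrable)
  from integral_distr[OF meas this]
  have "mean_norm q {q + 1} {q + 2} = (\<integral>\<omega>. partial_norm q {q + 1} {q + 2} (\<lambda>s\<in>?I. ?X s \<omega>) \<partial>M)"
    unfolding d mean_norm_def .
  also have "\<dots> = (\<integral>\<omega>. op_norm {1..d1} {1..d2} (matrix_chaos q m H A \<omega>) \<partial>M)"
  proof (rule Bochner_Integration.integral_cong[OF refl])
    fix \<omega>
    have "flattening (q + 2) ?D (\<lambda>i. coeff_tensor q A i * wt q (\<lambda>s\<in>?I. ?X s \<omega>) i) {q + 1} {q + 2}
        = flattening (q + 2) ?D (\<lambda>i. coeff_tensor q A i * (\<Prod>t\<in>{1..q}. H t (i t) \<omega>)) {q + 1} {q + 2}"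
      unfolding flattening_def
    proof (intro ext sum.cong refl)
      fix r c i assume i: "i \<in> multi_indices ?D {1..q + 2}"
      have "wt q (\<lambda>s\<in>?I. ?X s \<omega>) i = (\<Prod>t\<in>{1..q}. H t (i t) \<omega>)"
        unfolding wt_def
      proof (intro prod.cong refl)
        fix t assume t: "t \<in> {1..q}"
        then have "i t \<in> {1..?D t}" by (intro PiE_mem[OF i[unfolded multi_indices_def]]) simp
        then have "(t, i t) \<in> ?I" using t by (simp add: chaos_dim_def)
        then show "(\<lambda>s\<in>?I. ?X s \<omega>) (t, i t) = H t (i t) \<omega>" by simp
      qed
      then show "of_bool (r = restrict i {q + 1}) * of_bool (c = restrict i {q + 2})
            * (coeff_tensor q A i * wt q (\<lambda>s\<in>?I. ?X s \<omega>) i)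
          = of_bool (r = restrict i {q + 1}) * of_bool (c = restrict i {q + 2})
            * (coeff_tensor q A i * (\<Prod>t\<in>{1..q}. H t (i t) \<omega>))" by simp
    qed
    then show "partial_norm q {q + 1} {q + 2} (\<lambda>s\<in>?I. ?X s \<omega>) = op_norm {1..d1} {1..d2} (matrix_chaos q m H A \<omega>)"
      unfolding partial_norm_def op_norm_matrix_chaos by simp
  qed
  finally show ?thesis by simp
qed

lemma chaos_bounds:
  fixes M :: "'w measure" and H :: "nat \<Rightarrow> nat \<Rightarrow> 'w \<Rightarrow> real"
    and A :: "(nat \<Rightarrow> nat) \<Rightarrow> nat \<Rightarrow> nat \<Rightarrow> real"
  assumes M: "prob_space M" and h: "h \<in> borel_measurable M" and iid: "iid_copies M q m h H"
    and q: "q \<ge> 1" and m: "m \<ge> 1"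
    and tc: "tensor_chaos (distr M borel h) p a (q + 2) (chaos_dim q m d1 d2)"
  defines "EY \<equiv> (\<integral>\<omega>. op_norm {1..d1} {1..d2} (matrix_chaos q m H A \<omega>) \<partial>M)"
    and "\<sigma> \<equiv> chaos_sigma q m d1 d2 A" and "r \<equiv> chaos_r q m d1 d2 A" and "B \<equiv> step_const (real (q + 2))"
  shows "EY \<le> (2 * B * (a * sqrt p)) ^ q * \<sigma>"
    and "EY \<le> (4 * B) ^ q * (sqrt p ^ q * \<sigma> + a ^ q * sqrt p ^ Suc q * r)"
    and "\<sigma> \<le> 4 ^ q * EY + (16 * B) ^ q * (a * sqrt p) ^ q * r"
proof -
  let ?D = "chaos_dim q m d1 d2"
  interpret tensor_chaos "distr M borel h" p a "q + 2" ?D "coeff_tensor q A" by fact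
  have E: "EY = mean_norm q {q + 1} {q + 2}"
    unfolding EY_def by (rule expectation_op_norm_matrix_chaos[OF M h iid q m tc])
  have sub: "q \<le> q + 2" "{q + 1} \<subseteq> {Suc q..q + 2}" "{q + 2} \<subseteq> {Suc q..q + 2}" by auto
  have r0: "0 \<le> r" unfolding r_def by (rule chaos_r_nonneg[OF q])
  have s0: "0 \<le> \<sigma>" unfolding \<sigma>_def by (rule chaos_sigma_nonneg)
  show "EY \<le> (2 * B * (a * sqrt p)) ^ q * \<sigma>"
    unfolding E B_def \<sigma>_def by (rule mean_norm_le_sigma[OF sub chaos_sigma_ge])
  show "EY \<le> (4 * B) ^ q * (sqrt p ^ q * \<sigma> + a ^ q * sqrt p ^ Suc q * r)"
    unfolding E B_def using s0 r0 unfolding \<sigma>_def r_def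
    by (rule mean_norm_upper[OF sub _ _ chaos_sigma_ge chaos_r_ge])
  obtain U where U: "U \<subseteq> {1..q}"
    "\<sigma> = flattening_norm (q + 2) ?D (coeff_tensor q A) ({q + 1} \<union> U) ({q + 2} \<union> ({1..q} - U))"
    unfolding \<sigma>_def by (rule chaos_sigma_attained)
  show "\<sigma> \<le> 4 ^ q * EY + (16 * B) ^ q * (a * sqrt p) ^ q * r"
    unfolding E B_def U(2) using r0 unfolding r_def
    by (rule mean_norm_lower[OF sub _ U(1) chaos_r_ge])
qed

section \<open>Moments of the given variable\<close>

lemma tensor_chaosI:
  fixes M :: "'w measure"
  assumes M: "prob_space M" and h: "h \<in> borel_measurable M"
    and mean: "(\<integral>\<omega>. h \<omega> \<partial>M) = 0" and var: "integrable M (\<lambda>\<omega>. (h \<omega>)\<^sup>2)" "(\<integral>\<omega>. (h \<omega>)\<^sup>2 \<partial>M) = 1"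
    and p: "2 \<le> p" and a: "1 \<le> a"
    and mom: "integrable M (\<lambda>\<omega>. \<bar>h \<omega>\<bar> powr p)" "(\<integral>\<omega>. \<bar>h \<omega>\<bar> powr p \<partial>M) \<le> a powr p"
    and dim: "real (max d1 d2 + m) \<le> exp p"
  shows "tensor_chaos (distr M borel h) p a (q + 2) (chaos_dim q m d1 d2)"
proof -
  interpret M: prob_space M by fact
  interpret mu: prob_space "distr M borel h" by (rule M.prob_space_distr) (use h in simp)
  have ih: "integrable M h" using M.square_integrable_imp_integrable[OF h var(1)] .
  have m: "(\<lambda>y::real. \<bar>y\<bar> powr p) \<in> borel_measurable borel" "(\<lambda>y::real. y\<^sup>2) \<in> borel_measurable borel"
    "(\<lambda>y::real. y) \<in> borel_measurable borel"
    by measurable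
  note tr = integrable_distr_eq[OF h] integral_distr[OF h]
  show ?thesis
  proof unfold_locales
    show "real (chaos_dim q m d1 d2 t) \<le> exp p" for t
    proof -
      have "real (chaos_dim q m d1 d2 t) \<le> real (max d1 d2 + m)"
        unfolding of_nat_le_iff by (auto simp: chaos_dim_def)
      then show ?thesis using dim by (rule order_trans)
    qed
  qed (use ih mean var p a mom in \<open>simp_all add: tr[OF m(1)] tr[OF m(2)] tr[OF m(3)]\<close>)
qed

text \<open>The locale asks for \<open>a \<ge> 1\<close>, which \<open>a = 2 * \<alpha>\<close>
  provides: integrating \<open>(h / K)\<^sup>2 \<le> 1 + |h / K|^p\<close> at
  \<open>K = \<alpha>\<close> gives \<open>1 \<le> 2 * \<alpha>\<^sup>2\<close>.\<close>

lemma Lp_norm_real: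
  assumes M: "prob_space M" and var: "integrable M (\<lambda>\<omega>. (h \<omega>)\<^sup>2)" "(\<integral>\<omega>. (h \<omega>)\<^sup>2 \<partial>M) = 1"
    and p: "2 \<le> p" and int: "integrable M (\<lambda>\<omega>. \<bar>h \<omega>\<bar> powr p)"
  defines "\<alpha> \<equiv> (\<integral>\<omega>. \<bar>h \<omega>\<bar> powr p \<partial>M) powr (1 / p)"
  shows "Lp_norm M p h = ereal \<alpha>" "0 \<le> \<alpha>" "1 \<le> 2 * \<alpha>" "(\<integral>\<omega>. \<bar>h \<omega>\<bar> powr p \<partial>M) \<le> (2 * \<alpha>) powr p"
proof -
  interpret M: prob_space M by fact
  let ?E = "\<integral>\<omega>. \<bar>h \<omega>\<bar> powr p \<partial>M"
  have E0: "0 \<le> ?E" by (simp add: integral_nonneg_AE)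
  show "Lp_norm M p h = ereal \<alpha>" using int by (simp add: Lp_norm_def \<alpha>_def)
  show a0: "0 \<le> \<alpha>" by (simp add: \<alpha>_def)
  have ap: "\<alpha> powr p = ?E" using p E0 by (simp add: \<alpha>_def powr_powr)
  have le: "1 \<le> K\<^sup>2 * (1 + ?E / K powr p)" if K: "K > 0" for K
  proof -
    have pt: "(h \<omega>)\<^sup>2 \<le> K\<^sup>2 * (1 + \<bar>h \<omega>\<bar> powr p / K powr p)" for \<omega>
    proof -
      let ?t = "\<bar>h \<omega>\<bar> / K"
      have "?t\<^sup>2 \<le> 1 + ?t powr p" using K p by (intro sq_le_one_plus_powr) auto
      then have "K\<^sup>2 * ?t\<^sup>2 \<le> K\<^sup>2 * (1 + ?t powr p)" by (intro mult_left_mono) auto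
      then show ?thesis using K by (simp add: power_divide powr_divide)
    qed
    have "1 = (\<integral>\<omega>. (h \<omega>)\<^sup>2 \<partial>M)" using var by simp
    also have "\<dots> \<le> (\<integral>\<omega>. K\<^sup>2 * (1 + \<bar>h \<omega>\<bar> powr p / K powr p) \<partial>M)"
      using var int by (intro integral_mono pt) auto
    also have "\<dots> = K\<^sup>2 * (1 + ?E / K powr p)" using int by (simp add: M.prob_space)
    finally show ?thesis .
  qed
  show a1: "1 \<le> 2 * \<alpha>"
  proof (cases "\<alpha> = 0")
    case True
    then have "?E = 0" using ap p by simp
    \<comment> \<open>With zero moment, \<open>K = 1/2\<close> gives the contradiction
      \<open>1 \<le> 1/4\<close>.\<close>
    then show ?thesis using le[of "1/2"] by (simp add: power2_eq_square)
  next
    case False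
    then have "\<alpha> > 0" using a0 by simp
    then have "1\<^sup>2 \<le> (2 * \<alpha>)\<^sup>2" using le[of \<alpha>] unfolding ap[symmetric] by (simp add: power_mult_distrib)
    from power2_le_imp_le[OF this] show ?thesis using a0 by simp
  qed
  show "?E \<le> (2 * \<alpha>) powr p" unfolding ap[symmetric] using a0 p by (intro powr_mono2) auto
qed

lemma sqrt_power_eq_powr: "0 < L \<Longrightarrow> sqrt L ^ k = L powr (real k / 2)"
  by (simp add: powr_half_sqrt[symmetric] powr_powr flip: powr_realpow)

lemma ereal_top_power: "q \<ge> 1 \<Longrightarrow> (\<infinity> :: ereal) ^ q = \<infinity>"
  by (induction q rule: nat_induct_at_least) auto

text \<open>If the moment is infinite and \<open>r = 0\<close>, the extended-real product of both is
  0, and the theorem claims bounds with zero remainder; they hold because everything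
  vanishes.\<close>

lemma matrix_chaos_zero:
  assumes q: "q \<ge> 1" and r: "chaos_r q m d1 d2 A = 0"
  shows "op_norm {1..d1} {1..d2} (matrix_chaos q m H A \<omega>) = 0" "chaos_sigma q m d1 d2 A = 0"
proof -
  have zero: "coeff_tensor q A i = 0" if "i \<in> multi_indices (chaos_dim q m d1 d2) {1..q + 2}" for i
    using chaos_r_ge_abs[where A = A, OF q that] r by simp
  then show "chaos_sigma q m d1 d2 A = 0"
    using flattening_norm_zero chaos_sigma_attained by metis
  have "op_norm {1..d1} {1..d2} (matrix_chaos q m H A \<omega>)
      = flattening_norm (q + 2) (chaos_dim q m d1 d2) (\<lambda>i. coeff_tensor q A i * (\<Prod>t\<in>{1..q}. H t (i t) \<omega>)) {q + 1} {q + 2}"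
    unfolding op_norm_matrix_chaos flattening_norm_def ..
  also have "\<dots> = 0" by (rule flattening_norm_zero) (simp only: zero mult_zero_left)
  finally show "op_norm {1..d1} {1..d2} (matrix_chaos q m H A \<omega>) = 0" .
qed

theorem theorem2p6:
  fixes q :: nat
  assumes "q \<ge> 1"
  shows "\<exists>c C C' :: real. c > 0 \<and> C > 0 \<and> C' > 0 \<and>
    (\<forall>(m :: nat) (d1 :: nat) (d2 :: nat)
      (M :: (nat \<times> nat \<Rightarrow> real) measure)
      (h :: (nat \<times> nat \<Rightarrow> real) \<Rightarrow> real)
      (H :: nat \<Rightarrow> nat \<Rightarrow> (nat \<times> nat \<Rightarrow> real) \<Rightarrow> real)
      (A :: (nat \<Rightarrow> nat) \<Rightarrow> nat \<Rightarrow> nat \<Rightarrow> real).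
      m \<ge> 1 \<and> d1 \<ge> 1 \<and> d2 \<ge> 1 \<and> prob_space M \<and>
      h \<in> borel_measurable M \<and>
      prob_space.expectation M h = 0 \<and> prob_space.variance M h = 1 \<and>
      iid_copies M q m h H \<longrightarrow>
      (let d = max d1 d2;
           L = ln (real (d + m));
           \<sigma> = chaos_sigma q m d1 d2 A;
           r = chaos_r q m d1 d2 A;
           EY = prob_space.expectation M
                  (\<lambda>\<omega>. op_norm {1..d1} {1..d2} (matrix_chaos q m H A \<omega>))
       in ereal c * (ereal \<sigma> -
            ereal C * Lp_norm M (max 2 L) h ^ q * ereal (L powr (real q / 2)) * ereal r)
            \<le> ereal EY \<and>
          ereal EY \<le> ereal C' * (ereal (L powr (real q / 2) * \<sigma>) +
            Lp_norm M L h ^ q * ereal (L powr (real (q + 1) / 2)) * ereal r)))"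
proof -
  define B where "B = step_const (real (q + 2))"
  have B: "B \<ge> 1" unfolding B_def by (rule step_const_ge_one) simp
  \<comment> \<open>\<open>?c\<close> inverts the factor \<open>4 ^ q\<close> of the lower bound. In
    \<open>?C\<close>, \<open>64 = 16 * 2 * 2\<close> because of \<open>a = 2 * \<alpha>\<close> and
    \<open>sqrt p \<le> 2 * sqrt L\<close>; in \<open>?C'\<close>, \<open>8 = 4 * 2\<close> because
    of \<open>a = 2 * \<alpha>\<close>.\<close>
  let ?c = "1 / 4 ^ q :: real" and ?C = "(64 * B) ^ q" and ?C' = "(8 * B) ^ q"
  show ?thesis
  proof (rule exI[of _ ?c], rule exI[of _ ?C], rule exI[of _ ?C'], intro conjI allI impI, goal_cases)
    case (4 m d1 d2 M h H A)
    then have m: "m \<ge> 1" and d: "d1 \<ge> 1" "d2 \<ge> 1" and M: "prob_space M" and h: "h \<in> borel_measurable M"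
      and mean: "(\<integral>\<omega>. h \<omega> \<partial>M) = 0" and var': "(\<integral>\<omega>. (h \<omega> - (\<integral>\<omega>. h \<omega> \<partial>M))\<^sup>2 \<partial>M) = 1"
      and iid: "iid_copies M q m h H" by auto
    interpret M: prob_space M by fact
    have var: "(\<integral>\<omega>. (h \<omega>)\<^sup>2 \<partial>M) = 1" using var' by (simp add: mean)
    \<comment> \<open>A function that is not integrable has Bochner integral 0, so unit variance
      forces square integrability.\<close>
    then have ivar: "integrable M (\<lambda>\<omega>. (h \<omega>)\<^sup>2)"
      using not_integrable_integral_eq by fastforce
    define L where "L = ln (real (max d1 d2 + m))"
    define p where "p = max 2 L"
    define \<sigma> where "\<sigma> = chaos_sigma q m d1 d2 A"
    define r where "r = chaos_r q m d1 d2 A"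
    define EY where "EY = (\<integral>\<omega>. op_norm {1..d1} {1..d2} (matrix_chaos q m H A \<omega>) \<partial>M)"
    have dm: "2 \<le> real (max d1 d2 + m)" using m d by simp
    have "ln 2 \<le> L" unfolding L_def using dm by simp
    then have L: "2 / 3 \<le> L" using ln2_ge_two_thirds by linarith
    then have L0: "0 < L" by simp
    \<comment> \<open>As \<open>L \<ge> ln 2 \<ge> 2/3\<close>, raising the exponent to 2 costs at
      most a factor 3, so \<open>sqrt p\<close> and \<open>sqrt L\<close> stay comparable.\<close>
    have p: "2 \<le> p" "p \<le> 3 * L" using L by (auto simp: p_def)
    have "real (max d1 d2 + m) = exp L" unfolding L_def using dm by simp
    then have dim: "real (max d1 d2 + m) \<le> exp p" by (simp add: p_def)
    have s0: "0 \<le> \<sigma>" unfolding \<sigma>_def by (rule chaos_sigma_nonneg)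
    have r0: "0 \<le> r" unfolding r_def by (rule chaos_r_nonneg[OF assms])
    have E0: "0 \<le> EY" by (simp add: EY_def integral_nonneg_AE op_norm_nonneg)
    have sqrtp: "sqrt p \<le> 2 * sqrt L"
    proof -
      have "sqrt p \<le> sqrt (4 * L)" using p L0 by (intro real_sqrt_le_mono) linarith
      then show ?thesis by (simp add: real_sqrt_mult)
    qed
    note tcI = tensor_chaosI[OF M h mean ivar var]
    have zero: "\<sigma> = 0 \<and> EY = 0" if "r = 0"
    proof -
      have r: "chaos_r q m d1 d2 A = 0" using that by (simp add: r_def)
      show ?thesis unfolding EY_def \<sigma>_def matrix_chaos_zero[OF assms r] by simp
    qed
    have Lpos: "0 < L powr (real q / 2)" "0 < L powr (real (q + 1) / 2)" using L0 by auto
    have lower: "ereal ?c * (ereal \<sigma> - ereal ?C * Lp_norm M p h ^ q * ereal (L powr (real q / 2)) * ereal r) \<le> ereal EY"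
    proof (cases "integrable M (\<lambda>\<omega>. \<bar>h \<omega>\<bar> powr p)")
      case True
      define \<alpha> where "\<alpha> = (\<integral>\<omega>. \<bar>h \<omega>\<bar> powr p \<partial>M) powr (1 / p)"
      note Lp = Lp_norm_real[OF M ivar var p(1) True, folded \<alpha>_def]
      have "\<sigma> \<le> 4 ^ q * EY + (16 * B) ^ q * (2 * \<alpha> * sqrt p) ^ q * r"
        unfolding \<sigma>_def r_def EY_def B_def
        by (rule chaos_bounds(3)[OF M h iid assms m tcI[OF p(1) Lp(3) True Lp(4) dim]])
      also have "\<dots> \<le> 4 ^ q * EY + (16 * B) ^ q * (2 * \<alpha> * (2 * sqrt L)) ^ q * r"
        using sqrtp Lp(2) B r0 p by (intro add_left_mono mult_right_mono mult_left_mono power_mono) auto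
      also have "\<dots> = 4 ^ q * EY + ?C * \<alpha> ^ q * L powr (real q / 2) * r"
      proof -
        have "(16 * B) ^ q * (2 * \<alpha> * (2 * sqrt L)) ^ q = (64 * B * \<alpha> * sqrt L) ^ q"
          unfolding power_mult_distrib[symmetric] by (simp add: mult_ac)
        also have "\<dots> = ?C * \<alpha> ^ q * L powr (real q / 2)"
          unfolding sqrt_power_eq_powr[OF L0, symmetric] power_mult_distrib by simp
        finally show ?thesis by simp
      qed
      finally have "?c * (\<sigma> - ?C * \<alpha> ^ q * L powr (real q / 2) * r) \<le> EY" by (simp add: field_simps)
      then show ?thesis unfolding Lp(1) by simp
    next
      case False
      \<comment> \<open>An infinite moment makes the left side \<open>- \<infinity>\<close> when
        \<open>r > 0\<close>; for \<open>r = 0\<close> the remainder is 0 and the tensor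
        vanishes.\<close>
      then have Lp: "Lp_norm M p h ^ q = \<infinity>" using assms by (simp add: Lp_norm_def ereal_top_power)
      show ?thesis
      proof (cases "r = 0")
        case True
        then show ?thesis using zero by (simp flip: zero_ereal_def)
      next
        case False
        then have "r > 0" using r0 by simp
        then have inf: "ereal ?C * Lp_norm M p h ^ q * ereal (L powr (real q / 2)) * ereal r = \<infinity>"
          unfolding Lp using B Lpos by simp
        show ?thesis unfolding inf by simp
      qed
    qed
    have upper: "ereal EY \<le> ereal ?C' * (ereal (L powr (real q / 2) * \<sigma>) + Lp_norm M L h ^ q * ereal (L powr (real (q + 1) / 2)) * ereal r)"
    proof (cases "L < 2")
      case True
      \<comment> \<open>For \<open>L < 2\<close> the crude bound with \<open>p = 2\<close> is
        enough, since all logarithms are comparable to constants. There \<open>a = 1\<close> is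
        admissible because \<open>h\<close> has unit variance, and the nonnegative \<open>r\<close>
        term is simply added.\<close>
      then have p2: "p = 2" by (simp add: p_def)
      have sq: "\<bar>x\<bar> powr p = x\<^sup>2" for x :: real unfolding p2 by (cases "x = 0") (auto simp: powr_numeral)
      have "tensor_chaos (distr M borel h) p 1 (q + 2) (chaos_dim q m d1 d2)"
        by (rule tcI) (use p dim ivar var in \<open>simp_all add: sq\<close>)
      then have "EY \<le> (2 * B * (1 * sqrt p)) ^ q * \<sigma>"
        unfolding \<sigma>_def EY_def B_def by (rule chaos_bounds(1)[OF M h iid assms m])
      also have "\<dots> \<le> (8 * B * sqrt L) ^ q * \<sigma>"
      proof (intro mult_right_mono power_mono s0)
        have "2 * B * sqrt p \<le> 2 * B * (2 * sqrt L)" using sqrtp B by (intro mult_left_mono) auto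
        also have "\<dots> \<le> 8 * B * sqrt L" using B L0 by simp
        finally show "2 * B * (1 * sqrt p) \<le> 8 * B * sqrt L" by simp
      qed (use B p in auto)
      also have "\<dots> = ?C' * (L powr (real q / 2) * \<sigma>)"
        unfolding power_mult_distrib sqrt_power_eq_powr[OF L0] by simp
      finally have "ereal EY \<le> ereal ?C' * ereal (L powr (real q / 2) * \<sigma>)" by simp
      also have "\<dots> \<le> ereal ?C' * (ereal (L powr (real q / 2) * \<sigma>) + Lp_norm M L h ^ q * ereal (L powr (real (q + 1) / 2)) * ereal r)"
      proof (intro ereal_mult_left_mono)
        have "0 \<le> Lp_norm M L h" by (simp add: Lp_norm_def)
        then have "0 \<le> Lp_norm M L h ^ q * ereal (L powr (real (q + 1) / 2)) * ereal r"
          using r0 by (simp add: ereal_0_le_mult)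
        then show "ereal (L powr (real q / 2) * \<sigma>)
            \<le> ereal (L powr (real q / 2) * \<sigma>) + Lp_norm M L h ^ q * ereal (L powr (real (q + 1) / 2)) * ereal r"
          using add_left_mono[of 0] by (metis add.right_neutral)
      qed (use B in simp)
      finally show ?thesis .
    next
      case False
      then have pL: "p = L" by (simp add: p_def)
      show ?thesis
      proof (cases "integrable M (\<lambda>\<omega>. \<bar>h \<omega>\<bar> powr p)")
        case True
        define \<alpha> where "\<alpha> = (\<integral>\<omega>. \<bar>h \<omega>\<bar> powr p \<partial>M) powr (1 / p)"
        note Lp = Lp_norm_real[OF M ivar var p(1) True, folded \<alpha>_def]
        have "EY \<le> (4 * B) ^ q * (sqrt p ^ q * \<sigma> + (2 * \<alpha>) ^ q * sqrt p ^ Suc q * r)"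
          unfolding \<sigma>_def r_def EY_def B_def
          by (rule chaos_bounds(2)[OF M h iid assms m tcI[OF p(1) Lp(3) True Lp(4) dim]])
        also have "\<dots> \<le> (4 * B) ^ q * (2 ^ q * (sqrt p ^ q * \<sigma>) + (2 * \<alpha>) ^ q * sqrt p ^ Suc q * r)"
        proof (intro mult_left_mono add_right_mono)
          have "1 * (sqrt p ^ q * \<sigma>) \<le> 2 ^ q * (sqrt p ^ q * \<sigma>)"
            using p s0 by (intro mult_right_mono) auto
          then show "sqrt p ^ q * \<sigma> \<le> 2 ^ q * (sqrt p ^ q * \<sigma>)" by simp
        qed (use B in simp)
        also have "\<dots> = ?C' * (sqrt p ^ q * \<sigma> + \<alpha> ^ q * sqrt p ^ Suc q * r)"
        proof -
          have "?C' = (4 * B) ^ q * 2 ^ q" unfolding power_mult_distrib[symmetric] by simp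
          then show ?thesis by (simp only: power_mult_distrib[of 2 \<alpha>] distrib_left mult.assoc mult.left_commute)
        qed
        also have "\<dots> = ?C' * (L powr (real q / 2) * \<sigma> + \<alpha> ^ q * L powr (real (q + 1) / 2) * r)"
          unfolding pL using sqrt_power_eq_powr[OF L0, of q] sqrt_power_eq_powr[OF L0, of "Suc q"]
          by (simp only: Suc_eq_plus1)
        finally show ?thesis using Lp(1) unfolding pL by simp
      next
        case False
        then have Lp: "Lp_norm M L h ^ q = \<infinity>" using assms by (simp add: Lp_norm_def ereal_top_power pL)
        show ?thesis
        proof (cases "r = 0")
          case True
          then show ?thesis using zero by (simp flip: zero_ereal_def)
        next
          case False
          then have "r > 0" using r0 by simp
          then have inf: "Lp_norm M L h ^ q * ereal (L powr (real (q + 1) / 2)) * ereal r = \<infinity>"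
            unfolding Lp using Lpos by simp
          show ?thesis unfolding inf using B by simp
        qed
      qed
    qed
    show ?case
      using lower upper unfolding Let_def L_def[symmetric] p_def[symmetric] \<sigma>_def[symmetric] r_def[symmetric]
        EY_def[symmetric] by blast
  qed (use B in auto)
qed

end
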